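(* For $k\ge1$, $s\in\{0,1\}^k$ and $\eta\in(0,1/2)$ let $P_{s,\eta}$ be the noisy parity distribution on $k+1$ bits: for $x\in\{0,1\}^k$, $$P_{s,\eta}(x,\,x\cdot s)=(1-\eta)2^{-k},\qquad P_{s,\eta}(x,\,\neg(x\cdot s))=\eta\,2^{-k},$$ where $x\cdot s=\sum_i x_is_i \bmod 2$. Let $\mathbb{1}^{k}$ denote the uniform distribution on $\{0,1\}^k$. Assume that there is $\eta\in(0,1/2)$ such that the class of product distributions $\{P_{s,\eta}\otimes\mathbb{1}^{k}: s\in\{0,1\}^k\}$ on $2k+1$ bits is not efficiently learnable with respect to an evaluator (in time polynomial in $k$, $1/\epsilon$, $1/\delta$). Then the class of output distributions of IQP circuits with $N^{\Omega(1)}$ two-qubit gates is not efficiently learnable with respect to an evaluator either; that is, for every constant $c>0$, the class $\mathcal{D}_N$ of output distributions of $N$-qubit IQP circuits with at most $N^c$ two-qubit gates is not efficiently learnable with respect to an evaluator.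
   Context: IQP circuits: an $N$-qubit IQP circuit with angles $\theta_i$ ($1\le i\le N$) and $\phi_{ij}$ ($(i,j)\in E$), where $E$ is a set of pairs $i<j$, prepares $$|\psi\rangle=H^{\otimes N}\exp\Big[i\sum_i\theta_iZ_i\Big]\exp\Big[i\sum_{(i,j)\in E}\phi_{ij}Z_iZ_j\Big]|+\rangle^{\otimes N},$$ with $H$ the Hadamard gate, $Z_i$ the Pauli-$Z$ matrix on qubit $i$, and $|+\rangle=(|0\rangle+|1\rangle)/\sqrt2$. Its number of two-qubit gates is $|E|$, and its output distribution is $p(x)=|\langle x|\psi\rangle|^2$ on $\{0,1\}^N$. The angles are arbitrary in $[0,2\pi]$ and $E$ is arbitrary. Efficient learnability: a class $\mathcal{D}_N$ of distributions over $\{0,1\}^N$ is efficiently learnable with respect to an evaluator if there is a classical algorithm that, for any target distribution $P\in\mathcal{D}_N$ and any given $\epsilon,\delta\in(0,1]$, given access to independent samples from $P$, outputs, with probability at least $1-\delta$ and in time polynomial in $1/\epsilon$, $1/\delta$ and $N$, a circuit for evaluating $x\mapsto Q(x)$, where $Q$ is a probability distribution on $\{0,1\}^N$ with $\mathrm{TV}(P,Q)=\frac12\sum_x|P(x)-Q(x)|\le\epsilon$. *)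

theory Defs
  imports "HOL-Probability.Probability"
begin

section \<open>Bit strings\<close>

definition bits :: "nat \<Rightarrow> bool list set" where
  "bits N = {x. length x = N}"

lemma bits_0: "bits 0 = {[]}"
  by (auto simp: bits_def)

lemma bits_Suc: "bits (Suc n) = (#) False ` bits n \<union> (#) True ` bits n"
proof -
  have "x \<in> (#) False ` bits n \<union> (#) True ` bits n" if "length x = Suc n" for x :: "bool list"
    using that by (cases x; cases "hd x") (auto simp: bits_def)
  then show ?thesis by (auto simp: bits_def)
qed

lemma finite_bits: "finite (bits n)"
  by (induction n) (auto simp: bits_0 bits_Suc)

lemma bits_nonempty: "bits n \<noteq> {}"
  by (induction n) (auto simp: bits_0 bits_Suc)

lemma sum_bits_Suc:
  fixes f :: "bool list \<Rightarrow> 'a::comm_monoid_add"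
  shows "(\<Sum>x\<in>bits (Suc n). f x) = (\<Sum>x\<in>bits n. f (False # x)) + (\<Sum>x\<in>bits n. f (True # x))"
  unfolding bits_Suc
  by (subst sum.union_disjoint) (auto simp: finite_bits sum.reindex)

lemma card_bits: "card (bits n) = 2 ^ n"
proof (induction n)
  case 0
  show ?case by (simp add: bits_0)
next
  case (Suc n)
  then show ?case using sum_bits_Suc[of "\<lambda>_. 1::nat" n] by simp
qed


section \<open>IQP circuits\<close>

text \<open>
  A state of \<open>N\<close> qubits is given by its amplitudes on \<open>bits N\<close>. Qubits are numbered
  from \<open>0\<close> to \<open>N - 1\<close>.
\<close>

type_synonym state = "bool list \<Rightarrow> complex"

definition pauli_Z :: "nat \<Rightarrow> state \<Rightarrow> state" where
  "pauli_Z i v = (\<lambda>x. if x ! i then - v x else v x)"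

definition hadamard :: "bool \<Rightarrow> bool \<Rightarrow> complex" where
  "hadamard a b = (if a \<and> b then - 1 else 1) / complex_of_real (sqrt 2)"

definition hadamard_tensor :: "nat \<Rightarrow> state \<Rightarrow> state" where
  "hadamard_tensor N v = (\<lambda>x. \<Sum>z\<in>bits N. (\<Prod>i<N. hadamard (x ! i) (z ! i)) * v z)"

definition plus_ket :: "bool \<Rightarrow> complex" where
  "plus_ket b = 1 / complex_of_real (sqrt 2)"

definition plus_tensor :: "nat \<Rightarrow> state" where
  "plus_tensor N = (\<lambda>x. \<Prod>i<N. plus_ket (x ! i))"

text \<open>The exponential series of an operator, evaluated amplitude by amplitude.\<close>

definition op_exp :: "(state \<Rightarrow> state) \<Rightarrow> state \<Rightarrow> state" where
  "op_exp A v = (\<lambda>x. \<Sum>n. (A ^^ n) v x / fact n)"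

definition one_qubit_generator :: "nat \<Rightarrow> (nat \<Rightarrow> real) \<Rightarrow> state \<Rightarrow> state" where
  "one_qubit_generator N \<theta> v = (\<lambda>x. \<i> * (\<Sum>i<N. complex_of_real (\<theta> i) * pauli_Z i v x))"

definition two_qubit_generator ::
  "(nat \<times> nat) set \<Rightarrow> (nat \<Rightarrow> nat \<Rightarrow> real) \<Rightarrow> state \<Rightarrow> state" where
  "two_qubit_generator E \<phi> v =
     (\<lambda>x. \<i> * (\<Sum>(i, j)\<in>E. complex_of_real (\<phi> i j) * pauli_Z i (pauli_Z j v) x))"

definition iqp_state ::
  "nat \<Rightarrow> (nat \<times> nat) set \<Rightarrow> (nat \<Rightarrow> real) \<Rightarrow> (nat \<Rightarrow> nat \<Rightarrow> real) \<Rightarrow> state" where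
  "iqp_state N E \<theta> \<phi> =
     hadamard_tensor N
       (op_exp (one_qubit_generator N \<theta>)
         (op_exp (two_qubit_generator E \<phi>)
           (plus_tensor N)))"

definition iqp_output ::
  "nat \<Rightarrow> (nat \<times> nat) set \<Rightarrow> (nat \<Rightarrow> real) \<Rightarrow> (nat \<Rightarrow> nat \<Rightarrow> real) \<Rightarrow> bool list pmf \<Rightarrow> bool" where
  "iqp_output N E \<theta> \<phi> P \<longleftrightarrow>
     set_pmf P \<subseteq> bits N \<and> (\<forall>x\<in>bits N. pmf P x = (cmod (iqp_state N E \<theta> \<phi> x))\<^sup>2)"

definition iqp_class :: "real \<Rightarrow> nat \<Rightarrow> bool list pmf set" where
  "iqp_class c N =
     {P. \<exists>E \<theta> \<phi>.
           E \<subseteq> {(i, j). i < j \<and> j < N} \<and> real (card E) \<le> real N powr c \<and>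
           (\<forall>i<N. \<theta> i \<in> {0..2 * pi}) \<and> (\<forall>(i, j)\<in>E. \<phi> i j \<in> {0..2 * pi}) \<and>
           iqp_output N E \<theta> \<phi> P}"

text \<open>
  The squared amplitudes sum to one, so every circuit has an output distribution in
  the sense of \<^const>\<open>iqp_output\<close>.
\<close>

lemma op_exp_diagonal:
  assumes "\<And>v x. A v x = a x * v x"
  shows "op_exp A v x = exp (a x) * v x"
proof -
  have pow: "(A ^^ n) v x = a x ^ n * v x" for n
    by (induction n) (simp_all add: assms mult.assoc)
  have "(\<lambda>n. a x ^ n /\<^sub>R fact n) sums exp (a x)"
    by (rule exp_converges)
  then have "(\<lambda>n. (a x ^ n /\<^sub>R fact n) * v x) sums (exp (a x) * v x)"
    by (rule sums_mult2)
  moreover have "(a x ^ n /\<^sub>R fact n) * v x = (A ^^ n) v x / fact n" for n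
    by (simp add: pow scaleR_conv_of_real field_simps)
  ultimately have "(\<lambda>n. (A ^^ n) v x / fact n) sums (exp (a x) * v x)"
    by simp
  then show ?thesis
    by (simp add: op_exp_def sums_iff)
qed

lemma op_exp_one_qubit:
  "op_exp (one_qubit_generator N \<theta>) v x =
     exp (\<i> * complex_of_real (\<Sum>i<N. \<theta> i * (if x ! i then - 1 else 1))) * v x"
  by (rule op_exp_diagonal)
     (simp add: one_qubit_generator_def pauli_Z_def sum_distrib_left sum_distrib_right,
       rule sum.cong, auto)

lemma op_exp_two_qubit:
  "op_exp (two_qubit_generator E \<phi>) v x =
     exp (\<i> * complex_of_real (\<Sum>(i, j)\<in>E. \<phi> i j * (if x ! i = x ! j then 1 else - 1))) * v x"
  by (rule op_exp_diagonal)
     (simp add: two_qubit_generator_def pauli_Z_def sum_distrib_left sum_distrib_right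
        case_prod_unfold, rule sum.cong, auto)

lemma hadamard_tensor_0: "hadamard_tensor 0 v [] = v []"
  by (simp add: hadamard_tensor_def bits_0)

lemma hadamard_tensor_Cons:
  "hadamard_tensor (Suc n) v (b # x) =
     (hadamard_tensor n (\<lambda>z. v (False # z)) x +
      (if b then - 1 else 1) * hadamard_tensor n (\<lambda>z. v (True # z)) x) / complex_of_real (sqrt 2)"
  unfolding hadamard_tensor_def sum_bits_Suc
  by (simp only: prod.lessThan_Suc_shift nth_Cons_0 nth_Cons_Suc hadamard_def o_def)
     (simp add: sum_divide_distrib sum_distrib_left add_divide_distrib sum_negf)

lemma hadamard_tensor_unitary:
  "(\<Sum>x\<in>bits n. (cmod (hadamard_tensor n v x))\<^sup>2) = (\<Sum>x\<in>bits n. (cmod (v x))\<^sup>2)"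
proof (induction n arbitrary: v)
  case 0
  show ?case by (simp add: bits_0 hadamard_tensor_0)
next
  case (Suc n)
  have par: "(cmod ((a + b) / complex_of_real (sqrt 2)))\<^sup>2 +
      (cmod ((a - b) / complex_of_real (sqrt 2)))\<^sup>2 = (cmod a)\<^sup>2 + (cmod b)\<^sup>2" for a b :: complex
    by (simp only: norm_divide power_divide cmod_power2)
       (simp add: power2_eq_square field_simps)
  show ?case
    unfolding sum_bits_Suc hadamard_tensor_Cons
    by (simp add: sum.distrib[symmetric] par) (simp add: sum.distrib Suc.IH)
qed

lemma iqp_state_normalized: "(\<Sum>x\<in>bits N. (cmod (iqp_state N E \<theta> \<phi> x))\<^sup>2) = 1"
proof -
  have "(\<Sum>x\<in>bits N. (cmod (iqp_state N E \<theta> \<phi> x))\<^sup>2) = (\<Sum>x\<in>bits N. (cmod (plus_tensor N x))\<^sup>2)"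
    unfolding iqp_state_def
    by (simp add: hadamard_tensor_unitary op_exp_one_qubit op_exp_two_qubit norm_mult
          del: of_real_sum)
  also have "\<dots> = (\<Sum>x\<in>bits N. 1 / 2 ^ N)"
    by (simp add: plus_tensor_def plus_ket_def norm_divide norm_power power_divide power_even_eq[symmetric])
       (simp add: power_mult[symmetric] mult.commute[of _ 2] power_even_eq power_mult)
  finally show ?thesis
    by (simp add: card_bits)
qed

lemma iqp_output_exists: "\<exists>P. iqp_output N E \<theta> \<phi> P"
proof -
  define f where "f x = (if x \<in> bits N then (cmod (iqp_state N E \<theta> \<phi> x))\<^sup>2 else 0)" for x
  have "(\<integral>\<^sup>+ x. ennreal (f x) \<partial>count_space UNIV) = (\<Sum>x\<in>bits N. ennreal (f x))"
    by (rule nn_integral_count_space') (auto simp: f_def finite_bits)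
  also have "\<dots> = ennreal (\<Sum>x\<in>bits N. f x)"
    by (rule sum_ennreal) (simp add: f_def)
  also have "(\<Sum>x\<in>bits N. f x) = 1"
    using iqp_state_normalized[of N E \<theta> \<phi>] by (simp add: f_def)
  finally have one: "(\<integral>\<^sup>+ x. ennreal (f x) \<partial>count_space UNIV) = 1" by simp
  have nonneg: "\<And>x. 0 \<le> f x" by (simp add: f_def)
  have pmf: "pmf (embed_pmf f) x = f x" for x
    by (rule pmf_embed_pmf[OF nonneg one])
  have "iqp_output N E \<theta> \<phi> (embed_pmf f)"
    by (auto simp: iqp_output_def set_pmf_iff pmf f_def split: if_splits)
  then show ?thesis ..
qed


section \<open>Noisy parity distributions\<close>

definition parity_of :: "bool list \<Rightarrow> bool list \<Rightarrow> bool" where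
  "parity_of s x \<longleftrightarrow> (\<Sum>i<length s. of_bool (x ! i) * of_bool (s ! i)) mod 2 = (1::nat)"

definition noisy_parity :: "bool list \<Rightarrow> real \<Rightarrow> bool list pmf \<Rightarrow> bool" where
  "noisy_parity s \<eta> P \<longleftrightarrow>
     (let k = length s in
      set_pmf P \<subseteq> bits (k + 1) \<and>
      (\<forall>x\<in>bits k. pmf P (x @ [parity_of s x]) = (1 - \<eta>) / 2 ^ k \<and>
                   pmf P (x @ [\<not> parity_of s x]) = \<eta> / 2 ^ k))"

definition uniform_bits :: "nat \<Rightarrow> bool list pmf" where
  "uniform_bits k = pmf_of_set (bits k)"

definition product_dist :: "bool list pmf \<Rightarrow> bool list pmf \<Rightarrow> bool list pmf" where
  "product_dist P Q = map_pmf (\<lambda>(x, y). x @ y) (pair_pmf P Q)"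

text \<open>Like every family below, this one is indexed by the number of bits, here \<open>2 * k + 1\<close>.\<close>

definition noisy_parity_class :: "real \<Rightarrow> nat \<Rightarrow> bool list pmf set" where
  "noisy_parity_class \<eta> N =
     {product_dist P (uniform_bits k) | k s P.
        k \<ge> 1 \<and> N = 2 * k + 1 \<and> s \<in> bits k \<and> noisy_parity s \<eta> P}"

lemma noisy_parity_exists:
  assumes "0 \<le> \<eta>" "\<eta> \<le> 1"
  shows "\<exists>P. noisy_parity s \<eta> P"
proof -
  define k where "k = length s"
  define g where "g = (\<lambda>(x, e). x @ [parity_of s x \<noteq> e])"
  define P where "P = map_pmf g (pair_pmf (uniform_bits k) (bernoulli_pmf \<eta>))"
  have "inj g"
    by (auto simp: inj_def g_def)
  then have pmf: "pmf P (x @ [parity_of s x \<noteq> e]) = pmf (bernoulli_pmf \<eta>) e / 2 ^ k"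
    if "x \<in> bits k" for x e
    using that pmf_map_inj'[of g "pair_pmf (uniform_bits k) (bernoulli_pmf \<eta>)" "(x, e)"]
    by (simp add: P_def g_def pmf_pair uniform_bits_def bits_nonempty finite_bits card_bits)
  have "set_pmf P \<subseteq> bits (k + 1)"
    by (auto simp: P_def g_def uniform_bits_def bits_nonempty finite_bits bits_def[of "Suc k"])
       (simp add: bits_def)
  then have "noisy_parity s \<eta> P"
    using pmf[of _ False] pmf[of _ True] assms
    by (simp add: noisy_parity_def k_def[symmetric])
  then show ?thesis ..
qed


section \<open>Boolean circuits computing probabilities\<close>

text \<open>
  A circuit is a list of NAND gates together with a list of output wires. Wires are
  addressed relative to the current position: the wire list consists of the values of the
  gates evaluated so far, latest first, followed by the input bits, and wire \<open>i\<close> is its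
  \<open>i\<close>-th entry. An address beyond the end of this list denotes the constant \<open>False\<close>.
\<close>

type_synonym circuit = "(nat \<times> nat) list \<times> nat list"

definition wire :: "bool list \<Rightarrow> nat \<Rightarrow> bool" where
  "wire w i \<longleftrightarrow> i < length w \<and> w ! i"

fun eval_gates :: "(nat \<times> nat) list \<Rightarrow> bool list \<Rightarrow> bool list" where
  "eval_gates [] w = w"
| "eval_gates ((i, j) # gs) w = eval_gates gs ((\<not> (wire w i \<and> wire w j)) # w)"

fun eval_circuit :: "circuit \<Rightarrow> bool list \<Rightarrow> bool list" where
  "eval_circuit (gs, outs) x = map (wire (eval_gates gs x)) outs"

text \<open>Output bits are read in binary, the first one being the integer part.\<close>

definition binary_value :: "bool list \<Rightarrow> real" where
  "binary_value bs = (\<Sum>j<length bs. of_bool (bs ! j) / 2 ^ j)"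

definition circuit_fun :: "circuit \<Rightarrow> bool list \<Rightarrow> real" where
  "circuit_fun C x = binary_value (eval_circuit C x)"

definition is_distribution :: "nat \<Rightarrow> (bool list \<Rightarrow> real) \<Rightarrow> bool" where
  "is_distribution N Q \<longleftrightarrow> (\<forall>x\<in>bits N. 0 \<le> Q x) \<and> (\<Sum>x\<in>bits N. Q x) = 1"

definition tv :: "nat \<Rightarrow> (bool list \<Rightarrow> real) \<Rightarrow> (bool list \<Rightarrow> real) \<Rightarrow> real" where
  "tv N P Q = (1 / 2) * (\<Sum>x\<in>bits N. \<bar>P x - Q x\<bar>)"


section \<open>Randomized algorithms with sample access\<close>

text \<open>
  Classical algorithms are programs of Jones's language WHILE ("Computability and
  Complexity from a Programming Perspective", MIT Press 1997), whose data are binary trees,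
  extended by fair coin flips and by a command that draws a fresh sample. Time is the number
  of execution steps. A step performs a bounded number of pointer operations on trees with
  shared subtrees, so polynomial time for these programs coincides with polynomial time for
  Turing machines. Sharing also means that a tree may be exponentially larger than the time
  spent on building it, but the maximal depth in a store grows by at most a constant per step, apart from the
  samples, which have depth at most \<open>N + 1\<close>; hence the lists
  and unary numbers that make up an encoded circuit are of polynomial length.
\<close>

datatype tree = Leaf | Node tree tree

datatype expr = Var nat | Nil_tree | Pair expr expr | Head expr | Tail expr

datatype com =
    Skip
  | Assign nat expr
  | Flip nat
  | Sample nat
  | Sequence com com
  | Cond expr com com
  | While expr com

type_synonym store = "nat \<Rightarrow> tree"

fun tree_head :: "tree \<Rightarrow> tree" where
  "tree_head Leaf = Leaf"
| "tree_head (Node l r) = l"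

fun tree_tail :: "tree \<Rightarrow> tree" where
  "tree_tail Leaf = Leaf"
| "tree_tail (Node l r) = r"

fun eval_expr :: "expr \<Rightarrow> store \<Rightarrow> tree" where
  "eval_expr (Var n) \<sigma> = \<sigma> n"
| "eval_expr Nil_tree \<sigma> = Leaf"
| "eval_expr (Pair e f) \<sigma> = Node (eval_expr e \<sigma>) (eval_expr f \<sigma>)"
| "eval_expr (Head e) \<sigma> = tree_head (eval_expr e \<sigma>)"
| "eval_expr (Tail e) \<sigma> = tree_tail (eval_expr e \<sigma>)"

fun enc_list :: "('a \<Rightarrow> tree) \<Rightarrow> 'a list \<Rightarrow> tree" where
  "enc_list f [] = Leaf"
| "enc_list f (x # xs) = Node (f x) (enc_list f xs)"

definition enc_bool :: "bool \<Rightarrow> tree" where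
  "enc_bool b = (if b then Node Leaf Leaf else Leaf)"

text \<open>Numbers are encoded in unary.\<close>

fun enc_nat :: "nat \<Rightarrow> tree" where
  "enc_nat 0 = Leaf"
| "enc_nat (Suc n) = Node Leaf (enc_nat n)"

definition enc_gate :: "nat \<times> nat \<Rightarrow> tree" where
  "enc_gate g = Node (enc_nat (fst g)) (enc_nat (snd g))"

definition enc_circuit :: "circuit \<Rightarrow> tree" where
  "enc_circuit C = Node (enc_list enc_gate (fst C)) (enc_list enc_nat (snd C))"

text \<open>
  A configuration consists of the commands that remain to be executed and the store;
  halted configurations do not change any more. The first argument of \<open>step\<close> is the
  distribution from which samples are drawn.
\<close>

type_synonym config = "com list \<times> store"

fun step :: "bool list pmf \<Rightarrow> config \<Rightarrow> config pmf" where
  "step P ([], \<sigma>) = return_pmf ([], \<sigma>)"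
| "step P (Skip # cs, \<sigma>) = return_pmf (cs, \<sigma>)"
| "step P (Assign n e # cs, \<sigma>) = return_pmf (cs, \<sigma>(n := eval_expr e \<sigma>))"
| "step P (Flip n # cs, \<sigma>) =
     map_pmf (\<lambda>b. (cs, \<sigma>(n := enc_bool b))) (bernoulli_pmf (1 / 2))"
| "step P (Sample n # cs, \<sigma>) =
     map_pmf (\<lambda>x. (cs, \<sigma>(n := enc_list enc_bool x))) P"
| "step P (Sequence c d # cs, \<sigma>) = return_pmf (c # d # cs, \<sigma>)"
| "step P (Cond e c d # cs, \<sigma>) =
     return_pmf ((if eval_expr e \<sigma> \<noteq> Leaf then c else d) # cs, \<sigma>)"
| "step P (While e c # cs, \<sigma>) =
     return_pmf (if eval_expr e \<sigma> \<noteq> Leaf then c # While e c # cs else cs, \<sigma>)"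

fun steps :: "bool list pmf \<Rightarrow> nat \<Rightarrow> config \<Rightarrow> config pmf" where
  "steps P 0 cfg = return_pmf cfg"
| "steps P (Suc t) cfg = bind_pmf (step P cfg) (steps P t)"


section \<open>Efficient learnability with respect to an evaluator\<close>

text \<open>
  The real parameters are handed to the algorithm as the integers \<open>\<lceil>1 / \<epsilon>\<rceil>\<close> and \<open>\<lceil>1 / \<delta>\<rceil>\<close>.
\<close>

definition initial_store :: "nat \<Rightarrow> real \<Rightarrow> real \<Rightarrow> store" where
  "initial_store N \<epsilon> \<delta> =
     (\<lambda>_. Leaf)(0 := enc_nat N, 1 := enc_nat (nat \<lceil>1 / \<epsilon>\<rceil>), 2 := enc_nat (nat \<lceil>1 / \<delta>\<rceil>))"

definition good_evaluator :: "nat \<Rightarrow> bool list pmf \<Rightarrow> real \<Rightarrow> circuit \<Rightarrow> bool" where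
  "good_evaluator N P \<epsilon> C \<longleftrightarrow>
     is_distribution N (circuit_fun C) \<and> tv N (pmf P) (circuit_fun C) \<le> \<epsilon>"

definition halted_with_evaluator :: "nat \<Rightarrow> bool list pmf \<Rightarrow> real \<Rightarrow> config set" where
  "halted_with_evaluator N P \<epsilon> =
     {(cs, \<sigma>). cs = [] \<and> (\<exists>C. \<sigma> 0 = enc_circuit C \<and> good_evaluator N P \<epsilon> C)}"

text \<open>
  One program has to work for all \<open>N\<close>. The event of probability at least \<open>1 - \<delta>\<close> includes
  halting within the polynomial time bound.
\<close>

definition efficiently_learnable :: "(nat \<Rightarrow> bool list pmf set) \<Rightarrow> bool" where
  "efficiently_learnable \<D> \<longleftrightarrow>
     (\<exists>(prog :: com) (a :: nat) (d :: nat).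
        \<forall>N\<ge>1. \<forall>P\<in>\<D> N. \<forall>\<epsilon> \<delta> :: real.
          0 < \<epsilon> \<and> \<epsilon> \<le> 1 \<and> 0 < \<delta> \<and> \<delta> \<le> 1 \<longrightarrow>
          (\<exists>T :: nat. real T \<le> real a * (real N + 1 / \<epsilon> + 1 / \<delta>) ^ d \<and>
             measure_pmf.prob (steps P T ([prog], initial_store N \<epsilon> \<delta>))
               (halted_with_evaluator N P \<epsilon>) \<ge> 1 - \<delta>))"

end

theory Submission
  imports Defs
begin

text \<open>
  A star-shaped IQP circuit with angles \<open>\<pi> / 4\<close> on its edges outputs a noisy parity: the leaves are
  uniform, and each leaf with value \<open>1\<close> contributes a relative phase \<open>-1\<close> between the two branches of
  the centre, so that the centre returns their parity with probability \<open>cos\<^sup>2 \<theta>\<close>. Its number of gates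
  is the weight of the secret, hence at most \<open>M\<^sup>c\<close> once the secret is padded with zeros to \<open>M\<close> qubits,
  \<open>M\<close> a polynomial in \<open>N\<close>. A learner for IQP circuits can therefore be run on samples padded with
  uniform bits, and returns a circuit for some \<open>Q'\<close> close to the padded distribution.

  An evaluator for the original distribution has to be exactly normalized, and neither marginals nor
  conditionals of \<open>Q'\<close> are at hand. But all bits except the parity bit \<open>b\<close> are uniform in the target.
  So fix the padding to a random \<open>y\<close> and let \<open>q\<close> be the fractional part of the rescaled value of
  \<open>Q'\<close> at \<open>(y, x, 0, v)\<close>; give \<open>(x, 0, v)\<close> the weight \<open>q\<close> and \<open>(x, 1, v)\<close> the weight \<open>1 - q\<close>, up to the
  common factor. This is a distribution whatever \<open>Q'\<close> is. On average over \<open>y\<close> it is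
  close to the target, and Markov's inequality finishes the argument. If the expansion of \<open>q\<close> ends
  in a digit \<open>1\<close>, then \<open>1 - q\<close> arises by negating all other digits, so the circuit needs no arithmetic.
\<close>

section \<open>Noisy parities from star-shaped IQP circuits\<close>

text \<open>With r = ceil(1/c), padding by N^r bits gives (N^r)^c >= N, which exceeds the at most k
  gates of the star; r depends on c alone, so the padding stays polynomial. Reducing the rescaled
  value of Q' modulo its range could turn a small error into a large one by wrapping around. The
  target keeps a distance proportional to \<eta> from the ends of the range, so this costs only a
  factor 1/\<eta>. The learner is therefore asked for accuracy 1/R with R >= 6/(\<eta> \<epsilon>
  \<delta>), which makes a random padding fail with probability at most \<delta>/2, and for
  confidence 1 - \<delta>/2. Two obstacles shape the rest. Circuits address wires relatively and
  read False beyond the end, so a learned circuit has to be shielded from the wires of the circuit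
  around it. And learnability bounds time only, while the reduction has to walk through the learned
  circuit; as subtrees may be shared, the depth of its encoding is tracked instead of its size. The
  learner's running time is never tested: a run beyond the bound counts as a failure.\<close>

lemma sum_bits_prod:
  fixes f :: "nat \<Rightarrow> bool \<Rightarrow> 'a::comm_semiring_1"
  shows "(\<Sum>z\<in>bits n. \<Prod>i<n. f i (z ! i)) = (\<Prod>i<n. f i False + f i True)"
proof (induction n arbitrary: f)
  case 0
  show ?case by (simp add: bits_0)
next
  case (Suc n)
  show ?case
    unfolding sum_bits_Suc prod.lessThan_Suc_shift
    by (simp add: sum_distrib_left[symmetric] Suc.IH[of "\<lambda>i. f (Suc i)", simplified] distrib_right)
qed

text \<open>The eigenvalue of Pauli Z on a basis state.\<close>

definition sgnb :: "bool \<Rightarrow> real" where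
  "sgnb b = (if b then - 1 else 1)"

definition star :: "nat set \<Rightarrow> nat \<Rightarrow> (nat \<times> nat) set" where
  "star S m = (\<lambda>i. (i, m)) ` S"

text \<open>Conditioned on the value \<open>c\<close> of the centre, every coupling acts as a
  single-qubit rotation, so the sum over all basis states factorizes over the qubits. The two values
  of \<open>c\<close> are the two interfering branches.\<close>

lemma star_amplitude:
  assumes S: "S \<subseteq> {..<m}" and "m < N"
  shows "iqp_state N (star S m) \<theta> (\<lambda>_ _. \<phi>) x =
    (\<Sum>c\<in>{False, True}. hadamard (x ! m) c * cis (\<theta> m * sgnb c) / sqrt 2 *
       (\<Prod>i\<in>{..<N} - {m}. (cis (\<theta> i + (if i \<in> S then \<phi> * sgnb c else 0)) +
          (if x ! i then - 1 else 1) * cis (- (\<theta> i + (if i \<in> S then \<phi> * sgnb c else 0)))) / 2))"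
proof -
  \<comment> \<open>The indicator at the centre selects the strings \<open>z\<close> with
    \<open>z ! m = c\<close>, so summing over both values of \<open>c\<close> counts each
    \<open>z\<close> once, with a summand that is a product over qubits.\<close>
  define f where "f c i b = hadamard (x ! i) b * (1 / complex_of_real (sqrt 2)) *
     (if i = m then of_bool (b = c) * cis (\<theta> m * sgnb c)
      else cis (sgnb b * (\<theta> i + (if i \<in> S then \<phi> * sgnb c else 0))))" for c i b
  have summand: "(\<Prod>i<N. hadamard (x ! i) (z ! i)) *
      (exp (\<i> * complex_of_real (\<Sum>i<N. \<theta> i * (if z ! i then - 1 else 1))) *
       (exp (\<i> * complex_of_real (\<Sum>(i, j)\<in>star S m. \<phi> * (if z ! i = z ! j then 1 else - 1))) *
        plus_tensor N z)) = (\<Sum>c\<in>{False, True}. \<Prod>i<N. f c i (z ! i))" for z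
  proof -
    define c where "c = z ! m"
    have other: "(\<Prod>i<N. f (\<not> c) i (z ! i)) = 0"
      using \<open>m < N\<close> by (intro prod_zero bexI[of _ m]) (auto simp: f_def c_def)
    have "(\<Sum>c\<in>{False, True}. \<Prod>i<N. f c i (z ! i)) = (\<Prod>i<N. f c i (z ! i))"
      using other by (cases c) auto
    also have "\<dots> = (\<Prod>i<N. hadamard (x ! i) (z ! i)) * plus_tensor N z *
       (\<Prod>i<N. cis (sgnb (z ! i) * \<theta> i + (if i \<in> S then \<phi> * sgnb c * sgnb (z ! i) else 0)))"
      unfolding plus_tensor_def plus_ket_def prod.distrib[symmetric]
      using S by (intro prod.cong) (auto simp: f_def c_def algebra_simps)
    also have "(\<Prod>i<N. cis (sgnb (z ! i) * \<theta> i + (if i \<in> S then \<phi> * sgnb c * sgnb (z ! i) else 0)))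
      = cis (\<Sum>i<N. sgnb (z ! i) * \<theta> i + (if i \<in> S then \<phi> * sgnb c * sgnb (z ! i) else 0))"
      by (induction N) (auto simp: cis_mult)
    also have "(\<Sum>i<N. sgnb (z ! i) * \<theta> i + (if i \<in> S then \<phi> * sgnb c * sgnb (z ! i) else 0))
      = (\<Sum>i<N. \<theta> i * (if z ! i then - 1 else 1)) +
        (\<Sum>(i, j)\<in>star S m. \<phi> * (if z ! i = z ! j then 1 else - 1))"
    proof -
      have "(\<Sum>(i, j)\<in>star S m. \<phi> * (if z ! i = z ! j then 1 else - 1)) =
         (\<Sum>i\<in>S. \<phi> * sgnb c * sgnb (z ! i))"
        unfolding star_def by (subst sum.reindex) (auto simp: inj_on_def sgnb_def c_def intro!: sum.cong)
      also have "\<dots> = (\<Sum>i<N. if i \<in> S then \<phi> * sgnb c * sgnb (z ! i) else 0)"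
      proof -
        have "{..<N} \<inter> S = S" using assms by auto
        then show ?thesis by (subst sum.inter_restrict[symmetric]) auto
      qed
      finally show ?thesis by (simp add: sum.distrib sgnb_def mult.commute)
    qed
    finally show ?thesis
      by (simp add: cis_conv_exp exp_add distrib_left del: of_real_sum)
  qed
  have "iqp_state N (star S m) \<theta> (\<lambda>_ _. \<phi>) x = (\<Sum>z\<in>bits N. \<Sum>c\<in>{False, True}. \<Prod>i<N. f c i (z ! i))"
    unfolding iqp_state_def hadamard_tensor_def op_exp_one_qubit op_exp_two_qubit summand ..
  also have "\<dots> = (\<Sum>c\<in>{False, True}. \<Prod>i<N. f c i False + f c i True)"
    by (subst sum.swap) (simp only: sum_bits_prod)
  also have "\<dots> = (\<Sum>c\<in>{False, True}. (f c m False + f c m True) *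
       (\<Prod>i\<in>{..<N} - {m}. f c i False + f c i True))"
    using \<open>m < N\<close> by (intro sum.cong refl prod.remove) auto
  also have "\<dots> = (\<Sum>c\<in>{False, True}. hadamard (x ! m) c * cis (\<theta> m * sgnb c) / sqrt 2 *
       (\<Prod>i\<in>{..<N} - {m}. (cis (\<theta> i + (if i \<in> S then \<phi> * sgnb c else 0)) +
          (if x ! i then - 1 else 1) * cis (- (\<theta> i + (if i \<in> S then \<phi> * sgnb c else 0)))) / 2))"
  proof (intro sum.cong refl arg_cong2[of _ _ _ _ "(*)"] prod.cong)
    fix c
    show "f c m False + f c m True = hadamard (x ! m) c * cis (\<theta> m * sgnb c) / sqrt 2"
      by (cases c) (auto simp: f_def)
  next
    fix c i assume "i \<in> {..<N} - {m}"
    have sq: "complex_of_real (sqrt 2) * complex_of_real (sqrt 2) = 2"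
      by (simp flip: of_real_mult)
    show "f c i False + f c i True = (cis (\<theta> i + (if i \<in> S then \<phi> * sgnb c else 0)) +
          (if x ! i then - 1 else 1) * cis (- (\<theta> i + (if i \<in> S then \<phi> * sgnb c else 0)))) / 2"
      using \<open>i \<in> _\<close> by (simp add: f_def hadamard_def sgnb_def sq add_divide_distrib)
  qed
  finally show ?thesis .
qed

text \<open>Sine and cosine agree at pi/4, so a leaf contributes modulus \<open>1 / sqrt 2\<close>
  for either outcome; the centre affects only the sign for outcome 1.\<close>

lemma cis_pi4_factor:
  "(cis (pi / 4 * sgnb c) + (if b then - 1 else 1) * cis (- (pi / 4 * sgnb c))) / 2 =
     (if b then \<i> * complex_of_real (sgnb c) else 1) / complex_of_real (sqrt 2)"
  by (cases b; cases c)
    (auto simp: sgnb_def complex_eq_iff cos_45 sin_45 field_simps)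

text \<open>Leaves get the angle pi/4 from their coupling, isolated qubits have it as their own
  angle; both become uniform. With \<open>u\<close> ones outside the centre and \<open>w\<close>
  ones among the leaves, the phase \<open>\<i> ^ u\<close> is common to both branches and drops out
  of the modulus, while the relative sign \<open>(- 1) ^ w\<close> decides between cosine and
  sine.\<close>

lemma star_probability:
  assumes S: "S \<subseteq> {..<m}" and "m < N"
    and \<theta>: "\<And>i. i < N \<Longrightarrow> i \<noteq> m \<Longrightarrow> \<theta> i = (if i \<in> S then 0 else pi / 4)"
  shows "(cmod (iqp_state N (star S m) \<theta> (\<lambda>_ _. pi / 4) x))\<^sup>2 =
    (if x ! m = odd (card {i\<in>S. x ! i}) then (cos (\<theta> m))\<^sup>2 else (sin (\<theta> m))\<^sup>2) / 2 ^ (N - 1)"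
proof -
  define I where "I = {..<N} - {m}"
  define w where "w = card {i\<in>S. x ! i}"
  define u where "u = card {i\<in>I. x ! i}"
  have SI: "S \<subseteq> I" using assms by (auto simp: I_def)
  have fin: "finite I" by (simp add: I_def)
  have cardI: "card I = N - 1" using \<open>m < N\<close> by (simp add: I_def)
  have fac: "(\<Prod>i\<in>I. (cis (\<theta> i + (if i \<in> S then pi / 4 * sgnb c else 0)) +
          (if x ! i then - 1 else 1) * cis (- (\<theta> i + (if i \<in> S then pi / 4 * sgnb c else 0)))) / 2)
      = \<i> ^ u * complex_of_real (sgnb c) ^ w / complex_of_real (sqrt 2) ^ (N - 1)" for c
  proof -
    have "(\<Prod>i\<in>I. (cis (\<theta> i + (if i \<in> S then pi / 4 * sgnb c else 0)) +
          (if x ! i then - 1 else 1) * cis (- (\<theta> i + (if i \<in> S then pi / 4 * sgnb c else 0)))) / 2)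
      = (\<Prod>i\<in>I. (if x ! i then \<i> else 1) * (if i \<in> S \<and> x ! i then complex_of_real (sgnb c) else 1) / complex_of_real (sqrt 2))"
    proof (intro prod.cong refl)
      fix i assume "i \<in> I"
      then have "\<theta> i = (if i \<in> S then 0 else pi / 4)" using \<theta> by (auto simp: I_def)
      then show "(cis (\<theta> i + (if i \<in> S then pi / 4 * sgnb c else 0)) +
          (if x ! i then - 1 else 1) * cis (- (\<theta> i + (if i \<in> S then pi / 4 * sgnb c else 0)))) / 2
        = (if x ! i then \<i> else 1) * (if i \<in> S \<and> x ! i then complex_of_real (sgnb c) else 1) / complex_of_real (sqrt 2)"
        using cis_pi4_factor[of c "x ! i"] cis_pi4_factor[of False "x ! i"]
        by (cases "i \<in> S") (simp_all add: sgnb_def del: divide_const_simps)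
    qed
    also have "\<dots> = (\<Prod>i\<in>I. if x ! i then \<i> else 1) * (\<Prod>i\<in>I. if i \<in> S \<and> x ! i then complex_of_real (sgnb c) else 1)
       / complex_of_real (sqrt 2) ^ (N - 1)"
      by (simp add: prod_dividef prod.distrib cardI)
    also have "(\<Prod>i\<in>I. if x ! i then \<i> else 1) = \<i> ^ u"
      using fin by (simp add: prod.If_cases u_def Int_def)
    also have "(\<Prod>i\<in>I. if i \<in> S \<and> x ! i then complex_of_real (sgnb c) else 1) = complex_of_real (sgnb c) ^ w"
    proof -
      have "I \<inter> {i. i \<in> S \<and> x ! i} = {i\<in>S. x ! i}" using SI by auto
      then show ?thesis using fin by (simp add: prod.If_cases w_def)
    qed
    finally show ?thesis .
  qed
  \<comment> \<open>The factors \<open>1 / sqrt 2\<close> from the centre's Hadamard gate and from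
    its initial state combine to the 1/2.\<close>
  have amp: "iqp_state N (star S m) \<theta> (\<lambda>_ _. pi / 4) x =
      \<i> ^ u / complex_of_real (sqrt 2) ^ (N - 1) *
        ((cis (\<theta> m) + (if x ! m then - 1 else 1) * (- 1) ^ w * cis (- \<theta> m)) / 2)"
  proof -
    have sq: "complex_of_real (sqrt 2) * complex_of_real (sqrt 2) = 2"
      by (simp flip: of_real_mult)
    show ?thesis
      unfolding star_amplitude[OF S \<open>m < N\<close>] I_def[symmetric] fac
      by (simp add: hadamard_def sgnb_def sq field_simps)
  qed
  have two: "(cmod ((cis (\<theta> m) + (if x ! m then - 1 else 1) * (- 1) ^ w * cis (- \<theta> m)) / 2))\<^sup>2 =
     (if x ! m = odd w then (cos (\<theta> m))\<^sup>2 else (sin (\<theta> m))\<^sup>2)"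
  proof -
    have plus: "cis (\<theta> m) + cis (- \<theta> m) = 2 * complex_of_real (cos (\<theta> m))"
      and minus: "cis (\<theta> m) - cis (- \<theta> m) = 2 * \<i> * complex_of_real (sin (\<theta> m))"
      by (simp_all add: complex_eq_iff)
    show ?thesis
      by (cases "x ! m"; cases "odd w") (simp_all add: plus minus norm_mult)
  qed
  show ?thesis
    unfolding amp norm_mult power_mult_distrib two w_def[symmetric]
    by (simp add: norm_divide norm_power power_divide power_mult[symmetric] mult.commute[of _ 2] power_mult)
qed

text \<open>Since all strings in the support of \<open>P\<close> have the same length, a
  concatenation can be split in one way only.\<close>

lemma pmf_product_dist:
  assumes "set_pmf P \<subseteq> bits n" "x \<in> bits n"
  shows "pmf (product_dist P Q) (x @ y) = pmf P x * pmf Q y"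
proof -
  have "pmf (product_dist P Q) (x @ y) =
      measure_pmf.prob (pair_pmf P Q) (((\<lambda>(x, y). x @ y) -` {x @ y}) \<inter> set_pmf (pair_pmf P Q))"
    unfolding product_dist_def pmf_map by (simp only: measure_Int_set_pmf)
  also have "((\<lambda>(x, y). x @ y) -` {x @ y}) \<inter> set_pmf (pair_pmf P Q) = {(x, y)} \<inter> set_pmf (pair_pmf P Q)"
    using assms by (auto simp: bits_def append_eq_append_conv)
  also have "measure_pmf.prob (pair_pmf P Q) \<dots> = pmf P x * pmf Q y"
    by (simp only: measure_Int_set_pmf) (simp add: measure_pmf_single pmf_pair)
  finally show ?thesis .
qed

lemma set_pmf_uniform_bits: "set_pmf (uniform_bits n) = bits n"
  by (simp add: uniform_bits_def finite_bits bits_nonempty)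

lemma pmf_uniform_bits: "x \<in> bits n \<Longrightarrow> pmf (uniform_bits n) x = 1 / 2 ^ n"
  by (simp add: uniform_bits_def finite_bits bits_nonempty card_bits)

lemma set_pmf_product_dist:
  assumes "set_pmf P \<subseteq> bits m" "set_pmf Q \<subseteq> bits n"
  shows "set_pmf (product_dist P Q) \<subseteq> bits (m + n)"
  using assms by (fastforce simp: product_dist_def bits_def)

lemma bits_appendE:
  assumes "w \<in> bits (m + n)"
  obtains x y where "w = x @ y" "x \<in> bits m" "y \<in> bits n"
  using assms that[of "take m w" "drop m w"] by (auto simp: bits_def)

lemma bits_1: "b \<in> bits (Suc 0) \<longleftrightarrow> (\<exists>a. b = [a])"
  by (auto simp: bits_def length_Suc_conv)

lemma parity_of_iff: "parity_of s x \<longleftrightarrow> odd (card {i. i < length s \<and> s ! i \<and> x ! i})"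
proof -
  have "(\<Sum>i<length s. of_bool (x ! i) * of_bool (s ! i)) = (\<Sum>i<length s. if s ! i \<and> x ! i then 1 else (0::nat))"
    by (intro sum.cong) auto
  also have "\<dots> = card {i. i < length s \<and> s ! i \<and> x ! i}"
    by (subst sum.If_cases) (auto simp: Int_def lessThan_def)
  finally show ?thesis by (simp add: parity_of_def odd_iff_mod_2_eq_one)
qed

lemma pmf_noisy_parity:
  assumes "noisy_parity s \<eta> P" "x \<in> bits (length s)"
  shows "pmf P (x @ [b]) = (if b = parity_of s x then 1 - \<eta> else \<eta>) / 2 ^ length s"
proof -
  have "b = parity_of s x \<or> b = (\<not> parity_of s x)" by auto
  with assms show ?thesis by (auto simp: noisy_parity_def Let_def)
qed

text \<open>The parity bit at position \<open>p + k\<close> is the centre, and the ones of the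
  secret select the leaves among the \<open>k\<close> bits before it. Padding and trailing bits are
  isolated qubits. The star has at most \<open>k\<close> edges however long the padding is.\<close>

lemma padded_noisy_parity_in_iqp_class:
  assumes s: "s \<in> bits k" and np: "noisy_parity s \<eta> P" and \<eta>: "0 \<le> \<eta>" "\<eta> \<le> 1"
    and gates: "real k \<le> real (p + (2 * k + 1)) powr c"
  shows "product_dist (uniform_bits p) (product_dist P (uniform_bits k)) \<in> iqp_class c (p + (2 * k + 1))"
proof -
  define N where "N = p + (2 * k + 1)"
  define m where "m = p + k"
  define A where "A = {i. i < k \<and> s ! i}"
  define S where "S = (+) p ` A"
  \<comment> \<open>The centre's angle has squared cosine \<open>1 - \<eta>\<close>, the probability
    of the correct parity.\<close>
  define \<theta> where "\<theta> i = (if i = m then arccos (sqrt (1 - \<eta>)) else if i \<in> S then 0 else pi / 4)" for i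
  have ls: "length s = k" using s by (simp add: bits_def)
  have S: "S \<subseteq> {..<m}" by (auto simp: S_def A_def m_def)
  have mN: "m < N" by (simp add: m_def N_def)
  have root: "sqrt (1 - \<eta>) \<le> 1" "0 \<le> sqrt (1 - \<eta>)" using \<eta> by auto
  have cos2: "(cos (\<theta> m))\<^sup>2 = 1 - \<eta>"
  proof -
    have "cos (\<theta> m) = sqrt (1 - \<eta>)"
      using root unfolding \<theta>_def by (simp only: simp_thms if_True) (rule cos_arccos, linarith+)
    then show ?thesis using \<eta> by simp
  qed
  then have sin2: "(sin (\<theta> m))\<^sup>2 = \<eta>" by (simp add: sin_squared_eq)
  have P: "set_pmf P \<subseteq> bits (k + 1)" using np by (simp add: noisy_parity_def Let_def ls)
  have PU: "set_pmf (product_dist P (uniform_bits k)) \<subseteq> bits (2 * k + 1)"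
    using set_pmf_product_dist[OF P, of "uniform_bits k" k] by (simp add: set_pmf_uniform_bits mult_2)
  have "card A \<le> card {..<k}" by (rule card_mono) (auto simp: A_def)
  then have cardS: "card (star S m) \<le> k"
    using card_image_le[of S "\<lambda>i. (i, m)"] card_image_le[of A "(+) p"]
    by (simp add: star_def S_def A_def)
  have "iqp_output N (star S m) \<theta> (\<lambda>_ _. pi / 4) (product_dist (uniform_bits p) (product_dist P (uniform_bits k)))"
    unfolding iqp_output_def
  proof (intro conjI ballI)
    show "set_pmf (product_dist (uniform_bits p) (product_dist P (uniform_bits k))) \<subseteq> bits N"
      unfolding N_def by (rule set_pmf_product_dist[OF _ PU]) (simp add: set_pmf_uniform_bits)
    fix w assume "w \<in> bits N"
    then obtain y v where w1: "w = y @ v" "y \<in> bits p" and v: "v \<in> bits (k + (1 + k))"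
      unfolding N_def by (metis bits_appendE mult_2 add.assoc add.commute)
    then obtain x v2 where w2: "v = x @ v2" "x \<in> bits k" and v2: "v2 \<in> bits (1 + k)"
      by (metis bits_appendE)
    then obtain b z where w3: "v2 = [b] @ z" "z \<in> bits k"
      by (metis bits_appendE bits_1 One_nat_def)
    have len: "length y = p" "length x = k" using w1 w2 by (auto simp: bits_def)
    have w: "w = y @ (x @ [b]) @ z" using w1 w2 w3 by simp
    have wm: "w ! m = b" using len by (simp add: w m_def nth_append)
    have "{i \<in> S. w ! i} = (+) p ` {i. i < length s \<and> s ! i \<and> x ! i}"
      using len by (auto simp: S_def A_def w nth_append ls)
    then have par: "odd (card {i \<in> S. w ! i}) = parity_of s x"
      by (simp add: card_image parity_of_iff)
    have "pmf (product_dist (uniform_bits p) (product_dist P (uniform_bits k))) w =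
        1 / 2 ^ p * (pmf P (x @ [b]) * (1 / 2 ^ k))"
    proof -
      have "pmf (product_dist P (uniform_bits k)) ((x @ [b]) @ z) = pmf P (x @ [b]) * (1 / 2 ^ k)"
        using w2 w3 by (subst pmf_product_dist[OF P]) (simp_all add: pmf_uniform_bits bits_def)
      then show ?thesis
        unfolding w using w1 by (subst pmf_product_dist[of _ p])
          (simp_all add: set_pmf_uniform_bits pmf_uniform_bits)
    qed
    also have "\<dots> = (if b = parity_of s x then 1 - \<eta> else \<eta>) / 2 ^ (N - 1)"
      using w2(2) by (subst pmf_noisy_parity[OF np]) (simp_all add: ls N_def power_add mult_2)
    also have "\<dots> = (cmod (iqp_state N (star S m) \<theta> (\<lambda>_ _. pi / 4) w))\<^sup>2"
      by (subst star_probability[OF S mN]) (simp_all add: par wm cos2 sin2, simp add: \<theta>_def)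
    finally show "pmf (product_dist (uniform_bits p) (product_dist P (uniform_bits k))) w =
      (cmod (iqp_state N (star S m) \<theta> (\<lambda>_ _. pi / 4) w))\<^sup>2" .
  qed
  moreover have "star S m \<subseteq> {(i, j). i < j \<and> j < N}" using S mN by (auto simp: star_def)
  moreover have "real (card (star S m)) \<le> real N powr c"
    using cardS gates by (simp add: N_def)
  moreover have "\<theta> i \<in> {0..2 * pi}" for i
  proof -
    have "0 \<le> arccos (sqrt (1 - \<eta>)) \<and> arccos (sqrt (1 - \<eta>)) \<le> pi"
      using root by (intro arccos_bounded) linarith+
    then show ?thesis using pi_gt_zero unfolding \<theta>_def by auto
  qed
  moreover have "\<forall>(i, j)\<in>star S m. pi / 4 \<in> {0..2 * pi}"
    using pi_gt_zero by auto
  ultimately show ?thesis unfolding iqp_class_def N_def[symmetric] mem_Collect_eq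
    by (intro exI[of _ "star S m"] exI[of _ \<theta>] exI[of _ "\<lambda>_ _. pi / 4"] conjI allI impI)
qed


section \<open>Completing a circuit\<close>

lemma eval_gates_append: "eval_gates (gs @ hs) w = eval_gates hs (eval_gates gs w)"
  by (induction gs w rule: eval_gates.induct) auto

lemma length_eval_gates: "length (eval_gates gs w) = length gs + length w"
  by (induction gs w rule: eval_gates.induct) auto

lemma wire_Cons: "wire (b # w) i = (if i = 0 then b else wire w (i - 1))"
  by (cases i) (auto simp: wire_def)

lemma wire_append: "wire (v @ w) i = (if i < length v then v ! i else wire w (i - length v))"
  by (auto simp: wire_def nth_append)

lemma wire_replicate: "wire (replicate n b) i \<longleftrightarrow> i < n \<and> b"
  by (auto simp: wire_def)

lemma wire_beyond: "length w \<le> i \<Longrightarrow> \<not> wire w i"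
  by (simp add: wire_def)

text \<open>
  Each gate shifts all addresses by one, so repeating a gate with a fixed address negates
  consecutive wires from last to first.
\<close>

lemma eval_replicate:
  assumes "n \<le> Suc a"
  shows "eval_gates (replicate n (a, a)) w = map (\<lambda>i. \<not> wire w i) [Suc a - n..<Suc a] @ w"
  using assms
proof (induction n)
  case (Suc n)
  have "eval_gates (replicate (Suc n) (a, a)) w =
      (\<not> wire (eval_gates (replicate n (a, a)) w) a) # eval_gates (replicate n (a, a)) w"
    by (simp only: replicate_Suc replicate_append_same[symmetric] eval_gates_append) simp
  also have "wire (eval_gates (replicate n (a, a)) w) a = wire w (a - n)"
    using Suc by (cases "n = 0") (auto simp: wire_append)
  also have "eval_gates (replicate n (a, a)) w = map (\<lambda>i. \<not> wire w i) [Suc a - n..<Suc a] @ w"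
    using Suc by simp
  finally have "eval_gates (replicate (Suc n) (a, a)) w =
      map (\<lambda>i. \<not> wire w i) ((a - n) # [Suc (a - n)..<Suc a]) @ w"
    using Suc.prems by (simp add: Suc_diff_le del: upt_Suc replicate_Suc)
  also have "(a - n) # [Suc (a - n)..<Suc a] = [Suc a - Suc n..<Suc a]"
    using upt_conv_Cons[of "a - n" "Suc a"] by (simp del: upt_Suc)
  finally show ?case .
qed simp

text \<open>The last of the \<open>n\<close> gates sees \<open>length w + n - 1\<close> wires, so
  \<open>a\<close> is beyond the end for all of them and each computes NAND of False and
  False.\<close>

lemma eval_replicate_beyond:
  assumes "length w + n \<le> Suc a"
  shows "eval_gates (replicate n (a, a)) w = replicate n True @ w"
proof -
  have "map (\<lambda>i. \<not> wire w i) [Suc a - n..<Suc a] = replicate n True"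
    using assms by (intro nth_equalityI) (auto simp: wire_beyond simp del: upt_Suc)
  then show ?thesis using assms by (subst eval_replicate) auto
qed

text \<open>\<open>a\<close> is the address of the last wire of \<open>v\<close>. Negating from last
  to first while prepending the results preserves the order of the block.\<close>

lemma eval_replicate_block:
  assumes "a + 1 = length u + length v"
  shows "eval_gates (replicate (length v) (a, a)) (u @ v @ w) = map Not v @ u @ v @ w"
proof -
  have "map (\<lambda>i. \<not> wire (u @ v @ w) i) [Suc a - length v..<Suc a] = map Not v"
    using assms by (intro nth_equalityI) (auto simp: wire_append simp del: upt_Suc)
  then show ?thesis using assms by (subst eval_replicate) (auto simp del: upt_Suc)
qed

text \<open>The \<open>z\<close> wires \<open>False\<close> imitate the end of the wire list: an
  address that overshoots \<open>w\<close> by less than \<open>z\<close> reads \<open>False\<close>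
  either way. Each gate lengthens \<open>w\<close>, so the address bound survives the
  evaluation.\<close>

lemma eval_gates_padded:
  assumes "\<forall>(i, j)\<in>set gs. i < length w + z \<and> j < length w + z"
  shows "eval_gates gs (w @ replicate z False @ v) = eval_gates gs w @ replicate z False @ v"
  using assms
proof (induction gs w rule: eval_gates.induct)
  case (2 i j gs w)
  have "wire (w @ replicate z False @ v) a = wire w a" if "a < length w + z" for a
    using that by (auto simp: wire_append wire_def nth_append)
  with 2 show ?case by (auto simp: less_Suc_eq)
qed simp

text \<open>
  The wires after these gates are, latest first: the padded input \<open>u = rev ys @ x @ False # v\<close>, \<open>z\<close>
  wires \<open>False\<close>, the negation of \<open>u\<close>, \<open>z\<close> wires \<open>True\<close>, and the actual input. The wires \<open>False\<close>
  hide the rest from a circuit with addresses below \<open>z\<close>, which finds \<open>False\<close> beyond its own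
  wires. The address \<open>t\<close> is always beyond the end, so its gates yield \<open>True\<close>.
\<close>

definition input_gates :: "nat \<Rightarrow> nat \<Rightarrow> nat \<Rightarrow> bool list \<Rightarrow> (nat \<times> nat) list" where
  "input_gates k m z ys = (let a = 2 * k + z; t = 2 * k + 1 + z + m in
     replicate z (t, t) @ replicate k (a, a) @ (t, t) # replicate k (a, a) @
     map (\<lambda>y. if y then (m, m) else (t, t)) ys @
     replicate (m + z) (z + m - 1, z + m - 1))"

text \<open>Constants are obtained by negation: the address \<open>m\<close> always hits a wire that
  is true, the address \<open>t\<close> lies beyond the end. Prepending one result per gate reverses
  the list.\<close>

lemma eval_constants:
  assumes "length w + length ys \<le> t + 1" "\<And>i. i < length ys \<Longrightarrow> i \<le> m \<Longrightarrow> wire w (m - i)" "length ys \<le> m"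
  shows "eval_gates (map (\<lambda>y. if y then (m, m) else (t, t)) ys) w = map Not (rev ys) @ w"
  using assms
proof (induction ys rule: rev_induct)
  case (snoc y ys)
  have IH: "eval_gates (map (\<lambda>y. if y then (m, m) else (t, t)) ys) w = map Not (rev ys) @ w"
    using snoc.prems by (intro snoc.IH) auto
  have "wire (map Not (rev ys) @ w) m"
    using snoc.prems(2)[of "length ys"] snoc.prems(3) by (simp add: wire_append)
  moreover have "\<not> wire (map Not (rev ys) @ w) t"
    using snoc.prems by (intro wire_beyond) simp
  ultimately show ?case by (simp add: eval_gates_append IH)
qed simp

lemma eval_input_gates:
  assumes len: "length x = k" "length v = k" and m: "m = length ys + 2 * k + 1" and z: "m < z"
  shows "\<exists>rest. eval_gates (input_gates k m z ys) (x @ b # v) =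
      (rev ys @ x @ False # v) @ replicate z False @ rest @ True # x @ b # v \<and>
      length rest + 1 = m + z"
proof -
  define t where "t = 2 * k + 1 + z + m"
  \<comment> \<open>Once the \<open>z\<close> wires \<open>True\<close> are in front,
    \<open>a\<close> is the address of the last bit of \<open>v\<close>. After \<open>k + 1\<close>
    further gates the same address is that of the last bit of \<open>x\<close>, which skips the bit
    \<open>b\<close>.\<close>
  define a where "a = 2 * k + z"
  \<comment> \<open>The complement of the padded input followed by \<open>z\<close> wires
    \<open>True\<close>. As gates can only negate, a second pass over all of \<open>W\<close> yields
    the input and the separating wires \<open>False\<close>.\<close>
  define W where "W = map Not (rev ys) @ map Not x @ True # map Not v @ replicate z True"
  have lW: "length W = m + z" using len m by (simp add: W_def)
  have 1: "eval_gates (replicate z (t, t)) (x @ b # v) = replicate z True @ x @ b # v"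
    using len m by (intro eval_replicate_beyond) (simp add: t_def)
  have 2: "eval_gates (replicate k (a, a)) (replicate z True @ x @ b # v) =
      map Not v @ replicate z True @ x @ b # v"
    using eval_replicate_block[of a "replicate z True @ x @ [b]" v "[]"] len by (simp add: a_def)
  \<comment> \<open>This \<open>True\<close> is the negation of the value \<open>False\<close> that
    replaces the parity bit.\<close>
  have 3: "eval_gates ((t, t) # gs) (map Not v @ replicate z True @ x @ b # v) =
      eval_gates gs (True # map Not v @ replicate z True @ x @ b # v)" for gs
    using len m by (simp add: t_def wire_beyond)
  have 4: "eval_gates (replicate k (a, a)) (True # map Not v @ replicate z True @ x @ b # v) =
      map Not x @ True # map Not v @ replicate z True @ x @ b # v"
    using eval_replicate_block[of a "True # map Not v @ replicate z True" x "b # v"] len by (simp add: a_def)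
  have 5: "eval_gates (map (\<lambda>y. if y then (m, m) else (t, t)) ys)
      (map Not x @ True # map Not v @ replicate z True @ x @ b # v) = W @ x @ b # v"
  proof (subst eval_constants)
    fix i assume "i < length ys" "i \<le> m"
    then show "wire (map Not x @ True # map Not v @ replicate z True @ x @ b # v) (m - i)"
      using len m z by (auto simp: wire_append wire_Cons)
  qed (use len m in \<open>auto simp: t_def W_def\<close>)
  have 6: "eval_gates (replicate (m + z) (z + m - 1, z + m - 1)) (W @ x @ b # v) =
      map Not W @ W @ x @ b # v"
    using eval_replicate_block[of "z + m - 1" "[]" W "x @ b # v"] z lW by (simp add: add.commute)
  have "eval_gates (input_gates k m z ys) (x @ b # v) = map Not W @ W @ x @ b # v"
    unfolding input_gates_def Let_def t_def[symmetric] a_def[symmetric]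
    by (simp only: eval_gates_append 1 2 3 4 5 6)
  moreover have "map Not W = (rev ys @ x @ False # v) @ replicate z False"
    by (simp add: W_def comp_def)
  \<comment> \<open>The output of the very first gate, directly before the actual input; it later
    serves as the final digit 1.\<close>
  moreover have "W = butlast W @ [True]"
  proof -
    have "W \<noteq> []" "last W" using z by (auto simp: W_def)
    then show ?thesis by (metis append_butlast_last_id)
  qed
  ultimately show ?thesis
    using lW z by (intro exI[of _ "butlast W"]) (auto simp: append_eq_append_conv2)
qed

text \<open>The usual four-NAND construction of XOR. \<open>e\<close> is the number of gates already
  placed in front of the wires that \<open>a\<close> and \<open>b\<close> refer to.\<close>

fun xor_gates :: "nat \<Rightarrow> nat \<Rightarrow> nat list \<Rightarrow> (nat \<times> nat) list" where
  "xor_gates e b [] = []"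
| "xor_gates e b (a # as) =
     [(a + e, b + e), (Suc (a + e), 0), (Suc (Suc (b + e)), 1), (1, 0)] @ xor_gates (e + 4) b as"

lemma length_xor_gates: "length (xor_gates e b as) = 4 * length as"
  by (induction as arbitrary: e) auto

text \<open>Each XOR occupies four wires with its result in front, and later ones come first; hence
  the multiples of 4 in descending order.\<close>

lemma eval_xor_gates:
  assumes "length v = e"
  shows "\<exists>v'. eval_gates (xor_gates e b as) (v @ w) = v' @ v @ w \<and> length v' = 4 * length as \<and>
     (\<forall>t<length as. v' ! (4 * (length as - 1 - t)) = (wire w (as ! t) \<noteq> wire w b))"
  using assms
proof (induction as arbitrary: e v)
  case Nil
  then show ?case by simp
next
  case (Cons a as)
  define p where "p = wire w a"
  define q where "q = wire w b"
  define n where "n = (\<not> (p \<and> q))"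
  define v1 where "v1 = [p \<noteq> q, \<not> (q \<and> n), \<not> (p \<and> n), n] @ v"
  have "eval_gates (xor_gates e b (a # as)) (v @ w) = eval_gates (xor_gates (e + 4) b as) (v1 @ w)"
  proof -
    have "eval_gates [(a + e, b + e), (Suc (a + e), 0), (Suc (Suc (b + e)), 1), (1, 0)] (v @ w) = v1 @ w"
      using Cons.prems by (auto simp: wire_append wire_Cons v1_def p_def q_def n_def)
    then show ?thesis by (simp only: xor_gates.simps eval_gates_append)
  qed
  moreover obtain v' where v': "eval_gates (xor_gates (e + 4) b as) (v1 @ w) = v' @ v1 @ w"
     "length v' = 4 * length as"
     "\<And>t. t < length as \<Longrightarrow> v' ! (4 * (length as - 1 - t)) = (wire w (as ! t) \<noteq> wire w b)"
    using Cons.IH[of v1 "e + 4"] Cons.prems by (auto simp: v1_def)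
  ultimately have "eval_gates (xor_gates e b (a # as)) (v @ w) = (v' @ take 4 v1) @ v @ w"
    by (simp add: v1_def)
  moreover have "(v' @ take 4 v1) ! (4 * (length (a # as) - 1 - t)) = (wire w ((a # as) ! t) \<noteq> wire w b)"
    if "t < length (a # as)" for t
  proof (cases t)
    case 0
    then show ?thesis using v'(2) by (simp add: nth_append v1_def p_def q_def)
  next
    case (Suc t')
    then show ?thesis using that v'(2) v'(3)[of t'] by (auto simp: nth_append)
  qed
  moreover have "length (v' @ take 4 v1) = 4 * length (a # as)" using v'(2) by (simp add: v1_def)
  ultimately show ?case by blast
qed

text \<open>A bound on all addresses of the circuit. The sum rather than the maximum, because a
  program on unary numbers obtains it by additions alone.\<close>

definition address_sum :: "circuit \<Rightarrow> nat" where
  "address_sum C = sum_list (map (\<lambda>(i, j). i + j) (fst C)) + sum_list (snd C)"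

text \<open>Dropping the first \<open>m\<close> output digits multiplies the value by
  \<open>2 ^ m\<close> and reduces it modulo 2. After \<open>gs\<close>, the address
  \<open>length gs + k\<close> is that of the actual parity bit.\<close>

definition complete_gates :: "nat \<Rightarrow> nat \<Rightarrow> bool list \<Rightarrow> circuit \<Rightarrow> (nat \<times> nat) list" where
  "complete_gates k m ys C = (let z = m + 1 + address_sum C; gs = input_gates k m z ys @ fst C in
     gs @ xor_gates 0 (length gs + k) (drop m (snd C)))"

text \<open>The first address lies beyond the end and yields \<open>2 * k + 1\<close> leading zeros,
  that is, division by \<open>2 ^ (2 * k + 1)\<close>. The parity bit is at \<open>l + k\<close>;
  its \<open>r\<close> copies push the final digit 1, found at \<open>l - 1\<close>, to a negligible
  position.\<close>

definition complete_outs :: "nat \<Rightarrow> nat \<Rightarrow> nat \<Rightarrow> bool list \<Rightarrow> circuit \<Rightarrow> nat list" where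
  "complete_outs k m r ys C = (let l = length (complete_gates k m ys C); n = length (snd C) - m in
     replicate (2 * k + 1) (l + k + (2 * k + 1)) @
     map (\<lambda>t. 4 * (n - 1 - t)) [0..<n] @ replicate r (l + k) @ [l - 1])"

lemma eval_complete:
  assumes len: "length x = k" "length v = k" and m: "m = length ys + 2 * k + 1"
  shows "eval_circuit (complete_gates k m ys C, complete_outs k m r ys C) (x @ b # v) =
     replicate (2 * k + 1) False @ map (\<lambda>c. c \<noteq> b) (drop m (eval_circuit C (rev ys @ x @ False # v))) @
     replicate r b @ [True]"
proof -
  obtain gs os where C: "C = (gs, os)" by force
  \<comment> \<open>Larger than \<open>m\<close>, as \<open>eval_input_gates\<close> demands, and
    than every address in \<open>C\<close>.\<close>
  define z where "z = m + 1 + address_sum C"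
  define u where "u = rev ys @ x @ False # v"
  obtain rest where rest: "eval_gates (input_gates k m z ys) (x @ b # v) =
      u @ replicate z False @ rest @ True # x @ b # v" "length rest + 1 = m + z"
    using eval_input_gates[OF len m, of z b] by (auto simp: z_def u_def)
  have small_g: "i < z \<and> j < z" if "(i, j) \<in> set gs" for i j
    using member_le_sum_list[of "i + j" "map (\<lambda>(i, j). i + j) gs"] that
    by (force simp: z_def address_sum_def C)
  have small_o: "i < z" if "i \<in> set os" for i
    using member_le_sum_list[of i os] that by (force simp: z_def address_sum_def C)
  define g where "g = eval_gates gs u"
  define w where "w = g @ replicate z False @ rest @ True # x @ b # v"
  have w: "eval_gates (input_gates k m z ys @ gs) (x @ b # v) = w"
    unfolding eval_gates_append rest(1) w_def g_def
    by (rule eval_gates_padded) (use small_g in \<open>auto intro: trans_less_add2\<close>)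
  define l where "l = length (input_gates k m z ys @ gs)"
  have lw: "length w = l + 2 * k + 1"
    using len unfolding w[symmetric] length_eval_gates l_def by simp
  have w_b: "wire w (l + k) = b"
  proof -
    have "w = (g @ replicate z False @ rest @ True # x) @ b # v" by (simp add: w_def)
    moreover have "length (g @ replicate z False @ rest @ True # x) = l + k"
      using lw len by (simp add: w_def)
    ultimately show ?thesis by (simp only: wire_append) (simp add: wire_Cons)
  qed
  have w_T: "wire w (l - 1)" and l0: "0 < l"
  proof -
    have "w = (g @ replicate z False @ rest) @ True # x @ b # v" by (simp add: w_def)
    moreover have "length (g @ replicate z False @ rest) = l - 1" and "0 < l"
      using lw len by (simp_all add: w_def)
    ultimately show "wire w (l - 1)" "0 < l" by (simp_all only: wire_append) (simp add: wire_Cons)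
  qed
  \<comment> \<open>An output address past the end of \<open>g\<close> falls among the
    \<open>z\<close> wires \<open>False\<close>, so it has the value it had in the circuit on its
    own.\<close>
  have w_o: "wire w i = wire g i" if "i \<in> set os" for i
    using small_o[OF that] by (auto simp: w_def wire_append wire_replicate wire_beyond) (auto simp: wire_def)
  define as where "as = drop m os"
  obtain v' where v': "eval_gates (xor_gates 0 (l + k) as) w = v' @ w" "length v' = 4 * length as"
     "\<And>t. t < length as \<Longrightarrow> v' ! (4 * (length as - 1 - t)) = (wire w (as ! t) \<noteq> b)"
    using eval_xor_gates[of "[]" 0 "l + k" as w] w_b by auto
  have cg: "complete_gates k m ys C = (input_gates k m z ys @ gs) @ xor_gates 0 (l + k) as"
    by (simp add: complete_gates_def Let_def z_def C as_def l_def)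
  have lcg: "length (complete_gates k m ys C) = l + 4 * length as"
    by (simp add: cg length_xor_gates l_def)
  have eg: "eval_gates (complete_gates k m ys C) (x @ b # v) = v' @ w"
    unfolding cg eval_gates_append[of _ "xor_gates 0 (l + k) as"] w v'(1) ..
  have "map (wire (v' @ w)) (map (\<lambda>t. 4 * (length as - 1 - t)) [0..<length as]) =
      map (\<lambda>c. c \<noteq> b) (map (wire g) as)"
  proof (rule nth_equalityI)
    fix t assume "t < length (map (wire (v' @ w)) (map (\<lambda>t. 4 * (length as - 1 - t)) [0..<length as]))"
    then have t: "t < length as" by simp
    then have lt: "length as - Suc t < length as" by arith
    from t have "as ! t \<in> set os" unfolding as_def by (metis in_set_dropD nth_mem)
    then show "map (wire (v' @ w)) (map (\<lambda>t. 4 * (length as - 1 - t)) [0..<length as]) ! t =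
      map (\<lambda>c. c \<noteq> b) (map (wire g) as) ! t"
      using t lt v'(2) v'(3)[of t] w_o[of "as ! t"] by (simp add: wire_append)
  qed simp
  moreover have "wire (v' @ w) (l + 4 * length as + k) = b"
    using w_b v'(2) by (simp add: wire_append)
  moreover have "wire (v' @ w) (l + 4 * length as - 1) = True"
  proof -
    have "l + 4 * length as - 1 = length v' + (l - 1)" using v'(2) l0 by simp
    then show ?thesis using w_T by (simp only: wire_append) simp
  qed
  moreover have "\<not> wire (v' @ w) (l + 4 * length as + k + (2 * k + 1))"
    using lw v'(2) by (intro wire_beyond) simp
  moreover have "drop m (eval_circuit C (rev ys @ x @ False # v)) = map (wire g) as"
    by (simp add: C g_def u_def as_def drop_map)
  moreover have "length (snd C) - m = length as" by (simp add: C as_def)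
  ultimately show ?thesis
    by (simp add: complete_outs_def Let_def eg lcg del: map_map replicate_Suc upt_Suc mult_Suc_right)
qed


section \<open>Error of the completed circuit\<close>

lemma binary_value_Nil: "binary_value [] = 0"
  by (simp add: binary_value_def)

lemma binary_value_Cons: "binary_value (b # bs) = of_bool b + binary_value bs / 2"
  unfolding binary_value_def length_Cons sum.lessThan_Suc_shift
  by (simp add: sum_divide_distrib mult.commute)

lemma binary_value_append:
  "binary_value (bs @ cs) = binary_value bs + binary_value cs / 2 ^ length bs"
  by (induction bs) (simp_all add: binary_value_Nil binary_value_Cons add_divide_distrib)

lemma binary_value_False: "binary_value (replicate n False) = 0"
  by (induction n) (simp_all add: binary_value_Nil binary_value_Cons)

lemma binary_value_True: "binary_value (replicate n True) = 2 - 2 / 2 ^ n"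
  by (induction n) (simp_all add: binary_value_Nil binary_value_Cons field_simps)

lemma binary_value_Not: "binary_value (map Not bs) = 2 - 2 / 2 ^ length bs - binary_value bs"
  by (induction bs) (simp_all add: binary_value_Nil binary_value_Cons field_simps of_bool_not_iff)

lemma binary_value_nonneg: "0 \<le> binary_value bs"
  by (induction bs) (simp_all add: binary_value_Nil binary_value_Cons)

lemma binary_value_le: "binary_value bs \<le> 2 - 2 / 2 ^ length bs"
  using binary_value_nonneg[of "map Not bs"] by (simp add: binary_value_Not)

text \<open>The value is even because the first digit is the integer part; thus a prefix of digits
  vanishes modulo 2 after rescaling by its length.\<close>

lemma binary_value_scaled: "\<exists>n::nat. 2 ^ length bs * binary_value bs = 2 * real n"
proof (induction bs)
  case (Cons b bs)
  then obtain n :: nat where n: "2 ^ length bs * binary_value bs = 2 * real n" by blast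
  have "2 ^ length (b # bs) * binary_value (b # bs) = 2 * real (2 ^ length bs * of_bool b + n)"
    using n by (simp add: binary_value_Cons algebra_simps)
  then show ?case by blast
qed (simp add: binary_value_Nil)

lemma sum_bits_append:
  fixes f :: "bool list \<Rightarrow> 'a::comm_monoid_add"
  shows "(\<Sum>w\<in>bits (m + n). f w) = (\<Sum>x\<in>bits m. \<Sum>y\<in>bits n. f (x @ y))"
  by (induction m arbitrary: f) (simp_all add: bits_0 sum_bits_Suc)

lemma two_power_odd: "(2::'a::comm_semiring_1) ^ (2 * k + 1) = 2 * 2 ^ k * 2 ^ k"
  by (simp add: power_add power_mult power2_eq_square power_mult_distrib mult.commute[of 2 k] mult_ac)

lemma sum_bits_split:
  fixes f :: "bool list \<Rightarrow> 'a::comm_monoid_add"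
  shows "(\<Sum>w\<in>bits (2 * k + 1). f w) = (\<Sum>x\<in>bits k. \<Sum>v\<in>bits k. f (x @ False # v) + f (x @ True # v))"
  using sum_bits_append[of f k "Suc k"] by (simp add: sum_bits_Suc sum.distrib mult_2)

lemma sum_bits_rev:
  fixes f :: "bool list \<Rightarrow> 'a::comm_monoid_add"
  shows "(\<Sum>y\<in>bits n. f (rev y)) = (\<Sum>y\<in>bits n. f y)"
  by (rule sum.reindex_bij_witness[of _ rev rev]) (auto simp: bits_def)

text \<open>Dropping the integer part \<open>2 * n\<close> costs a factor of \<open>1 / \<eta>\<close>, as \<open>p\<close> stays away from the endpoint \<open>2\<close>.\<close>

lemma fractional_part_error:
  fixes n :: nat
  assumes \<eta>: "0 < \<eta>" "\<eta> \<le> 1" and p: "0 \<le> p" "p \<le> 2 - 2 * \<eta>" and g: "0 \<le> g" "g \<le> 2"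
  shows "\<bar>p - g\<bar> \<le> \<bar>p - (2 * real n + g)\<bar> / \<eta>"
proof (cases "n = 0")
  case True
  then show ?thesis using \<eta> by (simp add: field_simps mult_left_le_one_le)
next
  case False
  then have "1 \<le> real n" by simp
  then have "2 * \<eta> \<le> \<bar>p - (2 * real n + g)\<bar>" using p g by linarith
  then have "2 \<le> \<bar>p - (2 * real n + g)\<bar> / \<eta>" using \<eta> by (simp add: field_simps)
  moreover have "\<bar>p - g\<bar> \<le> 2" using p g \<eta> by linarith
  ultimately show ?thesis by linarith
qed

section \<open>Distance between the completed distribution and the noisy parity\<close>

context
  fixes k p r :: nat and C :: circuit
begin

definition completion :: "bool list \<Rightarrow> circuit" where
  "completion ys = (complete_gates k (p + 2 * k + 1) ys C, complete_outs k (p + 2 * k + 1) r ys C)"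

text \<open>The remaining digits followed by \<open>r\<close> zeros and a final 1, whose weight is
  the second summand.\<close>

definition frac_value :: "bool list \<Rightarrow> real" where
  "frac_value w = (let os = drop (p + 2 * k + 1) (eval_circuit C w)
     in binary_value os + 1 / 2 ^ (length os + r))"

text \<open>As in two's complement, negating all digits in front of a final 1 turns a value
  \<open>F\<close> into \<open>2 - F\<close>.\<close>

lemma circuit_fun_completion:
  assumes "x \<in> bits k" "v \<in> bits k" "ys \<in> bits p"
  shows "circuit_fun (completion ys) (x @ b # v) =
    (if b then 2 - frac_value (rev ys @ x @ False # v) else frac_value (rev ys @ x @ False # v)) / 2 ^ (2 * k + 1)"
proof -
  define os where "os = drop (p + 2 * k + 1) (eval_circuit C (rev ys @ x @ False # v))"
  have F: "frac_value (rev ys @ x @ False # v) = binary_value os + 1 / 2 ^ (length os + r)"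
    by (simp add: frac_value_def os_def Let_def)
  have "eval_circuit (completion ys) (x @ b # v) =
      replicate (2 * k + 1) False @ map (\<lambda>c. c \<noteq> b) os @ replicate r b @ [True]"
    unfolding completion_def os_def by (rule eval_complete) (use assms in \<open>auto simp: bits_def\<close>)
  then have "circuit_fun (completion ys) (x @ b # v) =
      binary_value (map (\<lambda>c. c \<noteq> b) os @ replicate r b @ [True]) / 2 ^ (2 * k + 1)"
    unfolding circuit_fun_def by (simp only: binary_value_append binary_value_False length_replicate)
  also have "binary_value (map (\<lambda>c. c \<noteq> b) os @ replicate r b @ [True]) =
      (if b then 2 - frac_value (rev ys @ x @ False # v) else frac_value (rev ys @ x @ False # v))"
    by (cases b) (simp_all add: F binary_value_append binary_value_Not binary_value_True
        binary_value_False binary_value_Cons binary_value_Nil power_add field_simps)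
  finally show ?thesis .
qed

lemma frac_value_bounds: "0 \<le> frac_value w" "frac_value w \<le> 2"
proof -
  define os where "os = drop (p + 2 * k + 1) (eval_circuit C w)"
  have "1 / 2 ^ (length os + r) \<le> (1::real) / 2 ^ length os"
    by (intro divide_left_mono) (simp_all add: power_add)
  moreover have "2 / 2 ^ length os = 2 * (1 / (2::real) ^ length os)" "0 \<le> 1 / (2::real) ^ length os"
    "0 \<le> 1 / (2::real) ^ (length os + r)"
    by simp_all
  ultimately show "0 \<le> frac_value w" "frac_value w \<le> 2"
    using binary_value_nonneg[of os] binary_value_le[of os]
    unfolding frac_value_def os_def[symmetric] Let_def by linarith+
qed

lemma completion_is_distribution:
  assumes "ys \<in> bits p"
  shows "is_distribution (2 * k + 1) (circuit_fun (completion ys))"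
  unfolding is_distribution_def
proof (intro conjI ballI)
  fix w assume "w \<in> bits (2 * k + 1)"
  then obtain x v' where "w = x @ v'" "x \<in> bits k" "v' \<in> bits (1 + k)"
    by (metis bits_appendE mult_2 add.assoc add.commute)
  moreover then obtain b v where "v' = [b] @ v" "v \<in> bits k"
    by (metis bits_appendE bits_1 One_nat_def)
  ultimately show "0 \<le> circuit_fun (completion ys) w"
    using assms frac_value_bounds by (simp add: circuit_fun_completion)
next
  have "(\<Sum>w\<in>bits (2 * k + 1). circuit_fun (completion ys) w) =
      (\<Sum>x\<in>bits k. \<Sum>v\<in>bits k. 2 / 2 ^ (2 * k + 1))"
    unfolding sum_bits_split
    by (intro sum.cong refl) (simp add: circuit_fun_completion assms diff_divide_distrib)
  also have "\<dots> = 1" unfolding two_power_odd by (simp add: card_bits)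
  finally show "(\<Sum>w\<in>bits (2 * k + 1). circuit_fun (completion ys) w) = 1" .
qed

context
  fixes s P\<^sub>0 P and \<eta> :: real
  assumes s: "s \<in> bits k" and np: "noisy_parity s \<eta> P\<^sub>0" and P: "P = product_dist P\<^sub>0 (uniform_bits k)"
    and \<eta>: "0 < \<eta>" "\<eta> < 1 / 2"
begin

text \<open>Over this denominator the numerators lie between \<open>2 * \<eta>\<close> and
  \<open>2 - 2 * \<eta>\<close>, the range in which \<open>fractional_part_error\<close> controls
  the reduction modulo 2.\<close>

lemma pmf_noisy_product:
  assumes "x \<in> bits k" "v \<in> bits k"
  shows "pmf P (x @ b # v) = (if b = parity_of s x then 2 - 2 * \<eta> else 2 * \<eta>) / 2 ^ (2 * k + 1)"
proof -
  have ls: "length s = k" using s by (simp add: bits_def)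
  have "pmf P ((x @ [b]) @ v) = pmf P\<^sub>0 (x @ [b]) * (1 / 2 ^ k)"
    using assms np unfolding P
    by (subst pmf_product_dist[of _ "k + 1"]) (auto simp: pmf_uniform_bits noisy_parity_def Let_def ls bits_def)
  also have "pmf P\<^sub>0 (x @ [b]) = (if b = parity_of s x then 1 - \<eta> else \<eta>) / 2 ^ k"
    using pmf_noisy_parity[OF np] assms ls by simp
  finally show ?thesis unfolding two_power_odd by (simp add: field_simps)
qed

lemma set_pmf_noisy_product: "set_pmf P \<subseteq> bits (2 * k + 1)"
  using set_pmf_product_dist[of P\<^sub>0 "k + 1" "uniform_bits k" k] np s
  by (simp add: P noisy_parity_def Let_def bits_def[of k] set_pmf_uniform_bits mult_2)

text \<open>Target and completion give the same total weight to the strings with parity bit 0 and 1,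
  so the errors at both coincide. This cancels the factor 1/2 and leaves only values of
  \<open>C\<close> at parity bit 0, the only ones that the completion uses.\<close>

lemma tv_completion:
  assumes "ys \<in> bits p"
  shows "tv (2 * k + 1) (pmf P) (circuit_fun (completion ys)) \<le>
    (\<Sum>x\<in>bits k. \<Sum>v\<in>bits k. 2 ^ p / \<eta> *
       \<bar>pmf (product_dist (uniform_bits p) P) (rev ys @ x @ False # v) - circuit_fun C (rev ys @ x @ False # v)\<bar>
       + 1 / 2 ^ r / 2 ^ (2 * k + 1))"
proof -
  let ?P' = "product_dist (uniform_bits p) P"
  have "tv (2 * k + 1) (pmf P) (circuit_fun (completion ys)) = (1 / 2) * (\<Sum>x\<in>bits k. \<Sum>v\<in>bits k.
       \<bar>pmf P (x @ False # v) - circuit_fun (completion ys) (x @ False # v)\<bar> +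
       \<bar>pmf P (x @ True # v) - circuit_fun (completion ys) (x @ True # v)\<bar>)"
    unfolding tv_def sum_bits_split ..
  also have "\<dots> = (\<Sum>x\<in>bits k. \<Sum>v\<in>bits k.
       \<bar>pmf P (x @ False # v) - frac_value (rev ys @ x @ False # v) / 2 ^ (2 * k + 1)\<bar>)"
    unfolding sum_distrib_left
  proof (intro sum.cong refl)
    fix x v assume xv: "x \<in> bits k" "v \<in> bits k"
    define F where "F = frac_value (rev ys @ x @ False # v)"
    have "pmf P (x @ True # v) = 2 / 2 ^ (2 * k + 1) - pmf P (x @ False # v)"
      using xv by (cases "parity_of s x") (simp_all add: pmf_noisy_product field_simps)
    then have "\<bar>pmf P (x @ True # v) - circuit_fun (completion ys) (x @ True # v)\<bar> =
        \<bar>pmf P (x @ False # v) - F / 2 ^ (2 * k + 1)\<bar>"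
      using xv assms by (simp add: circuit_fun_completion F_def diff_divide_distrib abs_minus_commute)
    then show "1 / 2 * (\<bar>pmf P (x @ False # v) - circuit_fun (completion ys) (x @ False # v)\<bar> +
       \<bar>pmf P (x @ True # v) - circuit_fun (completion ys) (x @ True # v)\<bar>) =
       \<bar>pmf P (x @ False # v) - F / 2 ^ (2 * k + 1)\<bar>"
      using xv assms by (simp add: circuit_fun_completion F_def)
  qed
  also have "\<dots> \<le> (\<Sum>x\<in>bits k. \<Sum>v\<in>bits k. 2 ^ p / \<eta> *
       \<bar>pmf ?P' (rev ys @ x @ False # v) - circuit_fun C (rev ys @ x @ False # v)\<bar>
       + 1 / 2 ^ r / 2 ^ (2 * k + 1))"
  proof (intro sum_mono)
    fix x v assume xv: "x \<in> bits k" "v \<in> bits k"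
    define w where "w = rev ys @ x @ False # v"
    define q where "q = (if False = parity_of s x then 2 - 2 * \<eta> else 2 * \<eta>)"
    define os where "os = eval_circuit C w"
    define g where "g = binary_value (drop (p + 2 * k + 1) os)"
    have Pq: "pmf P (x @ False # v) = q / 2 ^ (2 * k + 1)"
      using xv by (simp add: pmf_noisy_product q_def)
    have P'q: "pmf ?P' w = q / 2 ^ (p + 2 * k + 1)"
      unfolding w_def using assms
      by (subst pmf_product_dist[of _ p])
        (auto simp: set_pmf_uniform_bits pmf_uniform_bits bits_def Pq power_add)
    have F: "\<bar>frac_value w - g\<bar> \<le> 1 / 2 ^ r"
      by (simp add: frac_value_def Let_def g_def os_def power_add field_simps)
    \<comment> \<open>The integer part lost by dropping digits. If \<open>C\<close> has too few
      outputs, no digit remains, \<open>g\<close> is 0 and the rescaled value is itself an even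
      integer.\<close>
    obtain n :: nat where n: "2 ^ (p + 2 * k + 1) * circuit_fun C w = 2 * real n + g"
    proof (cases "p + 2 * k + 1 \<le> length os")
      case True
      define hs where "hs = take (p + 2 * k + 1) os"
      have "binary_value os = binary_value hs + g / 2 ^ length hs"
        using binary_value_append[of hs "drop (p + 2 * k + 1) os"] by (simp add: hs_def g_def)
      moreover have len: "length hs = p + 2 * k + 1" using True by (simp add: hs_def)
      moreover obtain n :: nat where "2 ^ length hs * binary_value hs = 2 * real n"
        using binary_value_scaled by blast
      ultimately have "2 ^ (p + 2 * k + 1) * circuit_fun C w = 2 * real n + g"
        by (simp add: circuit_fun_def os_def distrib_left)
      then show ?thesis by (rule that)
    next
      case False
      define l where "l = p + 2 * k + 1 - length os"
      obtain n :: nat where n: "2 ^ length os * binary_value os = 2 * real n"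
        using binary_value_scaled by blast
      have "(2::real) ^ (p + 2 * k + 1) = 2 ^ l * 2 ^ length os"
        using False by (simp add: l_def flip: power_add)
      then have "2 ^ (p + 2 * k + 1) * circuit_fun C w = 2 ^ l * (2 ^ length os * binary_value os)"
        by (simp only: circuit_fun_def os_def mult.assoc)
      also have "\<dots> = 2 * real (2 ^ l * n) + g"
        using False by (simp add: n g_def binary_value_Nil)
      finally show ?thesis by (rule that)
    qed
    \<comment> \<open>Here the factor \<open>1 / \<eta>\<close> enters: \<open>q\<close> is at most
      \<open>2 - 2 * \<eta>\<close>, so a positive \<open>n\<close> already means an error of at
      least \<open>2 * \<eta>\<close>.\<close>
    have "\<bar>q - g\<bar> \<le> \<bar>q - (2 * real n + g)\<bar> / \<eta>"
      using \<eta> binary_value_nonneg[of "drop (p + 2 * k + 1) os"] binary_value_le[of "drop (p + 2 * k + 1) os"]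
      by (intro fractional_part_error) (auto simp: q_def g_def intro: order_trans)
    moreover have "\<bar>q - (2 * real n + g)\<bar> = 2 ^ (p + 2 * k + 1) * \<bar>pmf ?P' w - circuit_fun C w\<bar>"
    proof -
      have "\<bar>q - c * a\<bar> = c * \<bar>q / c - a\<bar>" if "0 < c" for c a :: real
        using that abs_mult_pos'[of c "q / c - a"] by (simp add: right_diff_distrib)
      from this[of "2 ^ (p + 2 * k + 1)" "circuit_fun C w"] show ?thesis
        unfolding n[symmetric] P'q by (simp only: zero_less_power zero_less_numeral)
    qed
    ultimately have "\<bar>q - g\<bar> \<le> 2 ^ (p + 2 * k + 1) * \<bar>pmf ?P' w - circuit_fun C w\<bar> / \<eta>"
      by simp
    then have "\<bar>q - frac_value w\<bar> \<le> 2 ^ (p + 2 * k + 1) * \<bar>pmf ?P' w - circuit_fun C w\<bar> / \<eta> + 1 / 2 ^ r"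
      using F by linarith
    then have "\<bar>q - frac_value w\<bar> / 2 ^ (2 * k + 1) \<le>
        (2 ^ (p + 2 * k + 1) * \<bar>pmf ?P' w - circuit_fun C w\<bar> / \<eta> + 1 / 2 ^ r) / 2 ^ (2 * k + 1)"
      by (intro divide_right_mono) simp_all
    also have "\<dots> = 2 ^ p / \<eta> * \<bar>pmf ?P' w - circuit_fun C w\<bar> + 1 / 2 ^ r / 2 ^ (2 * k + 1)"
      by (simp add: add_divide_distrib power_add)
    also have "\<bar>q - frac_value w\<bar> / 2 ^ (2 * k + 1) = \<bar>pmf P (x @ False # v) - frac_value w / 2 ^ (2 * k + 1)\<bar>"
      unfolding Pq diff_divide_distrib[symmetric] by simp
    finally show "\<bar>pmf P (x @ False # v) - frac_value (rev ys @ x @ False # v) / 2 ^ (2 * k + 1)\<bar> \<le>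
      2 ^ p / \<eta> * \<bar>pmf ?P' (rev ys @ x @ False # v) - circuit_fun C (rev ys @ x @ False # v)\<bar>
       + 1 / 2 ^ r / 2 ^ (2 * k + 1)" by (simp add: w_def)
  qed
  finally show ?thesis .
qed

text \<open>Over all paddings, the errors at parity bit 0 are part of the distance on the padded
  space. The 2 in \<open>2 / \<eta>\<close> undoes the 1/2 in \<open>tv\<close>;
  \<open>1 / 2 ^ r\<close> accounts for the final digit.\<close>

lemma sum_tv_completion:
  "(\<Sum>ys\<in>bits p. tv (2 * k + 1) (pmf P) (circuit_fun (completion ys))) \<le>
     2 ^ p * (2 / \<eta> * tv (p + (2 * k + 1)) (pmf (product_dist (uniform_bits p) P)) (circuit_fun C) + 1 / 2 ^ r)"
proof -
  let ?D = "\<lambda>w. \<bar>pmf (product_dist (uniform_bits p) P) w - circuit_fun C w\<bar>"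
  have "(\<Sum>ys\<in>bits p. tv (2 * k + 1) (pmf P) (circuit_fun (completion ys))) \<le>
      (\<Sum>ys\<in>bits p. \<Sum>x\<in>bits k. \<Sum>v\<in>bits k. 2 ^ p / \<eta> * ?D (rev ys @ x @ False # v) + 1 / 2 ^ r / 2 ^ (2 * k + 1))"
    by (intro sum_mono tv_completion)
  also have "\<dots> = 2 ^ p / \<eta> * (\<Sum>ys\<in>bits p. \<Sum>x\<in>bits k. \<Sum>v\<in>bits k. ?D (rev ys @ x @ False # v)) +
      2 ^ p * (1 / 2 ^ r / 2)"
  proof -
    have "(\<Sum>ys\<in>bits p. \<Sum>x\<in>bits k. \<Sum>v\<in>bits k. 1 / 2 ^ r / 2 ^ (2 * k + 1)) = 2 ^ p * (1 / 2 ^ r / (2::real))"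
      unfolding two_power_odd by (simp add: card_bits)
    then show ?thesis by (simp only: sum.distrib sum_distrib_left)
  qed
  also have "\<dots> \<le> 2 ^ p / \<eta> * (\<Sum>w\<in>bits (p + (2 * k + 1)). ?D w) + 2 ^ p * (1 / 2 ^ r)"
  proof (intro add_mono mult_left_mono)
    \<comment> \<open>The reversal, due to wires being listed latest first, merely permutes the
      paddings.\<close>
    have "(\<Sum>ys\<in>bits p. \<Sum>x\<in>bits k. \<Sum>v\<in>bits k. ?D (rev ys @ x @ False # v)) =
       (\<Sum>ys\<in>bits p. \<Sum>x\<in>bits k. \<Sum>v\<in>bits k. ?D (ys @ x @ False # v))"
      by (rule sum_bits_rev[of "\<lambda>y. \<Sum>x\<in>bits k. \<Sum>v\<in>bits k. ?D (y @ x @ False # v)"])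
    also have "\<dots> \<le> (\<Sum>ys\<in>bits p. \<Sum>x\<in>bits k. \<Sum>v\<in>bits k. ?D (ys @ x @ False # v) + ?D (ys @ x @ True # v))"
      by (intro sum_mono) simp
    also have "\<dots> = (\<Sum>w\<in>bits (p + (2 * k + 1)). ?D w)"
      unfolding sum_bits_append[of _ p "2 * k + 1"] sum_bits_split ..
    finally show "(\<Sum>ys\<in>bits p. \<Sum>x\<in>bits k. \<Sum>v\<in>bits k. ?D (rev ys @ x @ False # v)) \<le>
       (\<Sum>w\<in>bits (p + (2 * k + 1)). ?D w)" .
  qed (use \<eta> in \<open>auto simp: field_simps\<close>)
  also have "\<dots> = 2 ^ p * (2 / \<eta> * tv (p + (2 * k + 1)) (pmf (product_dist (uniform_bits p) P)) (circuit_fun C) + 1 / 2 ^ r)"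
    by (simp add: tv_def distrib_left)
  finally show ?thesis .
qed

text \<open>Markov's inequality, by bounding the indicator of success below by one minus the error
  divided by \<epsilon>. The number \<open>r\<close> is both the inverse accuracy of
  \<open>C\<close> and the number of extra digits; as \<open>1 / 2 ^ r\<close> is at most
  \<open>1 / r\<close>, the mean error is at most \<open>3 / (\<eta> * r)\<close>.\<close>

lemma good_completions:
  assumes C: "good_evaluator (p + (2 * k + 1)) (product_dist (uniform_bits p) P) (1 / real r) C"
    and "0 < r" "0 < \<epsilon>"
  shows "1 - 3 / (\<eta> * real r * \<epsilon>) \<le>
    (\<Sum>ys\<in>bits p. of_bool (good_evaluator (2 * k + 1) P \<epsilon> (completion ys))) / 2 ^ p"
proof -
  let ?t = "\<lambda>ys. tv (2 * k + 1) (pmf P) (circuit_fun (completion ys))"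
  have t0: "0 \<le> ?t ys" for ys by (simp add: tv_def sum_nonneg)
  have pw: "1 / 2 ^ r \<le> 1 / real r"
    using \<open>0 < r\<close> of_nat_less_two_power[of r, where 'a=real] by (intro divide_left_mono) auto
  have "(\<Sum>ys\<in>bits p. ?t ys) \<le> 2 ^ p * (2 / \<eta> * (1 / real r) + 1 / real r)"
  proof (rule order_trans[OF sum_tv_completion], intro mult_left_mono add_mono)
    show "tv (p + (2 * k + 1)) (pmf (product_dist (uniform_bits p) P)) (circuit_fun C) \<le> 1 / real r"
      using C by (simp add: good_evaluator_def)
  qed (use pw \<eta> in auto)
  also have "\<dots> \<le> 2 ^ p * (3 / (\<eta> * real r))"
    using \<eta> \<open>0 < r\<close> by (intro mult_left_mono) (auto simp: field_simps)
  finally have sum: "(\<Sum>ys\<in>bits p. ?t ys) / \<epsilon> \<le> 2 ^ p * (3 / (\<eta> * real r)) / \<epsilon>"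
    using \<open>0 < \<epsilon>\<close> by (intro divide_right_mono) auto
  have "1 - ?t ys / \<epsilon> \<le> of_bool (good_evaluator (2 * k + 1) P \<epsilon> (completion ys))" if "ys \<in> bits p" for ys
    using completion_is_distribution[OF that] t0[of ys] \<open>0 < \<epsilon>\<close>
    by (auto simp: good_evaluator_def field_simps)
  then have "(\<Sum>ys\<in>bits p. 1 - ?t ys / \<epsilon>) \<le>
     (\<Sum>ys\<in>bits p. of_bool (good_evaluator (2 * k + 1) P \<epsilon> (completion ys)))"
    by (intro sum_mono)
  then have "2 ^ p - 2 ^ p * (3 / (\<eta> * real r)) / \<epsilon> \<le>
     (\<Sum>ys\<in>bits p. of_bool (good_evaluator (2 * k + 1) P \<epsilon> (completion ys)))"
    using sum by (simp add: sum_subtractf card_bits sum_divide_distrib[symmetric])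
  then have "(2 ^ p - 2 ^ p * (3 / (\<eta> * real r)) / \<epsilon>) / 2 ^ p \<le>
     (\<Sum>ys\<in>bits p. of_bool (good_evaluator (2 * k + 1) P \<epsilon> (completion ys))) / 2 ^ p"
    by (intro divide_right_mono) auto
  then show ?thesis by (simp add: diff_divide_distrib)
qed

end

end


section \<open>Simulating a learner on padded samples\<close>

lemma prob_bind_pmf:
  "measure_pmf.prob (bind_pmf p f) X = (\<integral>x. measure_pmf.prob (f x) X \<partial>measure_pmf p)"
proof -
  have "ennreal (measure_pmf.prob (bind_pmf p f) X) = (\<integral>\<^sup>+x. ennreal (measure_pmf.prob (f x) X) \<partial>measure_pmf p)"
    by (simp flip: measure_pmf.emeasure_eq_measure)
  also have "\<dots> = ennreal (\<integral>x. measure_pmf.prob (f x) X \<partial>measure_pmf p)"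
    by (intro nn_integral_eq_integral measure_pmf.integrable_const_bound[of _ 1]) auto
  finally show ?thesis by (simp add: integral_nonneg_AE)
qed

definition halts :: "bool list pmf \<Rightarrow> nat \<Rightarrow> (store \<Rightarrow> bool) \<Rightarrow> config \<Rightarrow> real" where
  "halts P T G cfg = measure_pmf.prob (steps P T cfg) {(cs, \<sigma>). cs = [] \<and> G \<sigma>}"

lemma halts_bounds: "0 \<le> halts P T G cfg" "halts P T G cfg \<le> 1"
  by (simp_all add: halts_def)

lemma halts_Suc: "halts P (Suc T) G cfg = (\<integral>c. halts P T G c \<partial>measure_pmf (step P cfg))"
  by (simp add: halts_def prob_bind_pmf)

lemma halts_0: "halts P 0 G (cs, \<sigma>) = of_bool (cs = [] \<and> G \<sigma>)"
  by (simp add: halts_def)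

lemma halts_Nil: "halts P T G ([], \<sigma>) = of_bool (G \<sigma>)"
  by (induction T) (simp_all add: halts_0 halts_Suc)

text \<open>Halted configurations are fixed, so extra time never lowers the probability; every time
  bound may be rounded up.\<close>

lemma halts_Suc_mono: "halts P T G cfg \<le> halts P (Suc T) G cfg"
proof (induction T arbitrary: cfg)
  case 0
  obtain cs \<sigma> where "cfg = (cs, \<sigma>)" by force
  then show ?case
    using halts_bounds(1)[of P "Suc 0" G cfg] by (cases cs) (simp_all add: halts_0 halts_Nil)
next
  case (Suc T)
  have "halts P (Suc T) G cfg = (\<integral>c. halts P T G c \<partial>measure_pmf (step P cfg))"
    by (rule halts_Suc)
  also have "\<dots> \<le> (\<integral>c. halts P (Suc T) G c \<partial>measure_pmf (step P cfg))"
    using halts_bounds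
    by (intro integral_mono measure_pmf.integrable_const_bound[of _ 1] Suc.IH) auto
  also have "\<dots> = halts P (Suc (Suc T)) G cfg"
    by (rule halts_Suc[symmetric])
  finally show ?case .
qed

lemma halts_mono: "T \<le> T' \<Longrightarrow> halts P T G cfg \<le> halts P T' G cfg"
  by (rule lift_Suc_mono_le[where f = "\<lambda>T. halts P T G cfg"]) (rule halts_Suc_mono)

lemma halts_Assign:
  "halts P (Suc T) G (Assign n e # cs, \<sigma>) = halts P T G (cs, \<sigma>(n := eval_expr e \<sigma>))"
  by (simp add: halts_Suc)

lemma halts_Sequence:
  "halts P (Suc T) G (Sequence c d # cs, \<sigma>) = halts P T G (c # d # cs, \<sigma>)"
  by (simp add: halts_Suc)

lemma halts_While:
  "halts P (Suc T) G (While e c # cs, \<sigma>) =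
     halts P T G (if eval_expr e \<sigma> \<noteq> Leaf then c # While e c # cs else cs, \<sigma>)"
  by (simp add: halts_Suc)

lemma halts_Flip:
  "halts P (Suc T) G (Flip n # cs, \<sigma>) =
     (halts P T G (cs, \<sigma>(n := enc_bool False)) + halts P T G (cs, \<sigma>(n := enc_bool True))) / 2"
  by (simp add: halts_Suc field_simps)

lemma halts_Sample:
  assumes "set_pmf P \<subseteq> bits N"
  shows "halts P (Suc T) G (Sample n # cs, \<sigma>) =
     (\<Sum>x\<in>bits N. pmf P x * halts P T G (cs, \<sigma>(n := enc_list enc_bool x)))"
  using assms by (simp add: halts_Suc) (subst integral_measure_pmf_real[of "bits N"], auto simp: finite_bits mult.commute)

text \<open>Quantifying over sample source, continuation and remaining time makes deterministic
  pieces compose with each other and with random ones. Only a bound on the number of steps is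
  kept.\<close>

definition runs :: "com \<Rightarrow> store \<Rightarrow> nat \<Rightarrow> store \<Rightarrow> bool" where
  "runs c \<sigma> t \<sigma>' \<longleftrightarrow> (\<exists>t'\<le>t. \<forall>P cs T. steps P (t' + T) (c # cs, \<sigma>) = steps P T (cs, \<sigma>'))"

lemma runs_mono: "runs c \<sigma> t \<sigma>' \<Longrightarrow> t \<le> u \<Longrightarrow> runs c \<sigma> u \<sigma>'"
  unfolding runs_def by (meson order_trans)

lemma halts_runs:
  assumes "runs c \<sigma> t \<sigma>'"
  shows "halts P T G (cs, \<sigma>') \<le> halts P (t + T) G (c # cs, \<sigma>)"
proof -
  obtain t' where t': "t' \<le> t" "\<forall>P cs T. steps P (t' + T) (c # cs, \<sigma>) = steps P T (cs, \<sigma>')"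
    using assms by (auto simp: runs_def)
  then have "halts P T G (cs, \<sigma>') = halts P (t' + T) G (c # cs, \<sigma>)" by (simp add: halts_def)
  also have "\<dots> \<le> halts P (t + T) G (c # cs, \<sigma>)" using t' by (intro halts_mono) simp
  finally show ?thesis .
qed

lemma runs_Assign: "runs (Assign n e) \<sigma> 1 (\<sigma>(n := eval_expr e \<sigma>))"
  unfolding runs_def by (intro exI[of _ 1]) (simp add: bind_return_pmf)

lemma runs_Sequence:
  assumes "runs c \<sigma> t \<sigma>'" "runs d \<sigma>' u \<sigma>''"
  shows "runs (Sequence c d) \<sigma> (1 + t + u) \<sigma>''"
proof -
  obtain t' u' where "t' \<le> t" "\<forall>P cs T. steps P (t' + T) (c # cs, \<sigma>) = steps P T (cs, \<sigma>')"
    "u' \<le> u" "\<forall>P cs T. steps P (u' + T) (d # cs, \<sigma>') = steps P T (cs, \<sigma>'')"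
    using assms by (auto simp: runs_def)
  then show ?thesis
    unfolding runs_def by (intro exI[of _ "1 + t' + u'"]) (simp add: bind_return_pmf add.assoc)
qed

lemma runs_Cond:
  assumes "runs (if eval_expr e \<sigma> \<noteq> Leaf then c else d) \<sigma> t \<sigma>'"
  shows "runs (Cond e c d) \<sigma> (1 + t) \<sigma>'"
proof -
  obtain t' where "t' \<le> t" "\<forall>P cs T. steps P (t' + T) ((if eval_expr e \<sigma> \<noteq> Leaf then c else d) # cs, \<sigma>) = steps P T (cs, \<sigma>')"
    using assms by (auto simp: runs_def)
  then show ?thesis
    unfolding runs_def by (intro exI[of _ "1 + t'"]) (simp add: bind_return_pmf)
qed

lemma runs_While_False: "eval_expr e \<sigma> = Leaf \<Longrightarrow> runs (While e c) \<sigma> 1 \<sigma>"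
  unfolding runs_def by (intro exI[of _ 1]) (simp add: bind_return_pmf)

lemma runs_While_True:
  assumes "eval_expr e \<sigma> \<noteq> Leaf" "runs c \<sigma> t \<sigma>'" "runs (While e c) \<sigma>' u \<sigma>''"
  shows "runs (While e c) \<sigma> (1 + t + u) \<sigma>''"
proof -
  obtain t' u' where "t' \<le> t" "\<forall>P cs T. steps P (t' + T) (c # cs, \<sigma>) = steps P T (cs, \<sigma>')"
    "u' \<le> u" "\<forall>P cs T. steps P (u' + T) (While e c # cs, \<sigma>') = steps P T (cs, \<sigma>'')"
    using assms by (auto simp: runs_def)
  then show ?thesis
    using assms(1) unfolding runs_def
    by (intro exI[of _ "1 + t' + u'"]) (simp add: bind_return_pmf add.assoc)
qed

lemma runs_While:
  assumes "\<And>i. i < n \<Longrightarrow> eval_expr e (S i) \<noteq> Leaf" "\<And>i. i < n \<Longrightarrow> runs c (S i) t (S (Suc i))"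
    and "eval_expr e (S n) = Leaf"
  shows "runs (While e c) (S 0) (n * (t + 1) + 1) (S n)"
  using assms
proof (induction n arbitrary: S)
  case 0
  then show ?case using runs_While_False[of e "S 0" c] by simp
next
  case (Suc n)
  have "runs (While e c) (S (Suc 0)) (n * (t + 1) + 1) (S (Suc n))"
    using Suc.IH[of "\<lambda>i. S (Suc i)"] Suc.prems by simp
  then have "runs (While e c) (S 0) (1 + t + (n * (t + 1) + 1)) (S (Suc n))"
    using Suc.prems by (intro runs_While_True[of _ _ _ _ "S (Suc 0)"]) auto
  then show ?case by (simp add: algebra_simps)
qed

section \<open>Random padding and the simulation\<close>

definition prepend_bits :: "nat \<Rightarrow> com" where
  "prepend_bits v = While (Var 10) (Sequence (Flip 11)
     (Sequence (Assign v (Pair (Var 11) (Var v))) (Assign 10 (Tail (Var 10)))))"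

lemma prepend_bits_step:
  assumes "v \<noteq> 10" "v \<noteq> 11" "\<tau> 10 = Node Leaf t"
  shows "halts P (Suc (Suc (Suc (Suc (Suc (Suc T)))))) G (prepend_bits v # cs, \<tau>) =
    (halts P T G (prepend_bits v # cs, \<tau>(11 := enc_bool False, v := Node (enc_bool False) (\<tau> v), 10 := t)) +
     halts P T G (prepend_bits v # cs, \<tau>(11 := enc_bool True, v := Node (enc_bool True) (\<tau> v), 10 := t))) / 2"
  using assms
  by (simp add: prepend_bits_def halts_Sequence halts_Assign halts_While halts_Flip)

text \<open>Averages the lower bounds \<open>f y\<close> over the uniform padding \<open>y\<close>.
  A loop iteration takes six steps, the last test one.\<close>

lemma halts_prepend_bits:
  assumes "v \<noteq> 10" "v \<noteq> 11" "\<tau> 10 = enc_nat p" "\<tau> v = enc_list enc_bool x"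
    and "\<And>y \<tau>'. y \<in> bits p \<Longrightarrow> (\<And>u. u \<notin> {10, 11, v} \<Longrightarrow> \<tau>' u = \<tau> u) \<Longrightarrow>
      \<tau>' v = enc_list enc_bool (y @ x) \<Longrightarrow> f y \<le> halts P T G (cs, \<tau>')"
  shows "(\<Sum>y\<in>bits p. f y) / 2 ^ p \<le> halts P (6 * p + 1 + T) G (prepend_bits v # cs, \<tau>)"
  using assms(3-)
proof (induction p arbitrary: x \<tau> f)
  case 0
  have "halts P (Suc T) G (prepend_bits v # cs, \<tau>) = halts P T G (cs, \<tau>)"
    using 0 by (simp add: halts_Suc prepend_bits_def)
  then show ?case using 0 by (simp add: bits_0)
next
  case (Suc p)
  define \<tau>b where "\<tau>b b = \<tau>(11 := enc_bool b, v := Node (enc_bool b) (\<tau> v), 10 := enc_nat p)" for b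
  have step: "halts P (6 * Suc p + 1 + T) G (prepend_bits v # cs, \<tau>) =
     (halts P (6 * p + 1 + T) G (prepend_bits v # cs, \<tau>b False) +
      halts P (6 * p + 1 + T) G (prepend_bits v # cs, \<tau>b True)) / 2"
  proof -
    have "6 * Suc p + 1 + T = Suc (Suc (Suc (Suc (Suc (Suc (6 * p + 1 + T))))))" by simp
    then show ?thesis
      using prepend_bits_step[OF assms(1,2), of \<tau> "enc_nat p" P "6 * p + 1 + T" G cs] Suc.prems(1)
      unfolding \<tau>b_def by (simp only: enc_nat.simps)
  qed
  \<comment> \<open>Bits are prepended, so the first one flipped becomes the last bit of the
    padding.\<close>
  have "(\<Sum>y\<in>bits p. f (y @ [b])) / 2 ^ p \<le> halts P (6 * p + 1 + T) G (prepend_bits v # cs, \<tau>b b)" for b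
  proof (rule Suc.IH)
    show "\<tau>b b 10 = enc_nat p" "\<tau>b b v = enc_list enc_bool (b # x)"
      using Suc.prems assms(1,2) by (simp_all add: \<tau>b_def)
  next
    fix y \<tau>' assume "y \<in> bits p" "\<And>u. u \<notin> {10, 11, v} \<Longrightarrow> \<tau>' u = \<tau>b b u"
      "\<tau>' v = enc_list enc_bool (y @ b # x)"
    then show "f (y @ [b]) \<le> halts P T G (cs, \<tau>')"
      by (intro Suc.prems(3)) (auto simp: \<tau>b_def bits_def)
  qed
  from add_mono[OF this[of False] this[of True]]
  show ?case
    unfolding step using sum_bits_append[of f p 1]
    by (simp add: sum_bits_Suc bits_0 sum.distrib field_simps)
qed

fun shift_expr :: "expr \<Rightarrow> expr" where
  "shift_expr (Var n) = Var (n + 20)"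
| "shift_expr Nil_tree = Nil_tree"
| "shift_expr (Pair e f) = Pair (shift_expr e) (shift_expr f)"
| "shift_expr (Head e) = Head (shift_expr e)"
| "shift_expr (Tail e) = Tail (shift_expr e)"

text \<open>
  The simulated program keeps its variables from \<open>20\<close> on; its samples are padded with as many
  random bits as variable \<open>3\<close> says.
\<close>

fun simulate :: "com \<Rightarrow> com" where
  "simulate Skip = Skip"
| "simulate (Assign n e) = Assign (n + 20) (shift_expr e)"
| "simulate (Flip n) = Flip (n + 20)"
| "simulate (Sample n) = Sequence (Sample (n + 20)) (Sequence (Assign 10 (Var 3)) (prepend_bits (n + 20)))"
| "simulate (Sequence c d) = Sequence (simulate c) (simulate d)"
| "simulate (Cond e c d) = Cond (shift_expr e) (simulate c) (simulate d)"
| "simulate (While e c) = While (shift_expr e) (simulate c)"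

text \<open>Variables 10 and 11 are exempt because \<open>prepend_bits\<close> overwrites them at
  each sample; the others below 20 carry the data of the reduction past the simulation.\<close>

definition simulates :: "store \<Rightarrow> store \<Rightarrow> store \<Rightarrow> bool" where
  "simulates \<tau>\<^sub>0 \<sigma> \<tau> \<longleftrightarrow> (\<forall>n. \<tau> (n + 20) = \<sigma> n) \<and> (\<forall>v<20. v \<noteq> 10 \<longrightarrow> v \<noteq> 11 \<longrightarrow> \<tau> v = \<tau>\<^sub>0 v)"

lemma eval_shift_expr: "simulates \<tau>\<^sub>0 \<sigma> \<tau> \<Longrightarrow> eval_expr (shift_expr e) \<tau> = eval_expr e \<sigma>"
  by (induction e) (auto simp: simulates_def)

lemma simulates_update: "simulates \<tau>\<^sub>0 \<sigma> \<tau> \<Longrightarrow> simulates \<tau>\<^sub>0 (\<sigma>(n := t)) (\<tau>(n + 20 := t))"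
  by (auto simp: simulates_def)

text \<open>A padded sample is the most expensive step: four steps for sampling and copying the
  counter, then \<open>6 * p + 1\<close> for the padding. The factor \<open>q\<close> bounds the
  success of the postprocessing from any accepted store, so the two probabilities multiply.\<close>

lemma halts_simulate:
  assumes P: "set_pmf P \<subseteq> bits N" and p: "\<tau>\<^sub>0 3 = enc_nat p"
    and post: "\<And>\<sigma> \<tau>. G' \<sigma> \<Longrightarrow> simulates \<tau>\<^sub>0 \<sigma> \<tau> \<Longrightarrow> q \<le> halts P T\<^sub>2 G ([post], \<tau>)" and "0 \<le> q"
    and "simulates \<tau>\<^sub>0 \<sigma> \<tau>"
  shows "q * halts (product_dist (uniform_bits p) P) T G' (cs, \<sigma>) \<le>
    halts P ((6 * p + 5) * T + T\<^sub>2) G (map simulate cs @ [post], \<tau>)"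
  using assms(5)
proof (induction T arbitrary: cs \<sigma> \<tau>)
  case 0
  then show ?case using post[of \<sigma> \<tau>] by (auto simp: halts_0 halts_bounds)
next
  case (Suc T)
  let ?P' = "product_dist (uniform_bits p) P"
  let ?T = "(6 * p + 5) * T + T\<^sub>2"
  have le: "halts P (Suc ?T) G c \<le> halts P ((6 * p + 5) * Suc T + T\<^sub>2) G c" for c
    by (rule halts_mono) simp
  show ?case
  proof (cases cs)
    case Nil
    have "q * halts ?P' (Suc T) G' (cs, \<sigma>) = q * halts ?P' T G' (cs, \<sigma>)"
      by (simp add: Nil halts_Nil)
    also have "\<dots> \<le> halts P ?T G (map simulate cs @ [post], \<tau>)" using Suc by blast
    also have "\<dots> \<le> halts P ((6 * p + 5) * Suc T + T\<^sub>2) G (map simulate cs @ [post], \<tau>)"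
      by (rule halts_mono) simp
    finally show ?thesis .
  next
    case (Cons c ds)
    note IH = Suc.IH
    have eval: "eval_expr (shift_expr e) \<tau> = eval_expr e \<sigma>" for e
      using Suc.prems by (rule eval_shift_expr)
    show ?thesis
    proof (cases c)
      case Skip
      then show ?thesis
        using IH[OF Suc.prems, of ds] by (intro order_trans[OF _ le]) (simp add: Cons halts_Suc)
    next
      case (Assign n e)
      have "q * halts ?P' (Suc T) G' (cs, \<sigma>) = q * halts ?P' T G' (ds, \<sigma>(n := eval_expr e \<sigma>))"
        by (simp add: Cons Assign halts_Assign)
      also have "\<dots> \<le> halts P ?T G (map simulate ds @ [post], \<tau>(n + 20 := eval_expr e \<sigma>))"
        by (rule IH[OF simulates_update[OF Suc.prems]])
      also have "\<dots> = halts P (Suc ?T) G (map simulate cs @ [post], \<tau>)"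
        by (simp add: Cons Assign halts_Assign eval)
      finally show ?thesis by (rule order_trans[OF _ le])
    next
      case (Flip n)
      have "q * halts ?P' T G' (ds, \<sigma>(n := enc_bool b)) \<le>
          halts P ?T G (map simulate ds @ [post], \<tau>(n + 20 := enc_bool b))" for b
        by (rule IH[OF simulates_update[OF Suc.prems]])
      from add_mono[OF this[of False] this[of True]]
      have "q * halts ?P' (Suc T) G' (cs, \<sigma>) \<le> halts P (Suc ?T) G (map simulate cs @ [post], \<tau>)"
        by (simp add: Cons Flip halts_Flip distrib_left)
      then show ?thesis by (rule order_trans[OF _ le])
    next
      case (Sequence a b)
      then show ?thesis
        using IH[OF Suc.prems, of "a # b # ds"] by (intro order_trans[OF _ le]) (simp add: Cons halts_Suc)
    next
      case (Cond e a b)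
      then show ?thesis
        using IH[OF Suc.prems, of "a # ds"] IH[OF Suc.prems, of "b # ds"]
        by (intro order_trans[OF _ le]) (simp add: Cons halts_Suc eval)
    next
      case (While e a)
      then show ?thesis
        using IH[OF Suc.prems, of "a # While e a # ds"] IH[OF Suc.prems, of ds]
        by (intro order_trans[OF _ le]) (simp add: Cons halts_Suc eval)
    next
      case (Sample n)
      define h where "h w = halts ?P' T G' (ds, \<sigma>(n := enc_list enc_bool w))" for w
      define \<tau>x where "\<tau>x x = \<tau>(n + 20 := enc_list enc_bool x, 10 := enc_nat p)" for x
      have P': "set_pmf ?P' \<subseteq> bits (p + N)"
        using P by (intro set_pmf_product_dist) (simp_all add: set_pmf_uniform_bits)
      have "q * halts ?P' (Suc T) G' (cs, \<sigma>) = q * (\<Sum>w\<in>bits (p + N). pmf ?P' w * h w)"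
        by (simp add: Cons Sample halts_Sample[OF P'] h_def)
      also have "\<dots> = q * (\<Sum>y\<in>bits p. \<Sum>x\<in>bits N. pmf P x * h (y @ x) / 2 ^ p)"
        unfolding sum_bits_append
        by (intro arg_cong[of _ _ "(*) q"] sum.cong refl)
          (simp add: pmf_product_dist[of "uniform_bits p" p] set_pmf_uniform_bits pmf_uniform_bits)
      \<comment> \<open>Exchanging the sums reflects the order in the program: first the sample,
        then its padding.\<close>
      also have "\<dots> = (\<Sum>x\<in>bits N. pmf P x * ((\<Sum>y\<in>bits p. q * h (y @ x)) / 2 ^ p))"
        by (subst sum.swap) (simp add: sum_distrib_left sum_divide_distrib mult.left_commute)
      also have "\<dots> \<le> (\<Sum>x\<in>bits N. pmf P x * halts P (6 * p + 1 + ?T) G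
          (prepend_bits (n + 20) # map simulate ds @ [post], \<tau>x x))"
      proof (intro sum_mono mult_left_mono pmf_nonneg halts_prepend_bits)
        fix x
        show "\<tau>x x 10 = enc_nat p" "\<tau>x x (n + 20) = enc_list enc_bool x"
          by (simp_all add: \<tau>x_def)
      next
        fix x y \<tau>'
        assume "\<And>u. u \<notin> {10, 11, n + 20} \<Longrightarrow> \<tau>' u = \<tau>x x u" "\<tau>' (n + 20) = enc_list enc_bool (y @ x)"
        then have "simulates \<tau>\<^sub>0 (\<sigma>(n := enc_list enc_bool (y @ x))) \<tau>'"
          using Suc.prems by (auto simp: simulates_def \<tau>x_def)
        then show "q * h (y @ x) \<le> halts P ?T G (map simulate ds @ [post], \<tau>')"
          unfolding h_def by (rule IH)
      qed auto
      also have "\<dots> = (\<Sum>x\<in>bits N. pmf P x * halts P (Suc (Suc (6 * p + 1 + ?T))) G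
          (Sequence (Assign 10 (Var 3)) (prepend_bits (n + 20)) # map simulate ds @ [post],
           \<tau>(n + 20 := enc_list enc_bool x)))"
        using p Suc.prems by (simp add: halts_Sequence halts_Assign \<tau>x_def simulates_def)
      also have "\<dots> = halts P (Suc (Suc (Suc (6 * p + 1 + ?T)))) G
          (Sample (n + 20) # Sequence (Assign 10 (Var 3)) (prepend_bits (n + 20)) # map simulate ds @ [post], \<tau>)"
        by (rule halts_Sample[OF P, symmetric])
      also have "\<dots> = halts P ((6 * p + 5) * Suc T + T\<^sub>2) G (map simulate cs @ [post], \<tau>)"
      proof -
        have "(6 * p + 5) * Suc T + T\<^sub>2 = Suc (Suc (Suc (Suc (6 * p + 1 + ?T))))" by simp
        then show ?thesis
          by (simp only: Cons Sample simulate.simps list.map append_Cons halts_Sequence)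
      qed
      finally show ?thesis .
    qed
  qed
qed

section \<open>Depth of the trees in a store\<close>

fun height :: "tree \<Rightarrow> nat" where
  "height Leaf = 0"
| "height (Node l r) = Suc (max (height l) (height r))"

fun expr_size :: "expr \<Rightarrow> nat" where
  "expr_size (Pair e f) = Suc (expr_size e + expr_size f)"
| "expr_size (Head e) = expr_size e"
| "expr_size (Tail e) = expr_size e"
| "expr_size _ = 0"

text \<open>A bound on the growth of depth in one step. Summing over subcommands makes the bound
  pass to every command that execution pushes.\<close>

fun com_size :: "com \<Rightarrow> nat" where
  "com_size (Assign n e) = expr_size e"
| "com_size (Sequence c d) = com_size c + com_size d"
| "com_size (Cond e c d) = com_size c + com_size d"
| "com_size (While e c) = com_size c"
| "com_size _ = 0"

lemma height_eval_expr:
  assumes "\<And>v. height (\<sigma> v) \<le> h"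
  shows "height (eval_expr e \<sigma>) \<le> h + expr_size e"
proof (induction e)
  case (Head e)
  then show ?case by (cases "eval_expr e \<sigma>") auto
next
  case (Tail e)
  then show ?case by (cases "eval_expr e \<sigma>") auto
qed (use assms in auto)

lemma height_enc_list: "(\<And>x. x \<in> set xs \<Longrightarrow> height (f x) \<le> h) \<Longrightarrow> height (enc_list f xs) \<le> length xs + h"
  by (induction xs) (auto intro: trans_le_add2)

lemma length_le_height: "length xs \<le> height (enc_list f xs)"
  by (induction xs) auto

lemma element_height: "x \<in> set xs \<Longrightarrow> height (f x) \<le> height (enc_list f xs)"
  by (induction xs) auto

lemma height_enc_nat: "height (enc_nat n) = n"
  by (induction n) auto

lemma height_enc_bool: "height (enc_bool b) \<le> 1"
  by (simp add: enc_bool_def)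

text \<open>An assignment deepens the store by at most the number of pairs in its expression, and
  samples have depth at most \<open>M + 1\<close>, which \<open>h\<close> already covers.\<close>

lemma height_steps:
  assumes "set_pmf P \<subseteq> bits M"
  shows "(cs', \<sigma>') \<in> set_pmf (steps P T (cs, \<sigma>)) \<Longrightarrow> \<forall>c\<in>set cs. com_size c \<le> b \<Longrightarrow>
    \<forall>v. height (\<sigma> v) \<le> h \<Longrightarrow> M + 1 \<le> h \<Longrightarrow> height (\<sigma>' v) \<le> h + b * T"
proof (induction T arbitrary: cs \<sigma> h)
  case 0
  then show ?case by simp
next
  case (Suc T)
  then obtain cs1 \<sigma>1 where step: "(cs1, \<sigma>1) \<in> set_pmf (step P (cs, \<sigma>))"
    and rest: "(cs', \<sigma>') \<in> set_pmf (steps P T (cs1, \<sigma>1))"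
    by auto
  have "\<forall>c\<in>set cs1. com_size c \<le> b" and "\<forall>v. height (\<sigma>1 v) \<le> h + b"
  proof -
    have samp: "height (enc_list enc_bool x) \<le> h + b" if "x \<in> set_pmf P" for x
      using height_enc_list[of x enc_bool 1] height_enc_bool that assms Suc.prems(4)
      by (force simp: bits_def)
    have bool: "height (enc_bool a) \<le> h + b" for a
      using height_enc_bool[of a] Suc.prems(4) by linarith
    have old: "height (\<sigma> v) \<le> h + b" for v using Suc.prems(3) by (simp add: trans_le_add1)
    have "(\<forall>c\<in>set cs1. com_size c \<le> b) \<and> (\<forall>v. height (\<sigma>1 v) \<le> h + b)"
    proof (cases cs)
      case Nil
      then show ?thesis using step old by simp
    next
      case (Cons c ds)
      show ?thesis
      proof (cases c)
        case (Assign n e)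
        have "height (eval_expr e \<sigma>) \<le> h + b"
          using height_eval_expr[of \<sigma> h e] Suc.prems(2,3) by (force simp: Cons Assign)
        then show ?thesis using step old Suc.prems(2) by (auto simp: Cons Assign)
      qed (use step old samp bool Suc.prems(2) in \<open>auto simp: Cons split: if_splits\<close>)
    qed
    then show "\<forall>c\<in>set cs1. com_size c \<le> b" and "\<forall>v. height (\<sigma>1 v) \<le> h + b" by auto
  qed
  from Suc.IH[OF rest this] Suc.prems(4) show ?case by (simp add: add.assoc)
qed

text \<open>The depth bound holds on every run, so it can join the postcondition without loss of
  probability. It is what bounds the time for processing the learned circuit.\<close>

lemma halts_height:
  assumes "set_pmf P \<subseteq> bits M" "\<And>v. height (\<sigma> v) \<le> h" "M + 1 \<le> h"
  shows "halts P T G ([c], \<sigma>) = halts P T (\<lambda>\<sigma>'. G \<sigma>' \<and> height (\<sigma>' 0) \<le> h + com_size c * T) ([c], \<sigma>)"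
  unfolding halts_def
  by (intro measure_pmf.finite_measure_eq_AE AE_pmfI)
    (use height_steps[OF assms(1), where cs = "[c]"] assms(2,3) in auto)


section \<open>Deterministic programs on unary numbers and lists\<close>

fun block :: "com list \<Rightarrow> com" where
  "block [] = Skip"
| "block (c # cs) = Sequence c (block cs)"

lemma runs_block_Nil: "runs (block []) \<sigma> 1 \<sigma>"
  unfolding runs_def by (intro exI[of _ 1]) (simp add: bind_return_pmf)

lemma runs_block_Cons:
  "runs c \<sigma> t \<sigma>' \<Longrightarrow> runs (block cs) \<sigma>' u \<sigma>'' \<Longrightarrow> runs (block (c # cs)) \<sigma> (1 + t + u) \<sigma>''"
  unfolding block.simps by (rule runs_Sequence)

lemma runs_Assign_to: "eval_expr e \<sigma> = w \<Longrightarrow> \<sigma>(n := w) = \<sigma>' \<Longrightarrow> runs (Assign n e) \<sigma> 1 \<sigma>'"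
  using runs_Assign by metis

text \<open>Variable 6 holds the remaining list, so these loops are never nested;
  \<open>add_nat\<close> counts in variable 5 and may occur in their bodies.\<close>

definition for_each :: "expr \<Rightarrow> com \<Rightarrow> com" where
  "for_each e c = Sequence (Assign 6 e) (While (Var 6) (Sequence c (Assign 6 (Tail (Var 6)))))"

text \<open>The invariant is an explicit store \<open>S ys\<close> for each processed prefix.
  \<open>X\<close> serves as a common bound on loop lengths, to keep the time bounds
  uniform.\<close>

lemma runs_for_each:
  assumes e: "eval_expr e (S []) = enc_list f xs" and clean: "\<And>ys. S ys 6 = Leaf" and len: "length xs \<le> X"
    and body: "\<And>ys x zs. xs = ys @ x # zs \<Longrightarrow>
      runs c ((S ys)(6 := Node (f x) (enc_list f zs))) t ((S (ys @ [x]))(6 := Node (f x) (enc_list f zs)))"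
  shows "runs (for_each e c) (S []) (X * (t + 3) + 3) (S xs)"
proof -
  define L where "L i = (S (take i xs))(6 := enc_list f (drop i xs))" for i
  have "runs (While (Var 6) (Sequence c (Assign 6 (Tail (Var 6))))) (L 0) (length xs * ((1 + t + 1) + 1) + 1) (L (length xs))"
  proof (rule runs_While)
    fix i assume i: "i < length xs"
    have d: "drop i xs = xs ! i # drop (Suc i) xs" and tk: "take (Suc i) xs = take i xs @ [xs ! i]"
      using i by (simp_all add: Cons_nth_drop_Suc take_Suc_conv_app_nth)
    show "eval_expr (Var 6) (L i) \<noteq> Leaf" using d by (simp add: L_def)
    have "runs c (L i) t ((S (take (Suc i) xs))(6 := Node (f (xs ! i)) (enc_list f (drop (Suc i) xs))))"
      unfolding L_def d tk enc_list.simps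
      by (rule body) (metis append_take_drop_id d)
    then show "runs (Sequence c (Assign 6 (Tail (Var 6)))) (L i) (1 + t + 1) (L (Suc i))"
      by (rule runs_Sequence) (rule runs_Assign_to, simp, simp add: L_def)
  qed (simp add: L_def)
  moreover have "L (length xs) = S xs" using clean[of xs] by (auto simp: L_def)
  moreover have "runs (Assign 6 e) (S []) 1 (L 0)"
    by (rule runs_Assign_to[OF e]) (simp add: L_def)
  ultimately have "runs (for_each e c) (S []) (1 + 1 + (length xs * ((1 + t + 1) + 1) + 1)) (S xs)"
    unfolding for_each_def using runs_Sequence by metis
  then show ?thesis
    using mult_le_mono1[OF len, of "t + 3"] by (elim runs_mono) (simp add: algebra_simps)
qed

lemma enc_nat_eq_list: "enc_nat n = enc_list (\<lambda>_. Leaf) (replicate n ())"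
  by (induction n) auto

lemma runs_for_nat:
  assumes "eval_expr e (S 0) = enc_nat n" "\<And>i. S i 6 = Leaf" "n \<le> X"
    and body: "\<And>i w. i < n \<Longrightarrow> runs c ((S i)(6 := w)) t ((S (Suc i))(6 := w))"
  shows "runs (for_each e c) (S 0) (X * (t + 3) + 3) (S n)"
proof -
  have "runs (for_each e c) (S (length ([] :: unit list))) (X * (t + 3) + 3) (S (length (replicate n ())))"
  proof (rule runs_for_each[where S = "\<lambda>us::unit list. S (length us)" and f = "\<lambda>_. Leaf"])
    fix ys zs :: "unit list" and x
    assume "replicate n () = ys @ x # zs"
    then have "length ys < n" by (metis length_append length_Cons length_replicate less_add_Suc1 add_Suc_right)
    then show "runs c ((S (length ys))(6 := Node Leaf (enc_list (\<lambda>_. Leaf) zs))) t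
       ((S (length (ys @ [x])))(6 := Node Leaf (enc_list (\<lambda>_. Leaf) zs)))"
      using body by simp
  qed (use assms in \<open>auto simp: enc_nat_eq_list\<close>)
  then show ?thesis by simp
qed

section \<open>Unary arithmetic and the learner's inputs\<close>

definition add_nat :: "nat \<Rightarrow> expr \<Rightarrow> com" where
  "add_nat v e = Sequence (Assign 5 e) (While (Var 5)
     (Sequence (Assign v (Pair Nil_tree (Var v))) (Assign 5 (Tail (Var 5)))))"

lemma runs_add_nat:
  assumes "eval_expr e \<sigma> = enc_nat b" "\<sigma> v = enc_nat a" "\<sigma> 5 = Leaf" "v \<noteq> 5" "b \<le> X"
    and "\<sigma>(v := enc_nat (a + b)) = \<sigma>'"
  shows "runs (add_nat v e) \<sigma> (4 * X + 3) \<sigma>'"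
proof -
  define L where "L i = \<sigma>(v := enc_nat (a + i), 5 := enc_nat (b - i))" for i
  have "runs (While (Var 5) (Sequence (Assign v (Pair Nil_tree (Var v))) (Assign 5 (Tail (Var 5)))))
      (L 0) (b * ((1 + 1 + 1) + 1) + 1) (L b)"
  proof (rule runs_While)
    fix i assume i: "i < b"
    then obtain j where j: "b - i = Suc j" by (metis Suc_diff_Suc)
    then have j': "b - Suc i = j" by simp
    show "eval_expr (Var 5) (L i) \<noteq> Leaf" using j by (simp add: L_def)
    show "runs (Sequence (Assign v (Pair Nil_tree (Var v))) (Assign 5 (Tail (Var 5)))) (L i) (1 + 1 + 1) (L (Suc i))"
      using j j' assms(4) by (intro runs_Sequence[OF runs_Assign] runs_Assign_to) (auto simp: L_def)
  qed (simp add: L_def)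
  moreover have "runs (Assign 5 e) \<sigma> 1 (L 0)"
    using assms by (intro runs_Assign_to) (auto simp: L_def)
  moreover have "L b = \<sigma>'" using assms by (auto simp: L_def)
  ultimately have "runs (add_nat v e) \<sigma> (1 + 1 + (b * ((1 + 1 + 1) + 1) + 1)) \<sigma>'"
    unfolding add_nat_def using runs_Sequence by metis
  then show ?thesis by (rule runs_mono) (use assms in simp)
qed

definition mult_nat :: "nat \<Rightarrow> expr \<Rightarrow> nat \<Rightarrow> com" where
  "mult_nat v e w = Sequence (Assign v Nil_tree) (for_each e (add_nat v (Var w)))"

lemma runs_mult_nat:
  assumes "eval_expr e (\<sigma>(v := Leaf)) = enc_nat a" "\<sigma> w = enc_nat b" "\<sigma> 5 = Leaf" "\<sigma> 6 = Leaf"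
    "v \<noteq> 5" "v \<noteq> 6" "w \<noteq> v" "w \<noteq> 6" "a \<le> X" "b \<le> X"
    and "\<sigma>(v := enc_nat (a * b)) = \<sigma>'"
  shows "runs (mult_nat v e w) \<sigma> (X * (4 * X + 6) + 5) \<sigma>'"
proof -
  define S where "S i = \<sigma>(v := enc_nat (i * b))" for i
  have S0: "S 0 = \<sigma>(v := Leaf)" by (simp add: S_def)
  have "runs (for_each e (add_nat v (Var w))) (S 0) (X * ((4 * X + 3) + 3) + 3) (S a)"
  proof (rule runs_for_nat)
    fix i u assume "i < a"
    show "runs (add_nat v (Var w)) ((S i)(6 := u)) (4 * X + 3) ((S (Suc i))(6 := u))"
      using assms by (intro runs_add_nat[of _ _ b _ "i * b"]) (auto simp: S_def add.commute)
  next
    show "eval_expr e (S 0) = enc_nat a" unfolding S0 by (rule assms(1))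
  qed (use assms in \<open>auto simp: S_def\<close>)
  moreover have "runs (Assign v Nil_tree) \<sigma> 1 (S 0)" by (rule runs_Assign_to) (simp_all add: S_def)
  moreover have "S a = \<sigma>'" using assms by (simp add: S_def)
  ultimately have "runs (mult_nat v e w) \<sigma> (1 + 1 + (X * ((4 * X + 3) + 3) + 3)) \<sigma>'"
    unfolding mult_nat_def using runs_Sequence by metis
  then show ?thesis by (rule runs_mono) simp
qed

text \<open>The exponent depends only on the constant c, so the multiplications are unrolled in the
  program text.\<close>

fun pow_nat :: "nat \<Rightarrow> com" where
  "pow_nat 0 = Assign 3 (Pair Nil_tree Nil_tree)"
| "pow_nat (Suc r) = block [pow_nat r, mult_nat 7 (Var 3) 0, Assign 3 (Var 7), Assign 7 Nil_tree]"

lemma runs_pow_nat: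
  assumes "\<sigma> 0 = enc_nat n" "\<sigma> 5 = Leaf" "\<sigma> 6 = Leaf" "\<sigma> 7 = Leaf" "0 < n" "n \<le> X" "n ^ r \<le> X"
  shows "runs (pow_nat r) \<sigma> (r * (X * (4 * X + 6) + 12) + 1) (\<sigma>(3 := enc_nat (n ^ r)))"
  using assms(7)
proof (induction r)
  case 0
  show ?case
    unfolding pow_nat.simps power_0 mult_0 add_0
    by (rule runs_Assign_to[of _ _ "enc_nat 1"]) (simp_all add: fun_eq_iff)
next
  case (Suc r)
  have "n ^ r \<le> n ^ Suc r" using assms(5) by simp
  then have le: "n ^ r \<le> X" using Suc.prems by linarith
  define \<sigma>1 where "\<sigma>1 = \<sigma>(3 := enc_nat (n ^ r))"
  define \<sigma>2 where "\<sigma>2 = \<sigma>1(7 := enc_nat (n ^ r * n))"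
  have "runs (pow_nat (Suc r)) \<sigma> (1 + (r * (X * (4 * X + 6) + 12) + 1) + (1 + (X * (4 * X + 6) + 5) + (1 + 1 + (1 + 1 + 1))))
      (\<sigma>(3 := enc_nat (n ^ Suc r)))"
    unfolding pow_nat.simps
  proof (intro runs_block_Cons runs_block_Nil)
    show "runs (pow_nat r) \<sigma> (r * (X * (4 * X + 6) + 12) + 1) \<sigma>1"
      unfolding \<sigma>1_def by (rule Suc.IH[OF le])
    show "runs (mult_nat 7 (Var 3) 0) \<sigma>1 (X * (4 * X + 6) + 5) \<sigma>2"
      using assms le by (intro runs_mult_nat[of _ _ _ "n ^ r" _ n]) (auto simp: \<sigma>1_def \<sigma>2_def)
    show "runs (Assign 3 (Var 7)) \<sigma>2 1 (\<sigma>2(3 := \<sigma>2 7))" by (rule runs_Assign_to) auto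
    show "runs (Assign 7 Nil_tree) (\<sigma>2(3 := \<sigma>2 7)) 1 (\<sigma>(3 := enc_nat (n ^ Suc r)))"
      using assms by (intro runs_Assign_to) (auto simp: \<sigma>1_def \<sigma>2_def fun_eq_iff mult.commute)
  qed (rule runs_block_Nil)
  then show ?case by (rule runs_mono) simp
qed

fun const_expr :: "nat \<Rightarrow> expr" where
  "const_expr 0 = Nil_tree"
| "const_expr (Suc n) = Pair Nil_tree (const_expr n)"

lemma eval_const_expr: "eval_expr (const_expr n) \<sigma> = enc_nat n"
  by (induction n) auto

text \<open>The first tail removes the odd unit of \<open>2 * k + 1\<close>; each round then trades
  two units for one.\<close>

definition halve :: com where
  "halve = block [Assign 6 (Tail (Var 0)), While (Var 6)
     (Sequence (Assign 9 (Pair Nil_tree (Var 9))) (Assign 6 (Tail (Tail (Var 6)))))]"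

lemma runs_halve:
  assumes "\<sigma> 0 = enc_nat (2 * k + 1)" "\<sigma> 6 = Leaf" "\<sigma> 9 = Leaf" "k \<le> X"
  shows "runs halve \<sigma> (4 * X + 5) (\<sigma>(9 := enc_nat k))"
proof -
  define L where "L i = \<sigma>(9 := enc_nat i, 6 := enc_nat (2 * (k - i)))" for i
  have "runs (While (Var 6) (Sequence (Assign 9 (Pair Nil_tree (Var 9))) (Assign 6 (Tail (Tail (Var 6))))))
      (L 0) (k * ((1 + 1 + 1) + 1) + 1) (L k)"
  proof (rule runs_While)
    fix i assume i: "i < k"
    then obtain j where j: "k - i = Suc j" by (metis Suc_diff_Suc)
    then have j': "k - Suc i = j" by simp
    show "eval_expr (Var 6) (L i) \<noteq> Leaf" using j by (simp add: L_def)
    show "runs (Sequence (Assign 9 (Pair Nil_tree (Var 9))) (Assign 6 (Tail (Tail (Var 6))))) (L i) (1 + 1 + 1) (L (Suc i))"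
      by (intro runs_Sequence[OF runs_Assign] runs_Assign_to) (auto simp: L_def j j')
  qed (simp add: L_def)
  moreover have "runs (Assign 6 (Tail (Var 0))) \<sigma> 1 (L 0)"
    using assms by (intro runs_Assign_to) (auto simp: L_def fun_eq_iff)
  moreover have "L k = \<sigma>(9 := enc_nat k)" using assms by (auto simp: L_def fun_eq_iff)
  ultimately have "runs halve \<sigma> (1 + 1 + (1 + (k * ((1 + 1 + 1) + 1) + 1) + 1)) (\<sigma>(9 := enc_nat k))"
    unfolding halve_def by (metis runs_block_Cons runs_block_Nil)
  then show ?thesis by (rule runs_mono) (use assms in simp)
qed

text \<open>
  Variables of the reduction: \<open>0\<close>, \<open>1\<close>, \<open>2\<close> are \<open>N\<close> and the rounded inverses of \<open>\<epsilon>\<close> and \<open>\<delta>\<close>, \<open>3\<close> is the number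
  of padding bits, \<open>4\<close> the inverse accuracy asked from the learner, \<open>7\<close> and \<open>8\<close> the reversed list of
  emitted gates and its length, \<open>9\<close> is \<open>k\<close>, \<open>12\<close> holds the random padding and later the output wires,
  \<open>13\<close> is the number of qubits; \<open>20\<close>, \<open>21\<close>, \<open>22\<close> are the inputs \<open>0\<close>, \<open>1\<close>, \<open>2\<close> of the learner. Outside of their
  loops \<open>5\<close> and \<open>6\<close> contain \<open>Leaf\<close>.
\<close>

definition prepare :: "nat \<Rightarrow> nat \<Rightarrow> com" where
  "prepare r K = block [pow_nat r, mult_nat 7 (Var 1) 2, mult_nat 4 (const_expr K) 7, Assign 7 Nil_tree,
     Assign 13 (Var 3), add_nat 13 (Var 0), halve,
     Assign 20 (Var 13), Assign 21 (Var 4), Assign 22 (Var 2), add_nat 22 (Var 2)]"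

lemma runs_prepare:
  assumes \<sigma>: "\<sigma> 0 = enc_nat (2 * k + 1)" "\<sigma> 1 = enc_nat e" "\<sigma> 2 = enc_nat d" "\<And>v. 2 < v \<Longrightarrow> \<sigma> v = Leaf"
    and X: "2 * k + 1 \<le> X" "(2 * k + 1) ^ r \<le> X" "e \<le> X" "d \<le> X" "e * d \<le> X" "K \<le> X"
    and p: "p = (2 * k + 1) ^ r"
  shows "runs (prepare r K) \<sigma> ((r + 2) * (X * (4 * X + 6) + 12) + 12 * X + 40)
    (\<sigma>(3 := enc_nat p, 4 := enc_nat (K * (e * d)), 13 := enc_nat (p + (2 * k + 1)), 9 := enc_nat k,
       20 := enc_nat (p + (2 * k + 1)), 21 := enc_nat (K * (e * d)), 22 := enc_nat (d + d)))"
    (is "runs _ _ _ ?\<sigma>'")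
proof -
  define \<sigma>1 where "\<sigma>1 = \<sigma>(3 := enc_nat p)"
  define \<sigma>2 where "\<sigma>2 = \<sigma>1(7 := enc_nat (e * d))"
  define \<sigma>3 where "\<sigma>3 = \<sigma>2(4 := enc_nat (K * (e * d)))"
  define \<sigma>4 where "\<sigma>4 = \<sigma>3(7 := Leaf)"
  define \<sigma>5 where "\<sigma>5 = \<sigma>4(13 := enc_nat p)"
  define \<sigma>6 where "\<sigma>6 = \<sigma>5(13 := enc_nat (p + (2 * k + 1)))"
  define \<sigma>7 where "\<sigma>7 = \<sigma>6(9 := enc_nat k)"
  define \<sigma>8 where "\<sigma>8 = \<sigma>7(20 := enc_nat (p + (2 * k + 1)))"
  define \<sigma>9 where "\<sigma>9 = \<sigma>8(21 := enc_nat (K * (e * d)))"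
  define \<sigma>10 where "\<sigma>10 = \<sigma>9(22 := enc_nat d)"
  note defs = \<sigma>1_def \<sigma>2_def \<sigma>3_def \<sigma>4_def \<sigma>5_def \<sigma>6_def \<sigma>7_def \<sigma>8_def \<sigma>9_def \<sigma>10_def
  have 1: "runs (pow_nat r) \<sigma> (r * (X * (4 * X + 6) + 12) + 1) \<sigma>1"
    unfolding \<sigma>1_def p using \<sigma> X by (intro runs_pow_nat) auto
  have 2: "runs (mult_nat 7 (Var 1) 2) \<sigma>1 (X * (4 * X + 6) + 5) \<sigma>2"
    using \<sigma> X by (intro runs_mult_nat[of _ _ _ e _ d]) (auto simp: \<sigma>1_def \<sigma>2_def)
  have 3: "runs (mult_nat 4 (const_expr K) 7) \<sigma>2 (X * (4 * X + 6) + 5) \<sigma>3"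
    using \<sigma> X by (intro runs_mult_nat[of _ _ _ K _ "e * d"]) (auto simp: defs eval_const_expr)
  have 4: "runs (Assign 7 Nil_tree) \<sigma>3 1 \<sigma>4" by (intro runs_Assign_to) (auto simp: defs)
  have 5: "runs (Assign 13 (Var 3)) \<sigma>4 1 \<sigma>5" by (intro runs_Assign_to) (auto simp: defs)
  have 6: "runs (add_nat 13 (Var 0)) \<sigma>5 (4 * X + 3) \<sigma>6"
    using \<sigma> X by (intro runs_add_nat[of _ _ "2 * k + 1" _ p]) (auto simp: defs)
  have 7: "runs halve \<sigma>6 (4 * X + 5) \<sigma>7"
    unfolding \<sigma>7_def using \<sigma> X by (intro runs_halve) (auto simp: defs)
  have 8: "runs (Assign 20 (Var 13)) \<sigma>7 1 \<sigma>8" by (intro runs_Assign_to) (auto simp: defs)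
  have 9: "runs (Assign 21 (Var 4)) \<sigma>8 1 \<sigma>9" by (intro runs_Assign_to) (auto simp: defs)
  have 10: "runs (Assign 22 (Var 2)) \<sigma>9 1 \<sigma>10" using \<sigma> by (intro runs_Assign_to) (auto simp: defs)
  have 11: "runs (add_nat 22 (Var 2)) \<sigma>10 (4 * X + 3) ?\<sigma>'"
    using \<sigma> X by (intro runs_add_nat[of _ _ d _ d]) (auto simp: defs fun_eq_iff)
  show ?thesis
    unfolding prepare_def
    by (rule runs_mono, (rule runs_block_Cons[OF 1] runs_block_Cons[OF 2] runs_block_Cons[OF 3]
      runs_block_Cons[OF 4] runs_block_Cons[OF 5] runs_block_Cons[OF 6] runs_block_Cons[OF 7]
      runs_block_Cons[OF 8] runs_block_Cons[OF 9] runs_block_Cons[OF 10] runs_block_Cons[OF 11] runs_block_Nil)+)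
      (simp add: algebra_simps)
qed

section \<open>Emitting gates\<close>

definition emitted :: "store \<Rightarrow> (nat \<times> nat) list \<Rightarrow> store" where
  "emitted \<sigma> gs = \<sigma>(7 := enc_list enc_gate (rev gs), 8 := enc_nat (length gs))"

lemma emitted_apply: "v \<noteq> 7 \<Longrightarrow> v \<noteq> 8 \<Longrightarrow> emitted \<sigma> gs v = \<sigma> v"
  by (simp add: emitted_def)

lemma emitted_update: "v \<noteq> 7 \<Longrightarrow> v \<noteq> 8 \<Longrightarrow> (emitted \<sigma> gs)(v := w) = emitted (\<sigma>(v := w)) gs"
  by (auto simp: emitted_def fun_eq_iff)

definition emit :: "expr \<Rightarrow> expr \<Rightarrow> com" where
  "emit e f = Sequence (Assign 7 (Pair (Pair e f) (Var 7))) (Assign 8 (Pair Nil_tree (Var 8)))"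

lemma runs_emit:
  assumes "eval_expr e (emitted \<sigma> gs) = enc_nat i" "eval_expr f (emitted \<sigma> gs) = enc_nat j"
    and "emitted \<sigma> (gs @ [(i, j)]) = \<sigma>'"
  shows "runs (emit e f) (emitted \<sigma> gs) 3 \<sigma>'"
proof -
  have "runs (emit e f) (emitted \<sigma> gs) (1 + 1 + 1) \<sigma>'"
    unfolding emit_def using assms
    by (intro runs_Sequence[OF runs_Assign] runs_Assign_to) (auto simp: emitted_def enc_gate_def fun_eq_iff)
  then show ?thesis by (simp add: numeral_3_eq_3)
qed

definition emit_repeat :: "expr \<Rightarrow> nat \<Rightarrow> com" where
  "emit_repeat e v = for_each e (emit (Var v) (Var v))"

lemma runs_emit_repeat:
  assumes "eval_expr e (emitted \<sigma> gs) = enc_nat n" "\<sigma> v = enc_nat a" "\<sigma> 6 = Leaf" "v \<noteq> 6" "v \<noteq> 7" "v \<noteq> 8" "n \<le> X"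
  shows "runs (emit_repeat e v) (emitted \<sigma> gs) (6 * X + 3) (emitted \<sigma> (gs @ replicate n (a, a)))"
proof -
  define S where "S i = emitted \<sigma> (gs @ replicate i (a, a))" for i
  have "runs (emit_repeat e v) (S 0) (X * (3 + 3) + 3) (S n)"
    unfolding emit_repeat_def
  proof (rule runs_for_nat)
    fix i w
    show "runs (emit (Var v) (Var v)) ((S i)(6 := w)) 3 ((S (Suc i))(6 := w))"
      unfolding S_def emitted_update[of 6, simplified]
      using assms by (intro runs_emit) (auto simp: emitted_apply replicate_append_same)
  qed (use assms in \<open>auto simp: S_def emitted_apply\<close>)
  then show ?thesis by (simp add: S_def mult.commute)
qed


section \<open>Writing down the completed circuit\<close>

definition sum_addresses :: com where
  "sum_addresses = block [Assign 14 (Pair Nil_tree (Var 13)),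
     for_each (Head (Var 20)) (Sequence (add_nat 14 (Head (Head (Var 6)))) (add_nat 14 (Tail (Head (Var 6))))),
     for_each (Tail (Var 20)) (add_nat 14 (Head (Var 6)))]"

lemma runs_sum_addresses:
  assumes \<sigma>: "\<sigma> 5 = Leaf" "\<sigma> 6 = Leaf" "\<sigma> 13 = enc_nat m" "\<sigma> 20 = enc_circuit (gs, os)"
    and X: "length gs \<le> X" "length os \<le> X" "\<And>i j. (i, j) \<in> set gs \<Longrightarrow> i \<le> X \<and> j \<le> X" "\<And>i. i \<in> set os \<Longrightarrow> i \<le> X"
  shows "runs sum_addresses \<sigma> (X * (12 * X + 16) + 12) (\<sigma>(14 := enc_nat (m + 1 + address_sum (gs, os))))"
proof -
  define S where "S hs = \<sigma>(14 := enc_nat (m + 1 + sum_list (map (\<lambda>(i, j). i + j) hs)))" for hs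
  define U where "U is = \<sigma>(14 := enc_nat (m + 1 + sum_list (map (\<lambda>(i, j). i + j) gs) + sum_list is))" for "is"
  have 1: "runs (Assign 14 (Pair Nil_tree (Var 13))) \<sigma> 1 (S [])"
    using \<sigma> by (intro runs_Assign_to) (auto simp: S_def)
  have 2: "runs (for_each (Head (Var 20)) (Sequence (add_nat 14 (Head (Head (Var 6)))) (add_nat 14 (Tail (Head (Var 6))))))
      (S []) (X * ((1 + (4 * X + 3) + (4 * X + 3)) + 3) + 3) (S gs)"
  proof (rule runs_for_each[where f = enc_gate])
    fix hs g hs' assume gs: "gs = hs @ g # hs'"
    obtain i j where g: "g = (i, j)" by force
    have b: "i \<le> X" "j \<le> X" using X(3)[of i j] gs g by auto
    let ?w = "Node (enc_gate g) (enc_list enc_gate hs')"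
    show "runs (Sequence (add_nat 14 (Head (Head (Var 6)))) (add_nat 14 (Tail (Head (Var 6)))))
       ((S hs)(6 := ?w)) (1 + (4 * X + 3) + (4 * X + 3)) ((S (hs @ [g]))(6 := ?w))"
    proof (rule runs_Sequence)
      show "runs (add_nat 14 (Head (Head (Var 6)))) ((S hs)(6 := ?w)) (4 * X + 3)
          (((S hs)(6 := ?w))(14 := enc_nat (m + 1 + sum_list (map (\<lambda>(i, j). i + j) hs) + i)))"
        using \<sigma> b by (intro runs_add_nat[of _ _ i _ "m + 1 + sum_list (map (\<lambda>(i, j). i + j) hs)"])
          (auto simp: S_def g enc_gate_def)
      show "runs (add_nat 14 (Tail (Head (Var 6))))
          (((S hs)(6 := ?w))(14 := enc_nat (m + 1 + sum_list (map (\<lambda>(i, j). i + j) hs) + i))) (4 * X + 3)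
          ((S (hs @ [g]))(6 := ?w))"
        using \<sigma> b by (intro runs_add_nat[of _ _ j _ "m + 1 + sum_list (map (\<lambda>(i, j). i + j) hs) + i"])
          (auto simp: S_def g enc_gate_def fun_eq_iff add_ac)
    qed
  qed (use \<sigma> X in \<open>auto simp: S_def enc_circuit_def\<close>)
  have 3: "runs (for_each (Tail (Var 20)) (add_nat 14 (Head (Var 6)))) (U []) (X * ((4 * X + 3) + 3) + 3) (U os)"
  proof (rule runs_for_each[where f = enc_nat])
    fix hs i hs' assume os: "os = hs @ i # hs'"
    then have "i \<le> X" using X(4)[of i] by auto
    then show "runs (add_nat 14 (Head (Var 6))) ((U hs)(6 := Node (enc_nat i) (enc_list enc_nat hs'))) (4 * X + 3)
        ((U (hs @ [i]))(6 := Node (enc_nat i) (enc_list enc_nat hs')))"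
      using \<sigma> by (intro runs_add_nat[of _ _ i _ "m + 1 + sum_list (map (\<lambda>(i, j). i + j) gs) + sum_list hs"])
        (auto simp: U_def fun_eq_iff add_ac)
  qed (use \<sigma> X in \<open>auto simp: U_def enc_circuit_def\<close>)
  have eq: "U [] = S gs" "U os = \<sigma>(14 := enc_nat (m + 1 + address_sum (gs, os)))"
    by (simp_all add: U_def S_def address_sum_def add.assoc)
  show ?thesis
    unfolding sum_addresses_def eq(2)[symmetric]
    by (rule runs_mono, (rule runs_block_Cons[OF 1] runs_block_Cons[OF 2] runs_block_Cons[OF 3[unfolded eq(1)]]
      runs_block_Nil)+) (simp add: algebra_simps)
qed

text \<open>Variables 15, 16 and 17 receive the addresses \<open>a\<close>, \<open>t\<close> and
  \<open>z + m - 1\<close> of \<open>input_gates\<close>; each tail subtracts one.\<close>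

definition prepare_addresses :: com where
  "prepare_addresses = block [Assign 15 (Var 14), add_nat 15 (Tail (Var 0)), Assign 16 (Var 15),
     add_nat 16 (Var 13), Assign 16 (Pair Nil_tree (Var 16)), Assign 17 (Var 14), add_nat 17 (Tail (Var 13)),
     Assign 7 Nil_tree, Assign 8 Nil_tree]"

lemma runs_prepare_addresses:
  assumes \<sigma>: "\<sigma> 5 = Leaf" "\<sigma> 0 = enc_nat (2 * k + 1)" "\<sigma> 13 = enc_nat m" "\<sigma> 14 = enc_nat z"
    and X: "2 * k + 1 \<le> X" "m \<le> X" "0 < m"
  shows "runs prepare_addresses \<sigma> (12 * X + 30)
    (emitted (\<sigma>(15 := enc_nat (2 * k + z), 16 := enc_nat (2 * k + 1 + z + m), 17 := enc_nat (z + m - 1))) [])"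
    (is "runs _ _ _ ?\<sigma>'")
proof -
  obtain m' where m': "m = Suc m'" using X by (cases m) auto
  define \<sigma>1 where "\<sigma>1 = \<sigma>(15 := enc_nat z)"
  define \<sigma>2 where "\<sigma>2 = \<sigma>1(15 := enc_nat (2 * k + z))"
  define \<sigma>3 where "\<sigma>3 = \<sigma>2(16 := enc_nat (2 * k + z))"
  define \<sigma>4 where "\<sigma>4 = \<sigma>3(16 := enc_nat (2 * k + z + m))"
  define \<sigma>5 where "\<sigma>5 = \<sigma>4(16 := enc_nat (2 * k + 1 + z + m))"
  define \<sigma>6 where "\<sigma>6 = \<sigma>5(17 := enc_nat z)"
  define \<sigma>7 where "\<sigma>7 = \<sigma>6(17 := enc_nat (z + m - 1))"
  define \<sigma>8 where "\<sigma>8 = \<sigma>7(7 := Leaf)"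
  note defs = \<sigma>1_def \<sigma>2_def \<sigma>3_def \<sigma>4_def \<sigma>5_def \<sigma>6_def \<sigma>7_def \<sigma>8_def
  have 1: "runs (Assign 15 (Var 14)) \<sigma> 1 \<sigma>1" using \<sigma> by (intro runs_Assign_to) (auto simp: defs)
  have 2: "runs (add_nat 15 (Tail (Var 0))) \<sigma>1 (4 * X + 3) \<sigma>2"
    using \<sigma> X by (intro runs_add_nat[of _ _ "2 * k" _ z]) (auto simp: defs add.commute)
  have 3: "runs (Assign 16 (Var 15)) \<sigma>2 1 \<sigma>3" by (intro runs_Assign_to) (auto simp: defs)
  have 4: "runs (add_nat 16 (Var 13)) \<sigma>3 (4 * X + 3) \<sigma>4"
    using \<sigma> X by (intro runs_add_nat[of _ _ m _ "2 * k + z"]) (auto simp: defs)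
  have 5: "runs (Assign 16 (Pair Nil_tree (Var 16))) \<sigma>4 1 \<sigma>5" by (intro runs_Assign_to) (auto simp: defs)
  have 6: "runs (Assign 17 (Var 14)) \<sigma>5 1 \<sigma>6" using \<sigma> by (intro runs_Assign_to) (auto simp: defs)
  have 7: "runs (add_nat 17 (Tail (Var 13))) \<sigma>6 (4 * X + 3) \<sigma>7"
    using \<sigma> X by (intro runs_add_nat[of _ _ m' _ z]) (auto simp: defs m')
  have 8: "runs (Assign 7 Nil_tree) \<sigma>7 1 \<sigma>8" by (intro runs_Assign_to) (auto simp: defs)
  have 9: "runs (Assign 8 Nil_tree) \<sigma>8 1 ?\<sigma>'"
    by (intro runs_Assign_to) (auto simp: defs emitted_def fun_eq_iff)
  show ?thesis
    unfolding prepare_addresses_def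
    by (rule runs_mono, (rule runs_block_Cons[OF 1] runs_block_Cons[OF 2] runs_block_Cons[OF 3]
      runs_block_Cons[OF 4] runs_block_Cons[OF 5] runs_block_Cons[OF 6] runs_block_Cons[OF 7]
      runs_block_Cons[OF 8] runs_block_Cons[OF 9] runs_block_Nil)+)
      (simp add: algebra_simps)
qed

definition emit_inputs :: com where
  "emit_inputs = block [emit_repeat (Var 14) 16, emit_repeat (Var 9) 15, emit (Var 16) (Var 16),
     emit_repeat (Var 9) 15,
     for_each (Var 12) (Cond (Head (Var 6)) (emit (Var 13) (Var 13)) (emit (Var 16) (Var 16))),
     emit_repeat (Pair Nil_tree (Var 17)) 17]"

lemma runs_emit_inputs:
  assumes \<sigma>: "\<sigma> 6 = Leaf" "\<sigma> 9 = enc_nat k" "\<sigma> 12 = enc_list enc_bool ys" "\<sigma> 13 = enc_nat m" "\<sigma> 14 = enc_nat z"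
      "\<sigma> 15 = enc_nat (2 * k + z)" "\<sigma> 16 = enc_nat (2 * k + 1 + z + m)" "\<sigma> 17 = enc_nat (z + m - 1)"
    and X: "k \<le> X" "m + z \<le> X" "length ys \<le> X" "0 < m"
  shows "runs emit_inputs (emitted \<sigma> []) (31 * X + 40) (emitted \<sigma> (input_gates k m z ys))"
proof -
  let ?a = "2 * k + z" and ?t = "2 * k + 1 + z + m" and ?c = "z + m - 1"
  define g1 where "g1 = replicate z (?t, ?t)"
  define g2 where "g2 = g1 @ replicate k (?a, ?a)"
  define g3 where "g3 = g2 @ [(?t, ?t)]"
  define g4 where "g4 = g3 @ replicate k (?a, ?a)"
  define g5 where "g5 = g4 @ map (\<lambda>y. if y then (m, m) else (?t, ?t)) ys"
  have 1: "runs (emit_repeat (Var 14) 16) (emitted \<sigma> []) (6 * X + 3) (emitted \<sigma> g1)"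
    using runs_emit_repeat[of "Var 14" \<sigma> "[]" z 16 ?t X] \<sigma> X by (simp add: emitted_apply g1_def)
  have 2: "runs (emit_repeat (Var 9) 15) (emitted \<sigma> g1) (6 * X + 3) (emitted \<sigma> g2)"
    unfolding g2_def by (rule runs_emit_repeat) (use \<sigma> X in \<open>auto simp: emitted_apply\<close>)
  have 3: "runs (emit (Var 16) (Var 16)) (emitted \<sigma> g2) 3 (emitted \<sigma> g3)"
    by (rule runs_emit) (use \<sigma> in \<open>auto simp: emitted_apply g3_def\<close>)
  have 4: "runs (emit_repeat (Var 9) 15) (emitted \<sigma> g3) (6 * X + 3) (emitted \<sigma> g4)"
    unfolding g4_def by (rule runs_emit_repeat) (use \<sigma> X in \<open>auto simp: emitted_apply\<close>)
  have 5: "runs (for_each (Var 12) (Cond (Head (Var 6)) (emit (Var 13) (Var 13)) (emit (Var 16) (Var 16))))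
      (emitted \<sigma> g4) (X * ((1 + 3) + 3) + 3) (emitted \<sigma> g5)"
  proof -
    define S where "S us = emitted \<sigma> (g4 @ map (\<lambda>y. if y then (m, m) else (?t, ?t)) us)" for us
    have "runs (for_each (Var 12) (Cond (Head (Var 6)) (emit (Var 13) (Var 13)) (emit (Var 16) (Var 16))))
      (S []) (X * ((1 + 3) + 3) + 3) (S ys)"
    proof (rule runs_for_each[where f = enc_bool])
      fix us y vs
      let ?w = "Node (enc_bool y) (enc_list enc_bool vs)"
      have "runs (if y then emit (Var 13) (Var 13) else emit (Var 16) (Var 16)) ((S us)(6 := ?w)) 3 ((S (us @ [y]))(6 := ?w))"
        unfolding S_def emitted_update[of 6, simplified]
        by (cases y) (use \<sigma> in \<open>auto simp: emitted_apply intro!: runs_emit\<close>)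
      then show "runs (Cond (Head (Var 6)) (emit (Var 13) (Var 13)) (emit (Var 16) (Var 16)))
         ((S us)(6 := ?w)) (1 + 3) ((S (us @ [y]))(6 := ?w))"
        by (intro runs_Cond) (cases y, simp_all add: enc_bool_def)
    qed (use \<sigma> X in \<open>auto simp: S_def emitted_apply\<close>)
    then show ?thesis by (simp add: S_def g5_def)
  qed
  have 6: "runs (emit_repeat (Pair Nil_tree (Var 17)) 17) (emitted \<sigma> g5) (6 * X + 3)
      (emitted \<sigma> (g5 @ replicate (m + z) (?c, ?c)))"
  proof (rule runs_emit_repeat)
    have "m + z = Suc ?c" using X by simp
    then show "eval_expr (Pair Nil_tree (Var 17)) (emitted \<sigma> g5) = enc_nat (m + z)"
      using \<sigma> by (simp add: emitted_apply)
  qed (use \<sigma> X in auto)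
  have "g5 @ replicate (m + z) (?c, ?c) = input_gates k m z ys"
    by (simp add: input_gates_def Let_def g5_def g4_def g3_def g2_def g1_def)
  note 6 = 6[unfolded this]
  show ?thesis
    unfolding emit_inputs_def
    by (rule runs_mono, (rule runs_block_Cons[OF 1] runs_block_Cons[OF 2] runs_block_Cons[OF 3]
      runs_block_Cons[OF 4] runs_block_Cons[OF 5] runs_block_Cons[OF 6] runs_block_Nil)+)
      (simp add: algebra_simps)
qed

definition emit_copy :: com where
  "emit_copy = for_each (Head (Var 20)) (emit (Head (Head (Var 6))) (Tail (Head (Var 6))))"

lemma runs_emit_copy:
  assumes "\<sigma> 6 = Leaf" "\<sigma> 20 = enc_circuit (gs, os)" "length gs \<le> X"
  shows "runs emit_copy (emitted \<sigma> g) (6 * X + 3) (emitted \<sigma> (g @ gs))"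
proof -
  define S where "S hs = emitted \<sigma> (g @ hs)" for hs
  have "runs emit_copy (S []) (X * (3 + 3) + 3) (S gs)"
    unfolding emit_copy_def
  proof (rule runs_for_each[where f = enc_gate])
    fix hs h hs'
    show "runs (emit (Head (Head (Var 6))) (Tail (Head (Var 6))))
       ((S hs)(6 := Node (enc_gate h) (enc_list enc_gate hs'))) 3
       ((S (hs @ [h]))(6 := Node (enc_gate h) (enc_list enc_gate hs')))"
      unfolding S_def emitted_update[of 6, simplified]
      by (rule runs_emit[of _ _ _ "fst h" _ "snd h"]) (auto simp: emitted_apply enc_gate_def)
  qed (use assms in \<open>auto simp: S_def emitted_apply enc_circuit_def\<close>)
  then show ?thesis by (simp add: S_def mult.commute)
qed

definition plus_four :: "expr \<Rightarrow> expr" where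
  "plus_four e = Pair Nil_tree (Pair Nil_tree (Pair Nil_tree (Pair Nil_tree e)))"

lemma eval_plus_four: "eval_expr e \<sigma> = enc_nat n \<Longrightarrow> eval_expr (plus_four e) \<sigma> = enc_nat (n + 4)"
  by (simp add: plus_four_def numeral_eq_Suc)

text \<open>Variable 19 holds the shift \<open>e\<close> and variable 18 the already shifted address
  of the parity bit; 11 is the shifted address of the current output wire.\<close>

definition emit_xor :: com where
  "emit_xor = block [Assign 11 (Var 19), add_nat 11 (Head (Var 6)), emit (Var 11) (Var 18),
     emit (Pair Nil_tree (Var 11)) Nil_tree,
     emit (Pair Nil_tree (Pair Nil_tree (Var 18))) (Pair Nil_tree Nil_tree),
     emit (Pair Nil_tree Nil_tree) Nil_tree,
     Assign 18 (plus_four (Var 18)), Assign 19 (plus_four (Var 19)), Assign 11 Nil_tree]"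

lemma runs_emit_xor:
  assumes \<sigma>: "\<sigma> 5 = Leaf" "\<sigma> 6 = Node (enc_nat a) w" "\<sigma> 11 = Leaf" "\<sigma> 18 = enc_nat b" "\<sigma> 19 = enc_nat e" "a \<le> X"
  shows "runs emit_xor (emitted \<sigma> g) (4 * X + 40) (emitted (\<sigma>(18 := enc_nat (b + 4), 19 := enc_nat (e + 4)))
     (g @ [(a + e, b), (Suc (a + e), 0), (Suc (Suc b), 1), (1, 0)]))"
    (is "runs _ _ _ ?\<sigma>'")
proof -
  define \<tau>0 where "\<tau>0 = \<sigma>(11 := enc_nat e)"
  define \<tau> where "\<tau> = \<sigma>(11 := enc_nat (e + a))"
  define \<tau>1 where "\<tau>1 = \<tau>(18 := enc_nat (b + 4))"
  define \<tau>2 where "\<tau>2 = \<tau>1(19 := enc_nat (e + 4))"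
  define g1 where "g1 = g @ [(a + e, b)]"
  define g2 where "g2 = g1 @ [(Suc (a + e), 0)]"
  define g3 where "g3 = g2 @ [(Suc (Suc b), 1)]"
  define g4 where "g4 = g3 @ [(1, 0)]"
  have 1: "runs (Assign 11 (Var 19)) (emitted \<sigma> g) 1 (emitted \<tau>0 g)"
    using \<sigma> by (intro runs_Assign_to) (auto simp: emitted_apply emitted_update \<tau>0_def)
  have 2: "runs (add_nat 11 (Head (Var 6))) (emitted \<tau>0 g) (4 * X + 3) (emitted \<tau> g)"
    using \<sigma> by (intro runs_add_nat[of _ _ a _ e]) (auto simp: emitted_apply emitted_update \<tau>0_def \<tau>_def)
  have 3: "runs (emit (Var 11) (Var 18)) (emitted \<tau> g) 3 (emitted \<tau> g1)"
    using \<sigma> by (intro runs_emit[of _ _ _ "a + e" _ b]) (auto simp: emitted_apply \<tau>_def g1_def add.commute)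
  have 4: "runs (emit (Pair Nil_tree (Var 11)) Nil_tree) (emitted \<tau> g1) 3 (emitted \<tau> g2)"
    using \<sigma> by (intro runs_emit[of _ _ _ "Suc (a + e)" _ 0]) (auto simp: emitted_apply \<tau>_def g2_def add.commute)
  have 5: "runs (emit (Pair Nil_tree (Pair Nil_tree (Var 18))) (Pair Nil_tree Nil_tree)) (emitted \<tau> g2) 3 (emitted \<tau> g3)"
    using \<sigma> by (intro runs_emit[of _ _ _ "Suc (Suc b)" _ 1]) (auto simp: emitted_apply \<tau>_def g3_def)
  have 6: "runs (emit (Pair Nil_tree Nil_tree) Nil_tree) (emitted \<tau> g3) 3 (emitted \<tau> g4)"
    by (intro runs_emit[of _ _ _ 1 _ 0]) (auto simp: g4_def)
  have 7: "runs (Assign 18 (plus_four (Var 18))) (emitted \<tau> g4) 1 (emitted \<tau>1 g4)"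
    using \<sigma> by (intro runs_Assign_to[OF eval_plus_four[of _ _ b]]) (auto simp: emitted_apply emitted_update \<tau>_def \<tau>1_def)
  have 8: "runs (Assign 19 (plus_four (Var 19))) (emitted \<tau>1 g4) 1 (emitted \<tau>2 g4)"
    using \<sigma> by (intro runs_Assign_to[OF eval_plus_four[of _ _ e]]) (auto simp: emitted_apply emitted_update \<tau>_def \<tau>1_def \<tau>2_def)
  have 9: "runs (Assign 11 Nil_tree) (emitted \<tau>2 g4) 1 ?\<sigma>'"
    using \<sigma> by (intro runs_Assign_to)
      (auto simp: \<tau>_def \<tau>1_def \<tau>2_def g1_def g2_def g3_def g4_def emitted_def fun_eq_iff)
  show ?thesis
    unfolding emit_xor_def
    by (rule runs_mono, (rule runs_block_Cons[OF 1] runs_block_Cons[OF 2] runs_block_Cons[OF 3]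
      runs_block_Cons[OF 4] runs_block_Cons[OF 5] runs_block_Cons[OF 6] runs_block_Cons[OF 7]
      runs_block_Cons[OF 8] runs_block_Cons[OF 9] runs_block_Nil)+) simp
qed

lemma xor_gates_snoc:
  "xor_gates e b (as @ [a]) = xor_gates e b as @
     [(a + (e + 4 * length as), b + (e + 4 * length as)), (Suc (a + (e + 4 * length as)), 0),
      (Suc (Suc (b + (e + 4 * length as))), 1), (1, 0)]"
  by (induction as arbitrary: e) (auto simp: algebra_simps)

text \<open>The gate count plus \<open>k\<close> is the address of the parity bit. Its shifts leave
  the final address \<open>l + k\<close> in variable 18 for \<open>assemble\<close>.\<close>

definition emit_xors :: com where
  "emit_xors = block [Assign 18 (Var 8), add_nat 18 (Var 9), Assign 21 (Tail (Var 20)),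
     for_each (Var 13) (Assign 21 (Tail (Var 21))), Assign 19 Nil_tree, Assign 11 Nil_tree,
     for_each (Var 21) emit_xor]"

lemma runs_emit_xors:
  assumes \<sigma>: "\<sigma> 5 = Leaf" "\<sigma> 6 = Leaf" "\<sigma> 9 = enc_nat k" "\<sigma> 13 = enc_nat m" "\<sigma> 20 = enc_circuit (gs, os)"
    and X: "k \<le> X" "m \<le> X" "length os \<le> X" "\<And>i. i \<in> set os \<Longrightarrow> i \<le> X"
    and as: "as = drop m os" and b: "b = length g + k"
  shows "runs emit_xors (emitted \<sigma> g) (X * (4 * X + 60) + 40)
    (emitted (\<sigma>(21 := enc_list enc_nat as, 11 := Leaf, 18 := enc_nat (b + 4 * length as), 19 := enc_nat (4 * length as)))
      (g @ xor_gates 0 b as))"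
proof -
  define \<sigma>1 where "\<sigma>1 = \<sigma>(18 := enc_nat (length g))"
  define \<sigma>2 where "\<sigma>2 = \<sigma>1(18 := enc_nat b)"
  define D where "D i = emitted (\<sigma>2(21 := enc_list enc_nat (drop i os))) g" for i
  define \<sigma>3 where "\<sigma>3 = \<sigma>2(21 := enc_list enc_nat as, 19 := Leaf)"
  define S where "S cs = emitted (\<sigma>3(11 := Leaf, 18 := enc_nat (b + 4 * length cs), 19 := enc_nat (4 * length cs)))
     (g @ xor_gates 0 b cs)" for cs
  have 1: "runs (Assign 18 (Var 8)) (emitted \<sigma> g) 1 (emitted \<sigma>1 g)"
    by (intro runs_Assign_to) (auto simp: \<sigma>1_def emitted_def fun_eq_iff)
  have 2: "runs (add_nat 18 (Var 9)) (emitted \<sigma>1 g) (4 * X + 3) (emitted \<sigma>2 g)"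
    using \<sigma> X by (intro runs_add_nat[of _ _ k _ "length g"]) (auto simp: \<sigma>1_def \<sigma>2_def b emitted_apply emitted_update)
  have 3: "runs (Assign 21 (Tail (Var 20))) (emitted \<sigma>2 g) 1 (D 0)"
    using \<sigma> by (intro runs_Assign_to) (auto simp: \<sigma>1_def \<sigma>2_def D_def enc_circuit_def emitted_apply emitted_update)
  have 4: "runs (for_each (Var 13) (Assign 21 (Tail (Var 21)))) (D 0) (X * (1 + 3) + 3) (D m)"
  proof (rule runs_for_nat)
    have tl: "tree_tail (enc_list enc_nat xs) = enc_list enc_nat (tl xs)" for xs by (cases xs) auto
    show "runs (Assign 21 (Tail (Var 21))) ((D i)(6 := w)) 1 ((D (Suc i))(6 := w))" for i w
      by (intro runs_Assign_to) (auto simp: D_def emitted_apply emitted_update tl drop_Suc tl_drop fun_upd_twist)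
  qed (use \<sigma> X in \<open>auto simp: D_def \<sigma>1_def \<sigma>2_def emitted_apply\<close>)
  have 5: "runs (Assign 19 Nil_tree) (D m) 1 (emitted \<sigma>3 g)"
    by (intro runs_Assign_to) (auto simp: D_def \<sigma>3_def as emitted_update)
  have 6: "runs (Assign 11 Nil_tree) (emitted \<sigma>3 g) 1 (S [])"
    by (intro runs_Assign_to) (auto simp: S_def \<sigma>3_def \<sigma>2_def emitted_def fun_eq_iff)
  have 7: "runs (for_each (Var 21) emit_xor) (S []) (X * ((4 * X + 40) + 3) + 3) (S as)"
  proof (rule runs_for_each[where f = enc_nat])
    fix cs a cs' assume eq: "as = cs @ a # cs'"
    then have "a \<in> set os" using as by (metis in_set_conv_decomp in_set_dropD)
    then have a: "a \<le> X" by (rule X(4))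
    let ?w = "Node (enc_nat a) (enc_list enc_nat cs')"
    define \<tau> where "\<tau> = (\<sigma>3(11 := Leaf, 18 := enc_nat (b + 4 * length cs), 19 := enc_nat (4 * length cs)))(6 := ?w)"
    have "runs emit_xor (emitted \<tau> (g @ xor_gates 0 b cs)) (4 * X + 40)
       (emitted (\<tau>(18 := enc_nat (b + 4 * length cs + 4), 19 := enc_nat (4 * length cs + 4)))
         ((g @ xor_gates 0 b cs) @ [(a + 4 * length cs, b + 4 * length cs), (Suc (a + 4 * length cs), 0),
           (Suc (Suc (b + 4 * length cs)), 1), (1, 0)]))"
      using \<sigma> a by (intro runs_emit_xor) (auto simp: \<tau>_def \<sigma>3_def \<sigma>2_def \<sigma>1_def)
    moreover have "(S cs)(6 := ?w) = emitted \<tau> (g @ xor_gates 0 b cs)"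
      by (simp add: S_def \<tau>_def emitted_update)
    moreover have "emitted (\<tau>(18 := enc_nat (b + 4 * length cs + 4), 19 := enc_nat (4 * length cs + 4)))
         ((g @ xor_gates 0 b cs) @ [(a + 4 * length cs, b + 4 * length cs), (Suc (a + 4 * length cs), 0),
           (Suc (Suc (b + 4 * length cs)), 1), (1, 0)]) = (S (cs @ [a]))(6 := ?w)"
      by (auto simp: S_def \<tau>_def emitted_def xor_gates_snoc fun_eq_iff add_ac)
    ultimately show "runs emit_xor ((S cs)(6 := ?w)) (4 * X + 40) ((S (cs @ [a]))(6 := ?w))" by simp
  qed (use \<sigma> X as in \<open>auto simp: S_def \<sigma>3_def \<sigma>2_def \<sigma>1_def emitted_apply\<close>)
  have 8: "S as = emitted (\<sigma>(21 := enc_list enc_nat as, 11 := Leaf, 18 := enc_nat (b + 4 * length as),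
      19 := enc_nat (4 * length as))) (g @ xor_gates 0 b as)"
    by (auto simp: S_def \<sigma>3_def \<sigma>2_def \<sigma>1_def emitted_def fun_eq_iff)
  show ?thesis
    unfolding emit_xors_def 8[symmetric]
    by (rule runs_mono, (rule runs_block_Cons[OF 1] runs_block_Cons[OF 2] runs_block_Cons[OF 3]
      runs_block_Cons[OF 4] runs_block_Cons[OF 5] runs_block_Cons[OF 6] runs_block_Cons[OF 7]
      runs_block_Nil)+) (simp add: algebra_simps)
qed

text \<open>Output addresses are prepended, hence built from the last digit backwards; this also
  brings 0, 4, 8, ... into descending order. Variable 0 still holds \<open>2 * k + 1\<close>, the
  number of leading zeros, until the result overwrites it.\<close>

definition assemble :: com where
  "assemble = block [Assign 12 (Pair (Tail (Var 8)) Nil_tree),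
     for_each (Var 4) (Assign 12 (Pair (Var 18) (Var 12))),
     Assign 10 Nil_tree,
     for_each (Var 21) (Sequence (Assign 12 (Pair (Var 10) (Var 12))) (Assign 10 (plus_four (Var 10)))),
     Assign 11 (Var 18), add_nat 11 (Var 0),
     for_each (Var 0) (Assign 12 (Pair (Var 11) (Var 12))),
     Assign 10 Nil_tree,
     for_each (Var 7) (Assign 10 (Pair (Head (Var 6)) (Var 10))),
     Assign 0 (Pair (Var 10) (Var 12))]"

lemma runs_assemble:
  assumes \<sigma>: "\<sigma> 0 = enc_nat n" "\<sigma> 4 = enc_nat r" "\<sigma> 5 = Leaf" "\<sigma> 6 = Leaf" "\<sigma> 7 = enc_list enc_gate (rev gs)"
      "\<sigma> 8 = enc_nat (length gs)" "\<sigma> 18 = enc_nat b" "\<sigma> 21 = enc_list enc_nat as"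
    and X: "n \<le> X" "r \<le> X" "length as \<le> X" "length gs \<le> X" "gs \<noteq> []"
  shows "\<exists>\<sigma>'. runs assemble \<sigma> (25 * X + 40) \<sigma>' \<and>
    \<sigma>' 0 = enc_circuit (gs, replicate n (b + n) @ map (\<lambda>t. 4 * (length as - 1 - t)) [0..<length as] @
      replicate r b @ [length gs - 1])"
proof -
  define l1 where "l1 i = replicate i b @ [length gs - 1]" for i
  define l2 where "l2 i = map (\<lambda>t. 4 * (i - 1 - t)) [0..<i] @ l1 r" for i
  define l3 where "l3 i = replicate i (b + n) @ l2 (length as)" for i
  define S1 where "S1 i = \<sigma>(12 := enc_list enc_nat (l1 i))" for i
  define S2 where "S2 cs = \<sigma>(12 := enc_list enc_nat (l2 (length cs)), 10 := enc_nat (4 * length cs))" for cs :: "nat list"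
  define \<sigma>1 where "\<sigma>1 = (S2 as)(11 := enc_nat b)"
  define S3 where "S3 i = \<sigma>1(11 := enc_nat (b + n), 12 := enc_list enc_nat (l3 i))" for i
  define S4 where "S4 hs = (S3 n)(10 := enc_list enc_gate (rev hs))" for hs
  define \<sigma>2 where "\<sigma>2 = (S4 (rev gs))(0 := enc_circuit (gs, l3 n))"
  obtain g where g: "length gs = Suc g" using X by (cases gs) auto
  have l2_Suc: "l2 (Suc i) = 4 * i # l2 i" for i
    by (simp add: l2_def upt_conv_Cons map_Suc_upt[symmetric] comp_def del: upt_Suc)
  have 1: "runs (Assign 12 (Pair (Tail (Var 8)) Nil_tree)) \<sigma> 1 (S1 0)"
    using \<sigma> by (intro runs_Assign_to) (auto simp: S1_def l1_def g)
  have 2: "runs (for_each (Var 4) (Assign 12 (Pair (Var 18) (Var 12)))) (S1 0) (X * (1 + 3) + 3) (S1 r)"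
  proof (rule runs_for_nat)
    show "runs (Assign 12 (Pair (Var 18) (Var 12))) ((S1 i)(6 := w)) 1 ((S1 (Suc i))(6 := w))" for i w
      using \<sigma> by (intro runs_Assign_to) (auto simp: S1_def l1_def)
  qed (use \<sigma> X in \<open>auto simp: S1_def\<close>)
  have 3: "runs (Assign 10 Nil_tree) (S1 r) 1 (S2 [])"
    by (intro runs_Assign_to) (auto simp: S1_def S2_def l2_def)
  have 4: "runs (for_each (Var 21) (Sequence (Assign 12 (Pair (Var 10) (Var 12))) (Assign 10 (plus_four (Var 10)))))
      (S2 []) (X * ((1 + 1 + 1) + 3) + 3) (S2 as)"
  proof (rule runs_for_each[where f = enc_nat])
    show "runs (Sequence (Assign 12 (Pair (Var 10) (Var 12))) (Assign 10 (plus_four (Var 10))))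
      ((S2 cs)(6 := Node (enc_nat a) w)) (1 + 1 + 1) ((S2 (cs @ [a]))(6 := Node (enc_nat a) w))" for cs a w
      by (intro runs_Sequence[OF runs_Assign] runs_Assign_to[OF eval_plus_four[of _ _ "4 * length cs"]])
        (auto simp: S2_def l2_Suc fun_eq_iff add.commute)
  qed (use \<sigma> X in \<open>auto simp: S2_def\<close>)
  have 5: "runs (Assign 11 (Var 18)) (S2 as) 1 \<sigma>1"
    using \<sigma> by (intro runs_Assign_to) (auto simp: \<sigma>1_def S2_def)
  have 6: "runs (add_nat 11 (Var 0)) \<sigma>1 (4 * X + 3) (S3 0)"
    using \<sigma> X by (intro runs_add_nat[of _ _ n _ b]) (auto simp: \<sigma>1_def S2_def S3_def l3_def fun_eq_iff)
  have 7: "runs (for_each (Var 0) (Assign 12 (Pair (Var 11) (Var 12)))) (S3 0) (X * (1 + 3) + 3) (S3 n)"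
  proof (rule runs_for_nat)
    show "runs (Assign 12 (Pair (Var 11) (Var 12))) ((S3 i)(6 := w)) 1 ((S3 (Suc i))(6 := w))" for i w
      using \<sigma> by (intro runs_Assign_to) (auto simp: S3_def l3_def)
  qed (use \<sigma> X in \<open>auto simp: S3_def \<sigma>1_def S2_def\<close>)
  have 8: "runs (Assign 10 Nil_tree) (S3 n) 1 (S4 [])"
    by (intro runs_Assign_to) (auto simp: S4_def)
  have 9: "runs (for_each (Var 7) (Assign 10 (Pair (Head (Var 6)) (Var 10)))) (S4 []) (X * (1 + 3) + 3) (S4 (rev gs))"
  proof (rule runs_for_each[where f = enc_gate])
    show "runs (Assign 10 (Pair (Head (Var 6)) (Var 10))) ((S4 hs)(6 := Node (enc_gate h) w)) 1
       ((S4 (hs @ [h]))(6 := Node (enc_gate h) w))" for hs h w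
      by (intro runs_Assign_to) (auto simp: S4_def)
  qed (use \<sigma> X in \<open>auto simp: S4_def S3_def \<sigma>1_def S2_def\<close>)
  have 10: "runs (Assign 0 (Pair (Var 10) (Var 12))) (S4 (rev gs)) 1 \<sigma>2"
    by (intro runs_Assign_to) (auto simp: S4_def S3_def \<sigma>2_def enc_circuit_def)
  have "runs assemble \<sigma> (25 * X + 40) \<sigma>2"
    unfolding assemble_def
    by (rule runs_mono, (rule runs_block_Cons[OF 1] runs_block_Cons[OF 2] runs_block_Cons[OF 3]
      runs_block_Cons[OF 4] runs_block_Cons[OF 5] runs_block_Cons[OF 6] runs_block_Cons[OF 7]
      runs_block_Cons[OF 8] runs_block_Cons[OF 9] runs_block_Cons[OF 10] runs_block_Nil)+) (simp add: algebra_simps)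
  moreover have "\<sigma>2 0 = enc_circuit (gs, replicate n (b + n) @ map (\<lambda>t. 4 * (length as - 1 - t)) [0..<length as] @
      replicate r b @ [length gs - 1])"
    by (simp add: \<sigma>2_def l3_def l2_def l1_def)
  ultimately show ?thesis by blast
qed


section \<open>The reduction\<close>

lemma sum_list_le: "(\<And>x. x \<in> set xs \<Longrightarrow> x \<le> c) \<Longrightarrow> sum_list xs \<le> length xs * (c::nat)"
  by (induction xs) (auto intro: add_mono)

text \<open>Depth bounds both the length of an encoded list and each unary number in it; the address
  sum thus has at most \<open>2 * h\<close> terms from gates and \<open>h\<close> from outputs, each
  at most \<open>h\<close>, along with slack for their pairing.\<close>

lemma circuit_bounds:
  assumes "height (enc_circuit (gs, os)) \<le> h"
  shows "length gs \<le> h" "length os \<le> h" "\<And>i j. (i, j) \<in> set gs \<Longrightarrow> i \<le> h \<and> j \<le> h"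
    "\<And>i. i \<in> set os \<Longrightarrow> i \<le> h" "address_sum (gs, os) \<le> 3 * h ^ 2"
proof -
  have h: "height (enc_list enc_gate gs) \<le> h" "height (enc_list enc_nat os) \<le> h"
    using assms by (auto simp: enc_circuit_def)
  show 1: "length gs \<le> h" "length os \<le> h"
    using length_le_height h order_trans by metis+
  show 2: "i \<le> h \<and> j \<le> h" if "(i, j) \<in> set gs" for i j
  proof -
    have "Suc (max i j) \<le> h"
      using order_trans[OF element_height[OF that, of enc_gate] h(1)] by (simp add: enc_gate_def height_enc_nat)
    then show ?thesis by linarith
  qed
  show 3: "i \<le> h" if "i \<in> set os" for i
    using element_height[OF that, of enc_nat] h by (simp add: height_enc_nat)
  have "sum_list (map (\<lambda>(i, j). i + j) gs) \<le> length gs * (2 * h)"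
    using sum_list_le[of "map (\<lambda>(i, j). i + j) gs" "2 * h"] 2 by fastforce
  also have "\<dots> \<le> h * (2 * h)" using 1 by (intro mult_le_mono) auto
  finally have a: "sum_list (map (\<lambda>(i, j). i + j) gs) \<le> 2 * h ^ 2" by (simp add: power2_eq_square)
  have "sum_list os \<le> length os * h" using 3 by (rule sum_list_le)
  also have "\<dots> \<le> h * h" using 1 by (intro mult_le_mono) auto
  finally show "address_sum (gs, os) \<le> 3 * h ^ 2"
    using a by (simp add: address_sum_def power2_eq_square)
qed

definition finish :: com where
  "finish = block [sum_addresses, prepare_addresses, emit_inputs, emit_copy, emit_xors, assemble]"

lemma runs_finish:
  assumes \<tau>: "\<tau> 0 = enc_nat (2 * k + 1)" "\<tau> 4 = enc_nat r" "\<tau> 5 = Leaf" "\<tau> 6 = Leaf" "\<tau> 9 = enc_nat k"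
      "\<tau> 12 = enc_list enc_bool ys" "\<tau> 13 = enc_nat m" "\<tau> 20 = enc_circuit C"
    and m: "m = length ys + 2 * k + 1" and h: "height (enc_circuit C) \<le> h"
    and X: "X = 4 * m + 2 + 6 * h ^ 2 + 5 * h + r"
  shows "\<exists>\<sigma>'. runs finish \<tau> (X * (16 * X + 150) + 200) \<sigma>' \<and>
    \<sigma>' 0 = enc_circuit (complete_gates k m ys C, complete_outs k m r ys C)"
proof -
  obtain gs os where C: "C = (gs, os)" by force
  note b = circuit_bounds[OF h[unfolded C]]
  have hX: "h \<le> X" by (simp add: X)
  have bX: "length gs \<le> X" "length os \<le> X" "\<And>i j. (i, j) \<in> set gs \<Longrightarrow> i \<le> X \<and> j \<le> X"
    "\<And>i. i \<in> set os \<Longrightarrow> i \<le> X"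
    using b hX by (meson order_trans)+
  have mX: "2 * k + 1 \<le> X" "k \<le> X" "m \<le> X" "0 < m" by (simp_all add: X m)
  define z where "z = m + 1 + address_sum C"
  define as where "as = drop m os"
  define g where "g = input_gates k m z ys @ gs"
  have lg: "length g = 2 * m + 2 * z + length gs"
    by (simp add: g_def input_gates_def Let_def m)
  have lx: "length (g @ xor_gates 0 (length g + k) as) = length g + 4 * length as"
    by (simp add: length_xor_gates)
  have z: "z \<le> m + 1 + 3 * h ^ 2" using b by (simp add: z_def C)
  \<comment> \<open>The origin of \<open>X\<close>: the total of
    \<open>2 * m + 2 * z + length gs + 4 * length as\<close> gates, with \<open>z\<close> at most
    \<open>m + 1 + 3 * h ^ 2\<close>. The summand \<open>r\<close> covers the loop over copies of
    the parity bit.\<close>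
  have LX: "length g + 4 * length as \<le> X" using lg z b(1,2) by (simp add: X as_def)
  define \<sigma>1 where "\<sigma>1 = \<tau>(14 := enc_nat z)"
  define \<sigma>2 where "\<sigma>2 = \<sigma>1(15 := enc_nat (2 * k + z), 16 := enc_nat (2 * k + 1 + z + m), 17 := enc_nat (z + m - 1))"
  define \<sigma>3 where "\<sigma>3 = \<sigma>2(21 := enc_list enc_nat as, 11 := Leaf, 18 := enc_nat (length g + k + 4 * length as),
      19 := enc_nat (4 * length as))"
  have 1: "runs sum_addresses \<tau> (X * (12 * X + 16) + 12) \<sigma>1"
    unfolding \<sigma>1_def z_def C
    by (rule runs_sum_addresses) (use \<tau> bX in \<open>auto simp: C\<close>)
  have 2: "runs prepare_addresses \<sigma>1 (12 * X + 30) (emitted \<sigma>2 [])"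
    unfolding \<sigma>2_def by (rule runs_prepare_addresses) (use \<tau> in \<open>auto simp: \<sigma>1_def m X\<close>)
  have 3: "runs emit_inputs (emitted \<sigma>2 []) (31 * X + 40) (emitted \<sigma>2 (input_gates k m z ys))"
    by (rule runs_emit_inputs) (use \<tau> z in \<open>auto simp: \<sigma>1_def \<sigma>2_def m X\<close>)
  have 4: "runs emit_copy (emitted \<sigma>2 (input_gates k m z ys)) (6 * X + 3) (emitted \<sigma>2 g)"
    unfolding g_def by (rule runs_emit_copy) (use \<tau> bX in \<open>auto simp: \<sigma>1_def \<sigma>2_def C\<close>)
  have 5: "runs emit_xors (emitted \<sigma>2 g) (X * (4 * X + 60) + 40) (emitted \<sigma>3 (g @ xor_gates 0 (length g + k) as))"
    unfolding \<sigma>3_def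
    by (rule runs_emit_xors) (use \<tau> bX mX in \<open>auto simp: \<sigma>1_def \<sigma>2_def C as_def\<close>)
  have cg: "complete_gates k m ys C = g @ xor_gates 0 (length g + k) as"
    by (simp add: complete_gates_def Let_def z_def g_def as_def C)
  have "\<exists>\<sigma>'. runs assemble (emitted \<sigma>3 (g @ xor_gates 0 (length g + k) as)) (25 * X + 40) \<sigma>' \<and>
    \<sigma>' 0 = enc_circuit (g @ xor_gates 0 (length g + k) as,
      replicate (2 * k + 1) (length g + k + 4 * length as + (2 * k + 1)) @
      map (\<lambda>t. 4 * (length as - 1 - t)) [0..<length as] @ replicate r (length g + k + 4 * length as) @
      [length (g @ xor_gates 0 (length g + k) as) - 1])"
  proof (rule runs_assemble)
    show "g @ xor_gates 0 (length g + k) as \<noteq> []" using lg by (auto simp: m)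
    show "length (g @ xor_gates 0 (length g + k) as) \<le> X" unfolding lx by (rule LX)
    show "length as \<le> X" using LX by simp
  qed (use \<tau> in \<open>auto simp: \<sigma>1_def \<sigma>2_def \<sigma>3_def emitted_def m X\<close>)
  then obtain \<sigma>' where 6: "runs assemble (emitted \<sigma>3 (g @ xor_gates 0 (length g + k) as)) (25 * X + 40) \<sigma>'"
    and out: "\<sigma>' 0 = enc_circuit (g @ xor_gates 0 (length g + k) as,
      replicate (2 * k + 1) (length g + k + 4 * length as + (2 * k + 1)) @
      map (\<lambda>t. 4 * (length as - 1 - t)) [0..<length as] @ replicate r (length g + k + 4 * length as) @
      [length (g @ xor_gates 0 (length g + k) as) - 1])"
    by blast
  have "length as = length (snd C) - m" by (simp add: as_def C)
  then have "\<sigma>' 0 = enc_circuit (complete_gates k m ys C, complete_outs k m r ys C)"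
    unfolding out complete_outs_def Let_def cg lx by (simp add: add_ac)
  moreover have "runs finish \<tau> (X * (16 * X + 150) + 200) \<sigma>'"
    unfolding finish_def
    by (rule runs_mono, (rule runs_block_Cons[OF 1] runs_block_Cons[OF 2] runs_block_Cons[OF 3]
      runs_block_Cons[OF 4] runs_block_Cons[OF 5] runs_block_Cons[OF 6] runs_block_Nil)+) (simp add: algebra_simps)
  ultimately show ?thesis by blast
qed

text \<open>The padding is drawn only after the learner has halted, hence independently of its
  circuit.\<close>

definition postprocess :: com where
  "postprocess = Sequence (Assign 12 Nil_tree) (Sequence (Assign 10 (Var 3)) (Sequence (prepend_bits 12) finish))"

lemma halts_postprocess:
  assumes \<tau>: "\<tau> 0 = enc_nat (2 * k + 1)" "\<tau> 3 = enc_nat p" "\<tau> 4 = enc_nat r" "\<tau> 5 = Leaf" "\<tau> 6 = Leaf"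
      "\<tau> 9 = enc_nat k" "\<tau> 13 = enc_nat (p + (2 * k + 1))" "\<tau> 20 = enc_circuit C"
    and h: "height (enc_circuit C) \<le> h" and X: "X = 4 * (p + (2 * k + 1)) + 2 + 6 * h ^ 2 + 5 * h + r"
  shows "(\<Sum>ys\<in>bits p. of_bool (good (completion k p r C ys))) / 2 ^ p \<le>
    halts P (6 * p + 6 + (X * (16 * X + 150) + 200)) (\<lambda>\<sigma>. \<exists>C. \<sigma> 0 = enc_circuit C \<and> good C) ([postprocess], \<tau>)"
proof -
  let ?G = "\<lambda>\<sigma> :: store. \<exists>C. \<sigma> 0 = enc_circuit C \<and> good C" and ?T = "X * (16 * X + 150) + 200"
  let ?\<tau> = "\<tau>(12 := Leaf, 10 := enc_nat p)"
  have "(\<Sum>ys\<in>bits p. of_bool (good (completion k p r C ys))) / 2 ^ p \<le>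
      halts P (6 * p + 1 + ?T) ?G (prepend_bits 12 # [finish], ?\<tau>)"
  proof (rule halts_prepend_bits[where x = "[]"])
    fix ys \<tau>'
    assume ys: "ys \<in> bits p" and same: "\<And>u. u \<notin> {10, 11, 12} \<Longrightarrow> \<tau>' u = ?\<tau> u"
      and 12: "\<tau>' 12 = enc_list enc_bool (ys @ [])"
    have \<tau>': "\<tau>' u = \<tau> u" if "u \<notin> {10, 11, 12}" for u using same[OF that] that by simp
    have len: "length ys = p" using ys by (simp add: bits_def)
    obtain \<sigma>' where \<sigma>': "runs finish \<tau>' ?T \<sigma>'"
        "\<sigma>' 0 = enc_circuit (complete_gates k (p + (2 * k + 1)) ys C, complete_outs k (p + (2 * k + 1)) r ys C)"
      using runs_finish[of \<tau>' k r ys "p + (2 * k + 1)" C h X] \<tau> 12 h X len by (auto simp: \<tau>')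
    have "\<sigma>' 0 = enc_circuit (completion k p r C ys)"
      using \<sigma>'(2) by (simp add: completion_def add.assoc)
    then have "of_bool (good (completion k p r C ys)) \<le> halts P 0 ?G ([], \<sigma>')"
      by (auto simp: halts_0 of_bool_def simp del: split_paired_Ex split_paired_All)
    also have "\<dots> \<le> halts P (?T + 0) ?G ([finish], \<tau>')" by (rule halts_runs[OF \<sigma>'(1)])
    finally show "of_bool (good (completion k p r C ys)) \<le> halts P ?T ?G ([finish], \<tau>')" by simp
  qed auto
  also have "\<dots> = halts P (Suc (Suc (Suc (Suc (Suc (6 * p + 1 + ?T)))))) ?G ([postprocess], \<tau>)"
    using \<tau> by (simp only: postprocess_def halts_Sequence halts_Assign) simp
  also have "Suc (Suc (Suc (Suc (Suc (6 * p + 1 + ?T))))) = 6 * p + 6 + ?T" by simp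
  finally show ?thesis .
qed

section \<open>Polynomial bounds in three arguments\<close>

definition poly_bounded :: "(nat \<Rightarrow> nat \<Rightarrow> nat \<Rightarrow> nat) \<Rightarrow> bool" where
  "poly_bounded f \<longleftrightarrow> (\<exists>a b. \<forall>x y z. f x y z \<le> a * (x + y + z + 1) ^ b)"

lemma poly_bounded_const: "poly_bounded (\<lambda>x y z. c)"
  unfolding poly_bounded_def by (intro exI[of _ c] exI[of _ 0]) simp

lemma poly_bounded_args:
  "poly_bounded (\<lambda>x y z. x)" "poly_bounded (\<lambda>x y z. y)" "poly_bounded (\<lambda>x y z. z)"
  unfolding poly_bounded_def by (intro exI[of _ 1]; simp)+

lemma poly_bounded_mult:
  assumes "poly_bounded f" "poly_bounded g"
  shows "poly_bounded (\<lambda>x y z. f x y z * g x y z)"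
proof -
  obtain a b a' b' where *: "f x y z \<le> a * (x + y + z + 1) ^ b" "g x y z \<le> a' * (x + y + z + 1) ^ b'" for x y z
    using assms by (auto simp: poly_bounded_def)
  have "f x y z * g x y z \<le> a * a' * (x + y + z + 1) ^ (b + b')" for x y z
    using mult_le_mono[OF *(1)[of x y z] *(2)[of x y z]] by (simp add: power_add mult_ac)
  then show ?thesis unfolding poly_bounded_def by blast
qed

text \<open>The base is at least 1, so both powers are below the one with the sum of the
  exponents.\<close>

lemma poly_bounded_add:
  assumes "poly_bounded f" "poly_bounded g"
  shows "poly_bounded (\<lambda>x y z. f x y z + g x y z)"
proof -
  obtain a b a' b' where *: "f x y z \<le> a * (x + y + z + 1) ^ b" "g x y z \<le> a' * (x + y + z + 1) ^ b'" for x y z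
    using assms by (auto simp: poly_bounded_def)
  have "f x y z + g x y z \<le> (a + a') * (x + y + z + 1) ^ (b + b')" for x y z
  proof -
    let ?s = "x + y + z + 1"
    have "?s ^ b \<le> ?s ^ (b + b')" "?s ^ b' \<le> ?s ^ (b + b')" by (intro power_increasing; simp)+
    then have "a * ?s ^ b + a' * ?s ^ b' \<le> a * ?s ^ (b + b') + a' * ?s ^ (b + b')"
      by (intro add_mono mult_le_mono2)
    then show ?thesis unfolding distrib_right by (rule order_trans[OF add_mono[OF *]])
  qed
  then show ?thesis unfolding poly_bounded_def by blast
qed

lemma poly_bounded_power: "poly_bounded f \<Longrightarrow> poly_bounded (\<lambda>x y z. f x y z ^ n)"
  by (induction n) (simp_all add: poly_bounded_const poly_bounded_mult)

lemmas poly_bounded_intros =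
  poly_bounded_const poly_bounded_args poly_bounded_mult poly_bounded_add poly_bounded_power

lemma ceiling_inverse:
  assumes "0 < \<epsilon>" "\<epsilon> \<le> (1::real)"
  shows "1 / \<epsilon> \<le> real (nat \<lceil>1 / \<epsilon>\<rceil>)" "real (nat \<lceil>1 / \<epsilon>\<rceil>) \<le> 1 / \<epsilon> + 1" "0 < nat \<lceil>1 / \<epsilon>\<rceil>"
proof -
  have "0 < 1 / \<epsilon>" using assms by simp
  then show "1 / \<epsilon> \<le> real (nat \<lceil>1 / \<epsilon>\<rceil>)" "real (nat \<lceil>1 / \<epsilon>\<rceil>) \<le> 1 / \<epsilon> + 1" "0 < nat \<lceil>1 / \<epsilon>\<rceil>"
    by linarith+
qed

text \<open>The learner may fail with probability \<delta>/2 and the random padding with another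
  \<delta>/2; all other parts are deterministic.\<close>

lemma learnable_reduction:
  assumes c: "0 < c" and \<eta>: "0 < \<eta>" "\<eta> < 1 / 2" and learn: "efficiently_learnable (iqp_class c)"
  shows "efficiently_learnable (noisy_parity_class \<eta>)"
proof -
  obtain prog a d where prog_learns: "\<forall>N\<ge>1. \<forall>P\<in>iqp_class c N. \<forall>\<epsilon> \<delta> :: real. 0 < \<epsilon> \<and> \<epsilon> \<le> 1 \<and> 0 < \<delta> \<and> \<delta> \<le> 1 \<longrightarrow>
      (\<exists>T :: nat. real T \<le> real a * (real N + 1 / \<epsilon> + 1 / \<delta>) ^ d \<and>
        1 - \<delta> \<le> measure_pmf.prob (steps P T ([prog], initial_store N \<epsilon> \<delta>)) (halted_with_evaluator N P \<epsilon>))"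
    using learn unfolding efficiently_learnable_def by (elim exE) (rule that)
  have prog: "\<And>M P \<epsilon> \<delta>. 1 \<le> M \<Longrightarrow> P \<in> iqp_class c M \<Longrightarrow> 0 < \<epsilon> \<Longrightarrow> \<epsilon> \<le> 1 \<Longrightarrow> 0 < \<delta> \<Longrightarrow> \<delta> \<le> 1 \<Longrightarrow>
      \<exists>T :: nat. real T \<le> real a * (real M + 1 / \<epsilon> + 1 / \<delta>) ^ d \<and>
        1 - \<delta> \<le> measure_pmf.prob (steps P T ([prog], initial_store M \<epsilon> \<delta>)) (halted_with_evaluator M P \<epsilon>)"
    using prog_learns by simp
  define r where "r = nat \<lceil>1 / c\<rceil>"
  \<comment> \<open>Makes \<open>3 / (\<eta> * R * \<epsilon>)\<close> at most
    \<open>\<delta> / 2\<close> for \<open>R = K * (e * f)\<close>, with \<open>e\<close> and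
    \<open>f\<close> the rounded inverses of \<epsilon> and \<delta>.\<close>
  define K where "K = nat \<lceil>6 / \<eta>\<rceil>"
  have cr: "1 \<le> c * real r" 
  proof -
    have "c * (1 / c) \<le> c * real r"
      unfolding r_def using c by (intro mult_left_mono real_nat_ceiling_ge) auto
    then show ?thesis using c by simp
  qed
  have K: "6 / \<eta> \<le> real K" "0 < K" using \<eta> unfolding K_def by (simp_all add: real_nat_ceiling_ge)
  \<comment> \<open>The arguments stand for \<open>N\<close> and the rounded inverses of \<epsilon>
    and \<delta>. \<open>XP\<close> bounds the numbers in the preparation, \<open>L\<close> the sum
    of the learner's parameters, \<open>T1\<close> its time, \<open>h\<close> the depth of its
    circuit, \<open>XF\<close> the loops of the completion.\<close>
  define XP where "XP n e f = n + n ^ r + e + f + e * f + K" for n e f :: nat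
  define TP where "TP n e f = (r + 2) * (XP n e f * (4 * XP n e f + 6) + 12) + 12 * XP n e f + 40" for n e f
  define L where "L n e f = (n ^ r + n) + K * (e * f) + (f + f)" for n e f :: nat
  define T1 where "T1 n e f = a * L n e f ^ d" for n e f
  define h where "h n e f = L n e f + 1 + com_size prog * T1 n e f" for n e f
  define XF where "XF n e f = 4 * (n ^ r + n) + 2 + 6 * h n e f ^ 2 + 5 * h n e f + K * (e * f)" for n e f
  define T2 where "T2 n e f = 6 * n ^ r + 6 + (XF n e f * (16 * XF n e f + 150) + 200)" for n e f
  define T where "T n e f = Suc (TP n e f + Suc ((6 * n ^ r + 5) * T1 n e f + T2 n e f))" for n e f
  have XP: "poly_bounded XP" unfolding XP_def by (intro poly_bounded_intros)
  have TP: "poly_bounded TP" unfolding TP_def by (intro poly_bounded_intros XP)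
  have L: "poly_bounded L" unfolding L_def by (intro poly_bounded_intros)
  have T1: "poly_bounded T1" unfolding T1_def by (intro poly_bounded_intros L)
  have h: "poly_bounded h" unfolding h_def by (intro poly_bounded_intros L T1)
  have XF: "poly_bounded XF" unfolding XF_def by (intro poly_bounded_intros h)
  have T2: "poly_bounded T2" unfolding T2_def by (intro poly_bounded_intros XF)
  have "poly_bounded T" unfolding T_def Suc_eq_plus1 by (intro poly_bounded_intros TP T1 T2)
  then obtain A B where T: "\<And>n e f. T n e f \<le> A * (n + e + f + 1) ^ B"
    unfolding poly_bounded_def by blast
  define program where "program = Sequence (prepare r K) (Sequence (simulate prog) postprocess)"
  show ?thesis
    unfolding efficiently_learnable_def
  proof (rule exI[of _ program], rule exI[of _ "A * 2 ^ B"], rule exI[of _ B], intro allI impI ballI)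
    fix N :: nat and P and \<epsilon> \<delta> :: real
    assume "1 \<le> N" and P: "P \<in> noisy_parity_class \<eta> N" and "0 < \<epsilon> \<and> \<epsilon> \<le> 1 \<and> 0 < \<delta> \<and> \<delta> \<le> (1::real)"
    then have \<epsilon>: "0 < \<epsilon>" "\<epsilon> \<le> 1" and \<delta>: "0 < \<delta>" "\<delta> \<le> 1" by auto
    obtain k s P\<^sub>0 where k: "1 \<le> k" "N = 2 * k + 1" and s: "s \<in> bits k" and np: "noisy_parity s \<eta> P\<^sub>0"
      and Pk: "P = product_dist P\<^sub>0 (uniform_bits k)"
      using P unfolding noisy_parity_class_def by blast
    define e where "e = nat \<lceil>1 / \<epsilon>\<rceil>"
    define f where "f = nat \<lceil>1 / \<delta>\<rceil>"
    note e = ceiling_inverse[OF \<epsilon>, folded e_def] and f = ceiling_inverse[OF \<delta>, folded f_def]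
    define p where "p = N ^ r"
    define M where "M = p + (2 * k + 1)"
    define R where "R = K * (e * f)"
    define P' where "P' = product_dist (uniform_bits p) P"
    have R: "0 < R" using K e f by (simp add: R_def)
    have supp: "set_pmf P \<subseteq> bits N"
      using set_pmf_noisy_product[OF s np Pk \<eta>] k by simp
    have supp': "set_pmf P' \<subseteq> bits M"
      using set_pmf_product_dist[of "uniform_bits p" p P N] supp by (simp add: P'_def M_def k set_pmf_uniform_bits)
    have P': "P' \<in> iqp_class c M"
      unfolding P'_def Pk M_def
    proof (rule padded_noisy_parity_in_iqp_class[OF s np])
      \<comment> \<open>The exponent \<open>c * r\<close> is at least 1; this is the only use of the
        padding length for the gate count.\<close>
      have "real N \<le> real N powr (c * real r)" using cr k powr_mono[of 1 "c * real r" "real N"] by simp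
      also have "\<dots> = real p powr c"
        using k by (simp add: p_def powr_powr mult.commute flip: powr_realpow)
      also have "\<dots> \<le> real (p + (2 * k + 1)) powr c" using c by (intro powr_mono2) auto
      finally show "real k \<le> real (p + (2 * k + 1)) powr c" using k by simp
    qed (use \<eta> in auto)
    have "1 / real R \<le> 1" "1 / real (f + f) \<le> 1" using R f by simp_all
    then obtain T0 :: nat where T0: "real T0 \<le> real a * (real M + 1 / (1 / real R) + 1 / (1 / real (f + f))) ^ d"
      and good0: "1 - 1 / real (f + f) \<le> measure_pmf.prob
        (steps P' T0 ([prog], initial_store M (1 / real R) (1 / real (f + f)))) (halted_with_evaluator M P' (1 / real R))"
      using prog[OF _ P', of "1 / real R" "1 / real (f + f)"] R f by (auto simp: M_def)
    \<comment> \<open>Accuracy and confidence are inverses of integers, so rounding hands the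
      learner exactly \<open>R\<close> and \<open>f + f\<close>.\<close>
    have inv: "nat \<lceil>1 / (1 / real n)\<rceil> = n" for n by simp
    define \<sigma> where "\<sigma> = initial_store M (1 / real R) (1 / real (f + f))"
    define G' where "G' = (\<lambda>\<sigma> :: store. \<exists>C. \<sigma> 0 = enc_circuit C \<and> good_evaluator M P' (1 / real R) C)"
    have "real T0 \<le> real (T1 N e f)"
      using T0 by (simp add: T1_def L_def M_def R_def p_def k add_ac)
    then have "T0 \<le> T1 N e f" by simp
    have "1 - \<delta> / 2 \<le> 1 - 1 / real (f + f)"
      using f \<delta> by (simp add: field_simps)
    also have "\<dots> \<le> halts P' T0 G' ([prog], \<sigma>)"
      using good0 by (simp add: halts_def halted_with_evaluator_def G'_def \<sigma>_def)
    also have "\<dots> \<le> halts P' (T1 N e f) G' ([prog], \<sigma>)" by (rule halts_mono) fact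
    also have "\<dots> = halts P' (T1 N e f)
        (\<lambda>\<sigma>'. G' \<sigma>' \<and> height (\<sigma>' 0) \<le> (L N e f + 1) + com_size prog * T1 N e f) ([prog], \<sigma>)"
    proof (rule halts_height[OF supp'])
      show "height (\<sigma> v) \<le> L N e f + 1" for v
        unfolding \<sigma>_def initial_store_def inv by (simp add: height_enc_nat L_def M_def p_def R_def k)
      show "M + 1 \<le> L N e f + 1" by (simp add: L_def M_def p_def k)
    qed
    finally have good1: "1 - \<delta> / 2 \<le> halts P' (T1 N e f) (\<lambda>\<sigma>'. G' \<sigma>' \<and> height (\<sigma>' 0) \<le> h N e f) ([prog], \<sigma>)"
      by (simp add: h_def)
    let ?G = "\<lambda>\<sigma> :: store. \<exists>C. \<sigma> 0 = enc_circuit C \<and> good_evaluator N P \<epsilon> C"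
    define \<tau>\<^sub>0 where "\<tau>\<^sub>0 = (initial_store N \<epsilon> \<delta>)(3 := enc_nat p, 4 := enc_nat R, 13 := enc_nat M, 9 := enc_nat k,
       20 := enc_nat M, 21 := enc_nat R, 22 := enc_nat (f + f))"
    have sim: "simulates \<tau>\<^sub>0 \<sigma> \<tau>\<^sub>0"
      unfolding \<sigma>_def \<tau>\<^sub>0_def initial_store_def inv by (auto simp: simulates_def)
    have init: "initial_store N \<epsilon> \<delta> = (\<lambda>_. Leaf)(0 := enc_nat N, 1 := enc_nat e, 2 := enc_nat f)"
      by (simp add: initial_store_def e_def f_def)
    have prep: "runs (prepare r K) (initial_store N \<epsilon> \<delta>) (TP N e f) \<tau>\<^sub>0"
      unfolding TP_def \<tau>\<^sub>0_def R_def M_def init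
      by (rule runs_prepare) (auto simp: k XP_def p_def)
    have small: "3 / (\<eta> * real R * \<epsilon>) \<le> \<delta> / 2"
    proof -
      have "6 \<le> \<eta> * real K" "1 \<le> real e * \<epsilon>" "1 \<le> real f * \<delta>"
        using K e f \<eta> \<epsilon> \<delta> by (simp_all add: field_simps)
      then have "6 * (1 * 1) \<le> (\<eta> * real K) * ((real e * \<epsilon>) * (real f * \<delta>))"
        by (intro mult_mono) auto
      then show ?thesis using \<eta> \<epsilon> R by (simp add: field_simps R_def)
    qed
    have post: "1 - \<delta> / 2 \<le> halts P (T2 N e f) ?G ([postprocess], \<tau>)"
      if acc: "G' \<sigma>' \<and> height (\<sigma>' 0) \<le> h N e f" and "simulates \<tau>\<^sub>0 \<sigma>' \<tau>" for \<sigma>' \<tau>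
    proof -
      obtain C where C: "\<sigma>' 0 = enc_circuit C" "good_evaluator M P' (1 / real R) C"
        using acc unfolding G'_def by blast
      have \<tau>: "\<tau> v = \<tau>\<^sub>0 v" if "v < 20" "v \<noteq> 10" "v \<noteq> 11" for v
        using \<open>simulates \<tau>\<^sub>0 \<sigma>' \<tau>\<close> that by (simp add: simulates_def)
      have \<tau>20: "\<tau> 20 = enc_circuit C"
        using \<open>simulates \<tau>\<^sub>0 \<sigma>' \<tau>\<close> C unfolding simulates_def by (metis add_0)
      have "1 - \<delta> / 2 \<le> 1 - 3 / (\<eta> * real R * \<epsilon>)" using small by simp
      also have "\<dots> \<le> (\<Sum>ys\<in>bits p. of_bool (good_evaluator (2 * k + 1) P \<epsilon> (completion k p R C ys))) / 2 ^ p"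
        by (rule good_completions[OF s np Pk \<eta> _ R \<epsilon>(1)]) (use C in \<open>simp add: M_def P'_def\<close>)
      also have "\<dots> \<le> halts P (T2 N e f) ?G ([postprocess], \<tau>)"
        unfolding T2_def k(2)[symmetric] p_def[symmetric]
        by (rule halts_postprocess[where h = "h N e f"])
          (use \<tau>20 acc C in \<open>auto simp: \<tau> \<tau>\<^sub>0_def initial_store_def M_def XF_def R_def p_def k\<close>)
      finally show ?thesis .
    qed
    \<comment> \<open>The learner's success times the padding's success.\<close>
    have "1 - \<delta> \<le> (1 - \<delta> / 2) * (1 - \<delta> / 2)" by (simp add: algebra_simps)
    also have "\<dots> \<le> (1 - \<delta> / 2) * halts P' (T1 N e f) (\<lambda>\<sigma>'. G' \<sigma>' \<and> height (\<sigma>' 0) \<le> h N e f) ([prog], \<sigma>)"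
      using good1 \<delta> by (intro mult_left_mono) auto
    also have "\<dots> \<le> halts P ((6 * p + 5) * T1 N e f + T2 N e f) ?G (map simulate [prog] @ [postprocess], \<tau>\<^sub>0)"
      unfolding P'_def
      by (rule halts_simulate[OF supp _ post[unfolded P'_def] _ sim]) (use \<delta> in \<open>auto simp: \<tau>\<^sub>0_def\<close>)
    also have "\<dots> = halts P (Suc ((6 * p + 5) * T1 N e f + T2 N e f)) ?G ([Sequence (simulate prog) postprocess], \<tau>\<^sub>0)"
      by (simp add: halts_Sequence)
    also have "\<dots> \<le> halts P (TP N e f + Suc ((6 * p + 5) * T1 N e f + T2 N e f)) ?G
        ([prepare r K, Sequence (simulate prog) postprocess], initial_store N \<epsilon> \<delta>)"
      by (rule halts_runs[OF prep])
    also have "\<dots> = halts P (T N e f) ?G ([program], initial_store N \<epsilon> \<delta>)"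
      by (simp add: T_def program_def halts_Sequence p_def)
    finally have final: "1 - \<delta> \<le> measure_pmf.prob (steps P (T N e f) ([program], initial_store N \<epsilon> \<delta>))
        (halted_with_evaluator N P \<epsilon>)"
      by (simp add: halts_def halted_with_evaluator_def)
    let ?S = "real N + 1 / \<epsilon> + 1 / \<delta>"
    have "1 \<le> 1 / \<epsilon>" "1 \<le> 1 / \<delta>" using \<epsilon> \<delta> by simp_all
    \<comment> \<open>Rounding twice and the summand 1 add at most 3, and \<open>?S\<close> is at
      least 3; hence the factor \<open>2 ^ B\<close>.\<close>
    then have "real (N + e + f + 1) \<le> 2 * ?S" using e(2) f(2) k by simp
    then have "real (N + e + f + 1) ^ B \<le> (2 * ?S) ^ B" by (intro power_mono) auto
    then have "real A * real (N + e + f + 1) ^ B \<le> real A * (2 * ?S) ^ B" by (intro mult_left_mono) auto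
    moreover have "real (T N e f) \<le> real A * real (N + e + f + 1) ^ B"
      using T[of N e f] by (metis of_nat_le_iff of_nat_mult of_nat_power)
    ultimately have "real (T N e f) \<le> real A * (2 * ?S) ^ B" by (rule order_trans[rotated])
    also have "\<dots> = real (A * 2 ^ B) * ?S ^ B"
      by (simp only: power_mult_distrib of_nat_mult of_nat_power of_nat_numeral mult.assoc)
    finally have "real (T N e f) \<le> real (A * 2 ^ B) * ?S ^ B" .
    with final show "\<exists>T :: nat. real T \<le> real (A * 2 ^ B) * (real N + 1 / \<epsilon> + 1 / \<delta>) ^ B \<and>
        1 - \<delta> \<le> measure_pmf.prob (steps P T ([program], initial_store N \<epsilon> \<delta>)) (halted_with_evaluator N P \<epsilon>)"
      by blast
  qed
qed

theorem proposition4: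
  assumes "\<exists>\<eta>::real. 0 < \<eta> \<and> \<eta> < 1 / 2 \<and> \<not> efficiently_learnable (noisy_parity_class \<eta>)"
  shows "\<forall>c::real. 0 < c \<longrightarrow> \<not> efficiently_learnable (iqp_class c)"
  using assms learnable_reduction by blast

end
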